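(* Let $0<q<m$ be coprime integers. Assume that $\frac1m(1,q)$ admits an involution $\tau$ such that $\frac1m(1,q)/\langle\tau\rangle$ is either a cyclic quotient singularity $\frac{1}{m_0}(1,q_0)$ or a nonsingular point. Then the quotient is one of: (a) a nonsingular point, which can happen only when $q=m-1$; (b) $m_0=2m$ and $q_0\in\{q,\,m+q\}$; (c) $m_0=m$ and $q_0=2q$; (d) $m_0=m/2$ and $q_0=q$; (e) $m_0=\frac{m}{\gcd(q+1,m)}$ and $q_0=\frac{q+1}{\gcd(q+1,m)}$, which happens only when $q^2\equiv1\pmod m$ and $q\ne m-1$.
   Context: For coprime $0<q<m$, $\frac1m(1,q)$ denotes the cyclic quotient singularity, the germ at the origin of $\mathbb{C}^2/\mu_m$ where $\zeta$ acts by $(x,y)\mapsto(\zeta x,\zeta^q y)$.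
   Formalization: In (b) and (c), 1/m0(1,q0) means C^2/mu_{m0} with q0 taken mod m0 and not necessarily coprime to m0; with coprimality the list misses 1/5(1,2) modulo (x,y)->(-x,y), which is 1/5(1,1), i.e. the non-reduced 1/10(1,2). *)

theory Defs
  imports "HOL-Analysis.Analysis" "HOL-Number_Theory.Number_Theory"
begin

text \<open>Complex analytic germs are encoded by their local rings of holomorphic
functions (anti-equivalence between germs of complex spaces and analytic algebras).
A bivariate power series sum a i j x^i y^j is a function nat => nat => complex.\<close>

type_synonym ps2 = "nat \<Rightarrow> nat \<Rightarrow> complex"

definition convergent_ps2 :: "ps2 \<Rightarrow> bool" where
  "convergent_ps2 a \<longleftrightarrow>
     (\<exists>r::real. r > 0 \<and> (\<lambda>(i,j). norm (a i j) * r ^ (i + j)) summable_on UNIV)"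

definition ps2_add :: "ps2 \<Rightarrow> ps2 \<Rightarrow> ps2" where
  "ps2_add a b = (\<lambda>i j. a i j + b i j)"

definition ps2_smult :: "complex \<Rightarrow> ps2 \<Rightarrow> ps2" where
  "ps2_smult c a = (\<lambda>i j. c * a i j)"

definition ps2_mult :: "ps2 \<Rightarrow> ps2 \<Rightarrow> ps2" where
  "ps2_mult a b = (\<lambda>i j. \<Sum>k\<le>i. \<Sum>l\<le>j. a k l * b (i - k) (j - l))"

definition ps2_one :: ps2 where
  "ps2_one = (\<lambda>i j. if i = 0 \<and> j = 0 then 1 else 0)"

text \<open>The analytic local ring of the cyclic quotient singularity 1/m(1,q):
the mu_m-invariant convergent power series, where zeta acts by
(x,y) |-> (zeta x, zeta^q y); x^i y^j is invariant iff m divides i + q j.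
For m = 1 (or m dividing q) this is C{x,y}, the ring of a nonsingular point.\<close>

definition cqs_ring :: "nat \<Rightarrow> nat \<Rightarrow> ps2 set" where
  "cqs_ring m q = {a. convergent_ps2 a \<and> (\<forall>i j. a i j \<noteq> 0 \<longrightarrow> m dvd (i + q * j))}"

definition smooth_ring :: "ps2 set" where
  "smooth_ring = {a. convergent_ps2 a}"

text \<open>C-algebra homomorphisms between subalgebras of convergent power series
(morphisms of the corresponding germs, in the opposite direction).\<close>

definition alg_hom :: "ps2 set \<Rightarrow> ps2 set \<Rightarrow> (ps2 \<Rightarrow> ps2) \<Rightarrow> bool" where
  "alg_hom A B f \<longleftrightarrow>
     (\<forall>a\<in>A. f a \<in> B) \<and>
     (\<forall>a\<in>A. \<forall>b\<in>A. f (ps2_add a b) = ps2_add (f a) (f b)) \<and>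
     (\<forall>c. \<forall>a\<in>A. f (ps2_smult c a) = ps2_smult c (f a)) \<and>
     (\<forall>a\<in>A. \<forall>b\<in>A. f (ps2_mult a b) = ps2_mult (f a) (f b)) \<and>
     f ps2_one = ps2_one"

definition alg_iso :: "ps2 set \<Rightarrow> ps2 set \<Rightarrow> bool" where
  "alg_iso A B \<longleftrightarrow> (\<exists>f. alg_hom A B f \<and> bij_betw f A B)"

text \<open>An involution tau of the germ 1/m(1,q) (a non-identity automorphism of
order 2 of its analytic algebra) and the ring of the quotient germ by tau.\<close>

definition is_involution :: "ps2 set \<Rightarrow> (ps2 \<Rightarrow> ps2) \<Rightarrow> bool" where
  "is_involution A t \<longleftrightarrow> alg_hom A A t \<and> (\<forall>a\<in>A. t (t a) = a) \<and> (\<exists>a\<in>A. t a \<noteq> a)"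

definition fixed_ring :: "ps2 set \<Rightarrow> (ps2 \<Rightarrow> ps2) \<Rightarrow> ps2 set" where
  "fixed_ring A t = {a\<in>A. t a = a}"

end

theory Submission
  imports Defs "HOL-Complex_Analysis.Complex_Analysis"
begin

text \<open>
  An algebra homomorphism from the invariant ring \<open>A\<close> of \<open>1/m(1,q)\<close> to \<open>C{x,y}\<close> with finite fibre over the
  origin is substitution of two power series: the images of \<open>x^m\<close> and \<open>y^m\<close> have no common zero off the
  origin and a product of a power of one with the other is an \<open>m\<close>-th power, so both are \<open>m\<close>-th powers.
  Hence the involution lifts to an automorphism of \<open>C{x,y}\<close> normalising \<open>\<mu>\<^sub>m\<close>, and in suitable coordinates the
  lift is linear. If it is diagonal, the fixed monomials form one of the lattices of cases (b)--(d). If it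
  exchanges the axes, then \<open>q\<^sup>2 = 1\<close> modulo \<open>m\<close>; when the extended group contains a pseudo-reflection, the
  lift may be taken to be \<open>x \<leftrightarrow> y\<close>, and the symmetric invariants are power series in \<open>x^d + y^d\<close> and \<open>xy\<close> with
  \<open>d = gcd (q + 1) m\<close>, which gives (a) and (e). Otherwise the group is small and non-abelian, and applying
  the lifting property to the inverse of an isomorphism with a cyclic quotient leads to a contradiction.
\<close>

section \<open>Holomorphic functions of two variables\<close>

text \<open>The involution is given only as an algebra automorphism of the invariant ring: nothing
  says that it is continuous or that it comes from C{x,y}. The lift rests on one relation: with e =
  (m - 1) q, the invariants x^m, y^m and x^e y satisfy (x^m)^e y^m = (x^e y)^m, and e is prime to m,
  so m-th roots of the images can be extracted. Continuity is replaced by the fact that a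
  homomorphism respects the ideals generated by x^(mN) and y^(mN). The lift is an involution only
  modulo \<mu>_m: its square is diag(\<omega>, \<omega>^q) with \<omega>^m = 1. Eigenvalues are
  therefore square roots of powers of \<omega>, which is how \<open>2 * m\<close> arises. The
  invariant monomials with even y-exponent account for (c) and (d) alike: for even m, m | i + 2 q j
  makes i even, and x^2 -> x identifies 1/m(1, 2q) with 1/(m/2)(1, q). If the axes are exchanged,
  the assumption that the quotient is cyclic or smooth excludes the remaining groups; the argument
  compares zero sets of Jacobians instead of local fundamental groups.\<close>

definition polydisc :: "real \<Rightarrow> (complex \<times> complex) set" where
  "polydisc r = ball 0 r \<times> ball 0 r"

text \<open>Separate holomorphy together with continuity suffices for a convergent double power series expansion.\<close>

definition holomorphic2_on :: "(complex \<times> complex \<Rightarrow> complex) \<Rightarrow> (complex \<times> complex) set \<Rightarrow> bool"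
    (infixl \<open>holomorphic2'_on\<close> 50) where
  "F holomorphic2_on U \<longleftrightarrow> continuous_on U F \<and>
     (\<forall>x y. (x, y) \<in> U \<longrightarrow> (\<lambda>t. F (t, y)) field_differentiable (at x) \<and>
                         (\<lambda>t. F (x, t)) field_differentiable (at y))"

lemma open_polydisc [simp]: "open (polydisc r)"
  by (simp add: polydisc_def open_Times)

lemma mem_polydisc [simp]: "(x, y) \<in> polydisc r \<longleftrightarrow> norm x < r \<and> norm y < r"
  by (simp add: polydisc_def)

lemma polydisc_mono: "r \<le> s \<Longrightarrow> polydisc r \<subseteq> polydisc s"
  by (auto simp: polydisc_def)

lemma polydisc_subset_open:
  assumes "open U" "(0, 0) \<in> U"
  obtains r where "r > 0" "polydisc r \<subseteq> U"
proof -
  obtain A B where AB: "open A" "open B" "(0, 0) \<in> A \<times> B" "A \<times> B \<subseteq> U"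
    using open_prod_elim[OF assms] by metis
  then obtain r1 r2 where r: "r1 > 0" "ball 0 r1 \<subseteq> A" "r2 > 0" "ball 0 r2 \<subseteq> B"
    by (metis mem_Sigma_iff open_contains_ball)
  have "polydisc (min r1 r2) \<subseteq> U"
    using r AB(4) by (force simp: polydisc_def)
  then show ?thesis using that[of "min r1 r2"] r by auto
qed

lemma eventually_nhds_polydisc:
  "(\<forall>\<^sub>F z in nhds (0, 0). P z) \<longleftrightarrow> (\<exists>r>0. \<forall>z\<in>polydisc r. P z)"
proof
  assume "\<forall>\<^sub>F z in nhds (0, 0). P z"
  then obtain U where "open U" "(0, 0) \<in> U" "\<forall>z\<in>U. P z" by (auto simp: eventually_nhds)
  then show "\<exists>r>0. \<forall>z\<in>polydisc r. P z" by (metis polydisc_subset_open subsetD)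
next
  assume "\<exists>r>0. \<forall>z\<in>polydisc r. P z"
  then show "\<forall>\<^sub>F z in nhds (0, 0). P z" unfolding eventually_nhds
    using open_polydisc by (metis mem_polydisc norm_zero)
qed

lemma holomorphic2_on_subset: "F holomorphic2_on U \<Longrightarrow> V \<subseteq> U \<Longrightarrow> F holomorphic2_on V"
  unfolding holomorphic2_on_def using continuous_on_subset by blast

lemma holomorphic2_on_const [simp]: "(\<lambda>z. c) holomorphic2_on U"
  and holomorphic2_on_fst [simp]: "fst holomorphic2_on U"
  and holomorphic2_on_snd [simp]: "snd holomorphic2_on U"
  by (auto simp: holomorphic2_on_def intro!: continuous_intros field_differentiable_ident[unfolded id_def])

lemma holomorphic2_on_add: "F holomorphic2_on U \<Longrightarrow> G holomorphic2_on U \<Longrightarrow> (\<lambda>z. F z + G z) holomorphic2_on U"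
  and holomorphic2_on_diff: "F holomorphic2_on U \<Longrightarrow> G holomorphic2_on U \<Longrightarrow> (\<lambda>z. F z - G z) holomorphic2_on U"
  and holomorphic2_on_mult: "F holomorphic2_on U \<Longrightarrow> G holomorphic2_on U \<Longrightarrow> (\<lambda>z. F z * G z) holomorphic2_on U"
  by (auto simp: holomorphic2_on_def
      intro!: continuous_intros field_differentiable_add field_differentiable_diff field_differentiable_mult)

lemma holomorphic2_on_power: "F holomorphic2_on U \<Longrightarrow> (\<lambda>z. F z ^ n) holomorphic2_on U"
  by (induction n) (auto intro: holomorphic2_on_mult)

lemma holomorphic2_on_sum: "(\<And>i. i \<in> I \<Longrightarrow> F i holomorphic2_on U) \<Longrightarrow> (\<lambda>z. \<Sum>i\<in>I. F i z) holomorphic2_on U"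
  by (induction I rule: infinite_finite_induct) (auto intro: holomorphic2_on_add)

lemma holomorphic2_on_divide:
  "F holomorphic2_on U \<Longrightarrow> G holomorphic2_on U \<Longrightarrow> (\<And>z. z \<in> U \<Longrightarrow> G z \<noteq> 0) \<Longrightarrow> (\<lambda>z. F z / G z) holomorphic2_on U"
  by (auto simp: holomorphic2_on_def intro!: continuous_intros field_differentiable_divide)

lemma holomorphic2_on_slices:
  assumes "F holomorphic2_on polydisc r"
  shows "norm y < r \<Longrightarrow> (\<lambda>t. F (t, y)) holomorphic_on ball 0 r"
    and "norm x < r \<Longrightarrow> (\<lambda>t. F (x, t)) holomorphic_on ball 0 r"
proof -
  have *: "(\<lambda>t. F (t, y)) field_differentiable at x \<and> (\<lambda>t. F (x, t)) field_differentiable at y"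
    if "norm x < r" "norm y < r" for x y
    using assms that by (simp add: holomorphic2_on_def)
  show "norm y < r \<Longrightarrow> (\<lambda>t. F (t, y)) holomorphic_on ball 0 r"
    unfolding holomorphic_on_def using *
    by (intro ballI) (rule field_differentiable_at_within, simp)
  show "norm x < r \<Longrightarrow> (\<lambda>t. F (x, t)) holomorphic_on ball 0 r"
    unfolding holomorphic_on_def using *
    by (intro ballI) (rule field_differentiable_at_within, simp)
qed

text \<open>Weierstrass: the M-test gives uniform convergence, hence continuity, and uniform limits
  of holomorphic slices are holomorphic in each variable.\<close>

lemma holomorphic2_on_infsum:
  assumes F: "\<And>i. i \<in> I \<Longrightarrow> F i holomorphic2_on U" and U: "open U"
    and M: "\<And>i z. i \<in> I \<Longrightarrow> z \<in> U \<Longrightarrow> norm (F i z) \<le> M i" and S: "M summable_on I"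
  shows "(\<lambda>z. \<Sum>\<^sub>\<infinity>i\<in>I. F i z) holomorphic2_on U"
proof -
  let ?S = "\<lambda>z. \<Sum>\<^sub>\<infinity>i\<in>I. F i z"
  have lim: "uniform_limit U (\<lambda>X z. \<Sum>i\<in>X. F i z) ?S (finite_subsets_at_top I)"
    by (rule Weierstrass_m_test_general[OF _ S]) (rule M)
  have nt: "finite_subsets_at_top I \<noteq> bot" by simp
  have fin: "\<forall>\<^sub>F X in finite_subsets_at_top I. (\<lambda>z. \<Sum>i\<in>X. F i z) holomorphic2_on U"
    unfolding eventually_finite_subsets_at_top
    by (rule exI[of _ "{}"]) (simp add: holomorphic2_on_sum F subset_iff)
  have cont: "continuous_on U ?S"
    by (rule uniform_limit_theorem[OF _ lim nt], rule eventually_mono[OF fin]) (auto simp: holomorphic2_on_def)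
  have *: "(\<lambda>t. ?S (t, y)) field_differentiable (at x) \<and> (\<lambda>t. ?S (x, t)) field_differentiable (at y)"
    if xy: "(x, y) \<in> U" for x y
  proof -
    obtain A B where AB: "open A" "open B" "(x, y) \<in> A \<times> B" "A \<times> B \<subseteq> U"
      using open_prod_elim[OF U xy] by metis
    then obtain r1 r2 where r: "r1 > 0" "cball x r1 \<subseteq> A" "r2 > 0" "cball y r2 \<subseteq> B"
      by (metis mem_Sigma_iff open_contains_cball)
    have sub: "(t, y) \<in> U" if "t \<in> cball x r1" for t using AB r that by auto
    have sub': "(x, t) \<in> U" if "t \<in> cball y r2" for t using AB r that by auto
    have l1: "uniform_limit (cball x r1) (\<lambda>X t. \<Sum>i\<in>X. F i (t, y)) (\<lambda>t. ?S (t, y)) (finite_subsets_at_top I)"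
      by (rule uniform_limit_compose'[OF lim]) (use sub in auto)
    have l2: "uniform_limit (cball y r2) (\<lambda>X t. \<Sum>i\<in>X. F i (x, t)) (\<lambda>t. ?S (x, t)) (finite_subsets_at_top I)"
      by (rule uniform_limit_compose'[OF lim]) (use sub' in auto)
    have hol: "(\<lambda>t. G (t, y)) holomorphic_on cball x r1" "(\<lambda>t. G (x, t)) holomorphic_on cball y r2"
      if "G holomorphic2_on U" for G
      using that sub sub' unfolding holomorphic2_on_def holomorphic_on_def
      by (auto intro!: field_differentiable_at_within[of _ _ "cball _ _"])
    have "(\<lambda>t. ?S (t, y)) holomorphic_on ball x r1"
      apply (rule holomorphic_uniform_limit[OF _ l1 nt])
       apply (rule eventually_mono[OF fin])
       apply (drule hol(1), use ball_subset_cball holomorphic_on_imp_continuous_on holomorphic_on_subset in blast)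
      apply assumption done
    moreover have "(\<lambda>t. ?S (x, t)) holomorphic_on ball y r2"
      apply (rule holomorphic_uniform_limit[OF _ l2 nt])
       apply (rule eventually_mono[OF fin])
       apply (drule hol(2), use ball_subset_cball holomorphic_on_imp_continuous_on holomorphic_on_subset in blast)
      apply assumption done
    ultimately show ?thesis
      using r by (meson centre_in_ball holomorphic_on_imp_differentiable_at open_ball)
  qed
  then show ?thesis using cont by (auto simp: holomorphic2_on_def)
qed

section \<open>Contour integrals depending on a parameter\<close>

lemma continuous_on_contour_integral_param:
  assumes "continuous_on (U \<times> sphere 0 r) k" "0 \<le> r"
  shows "continuous_on U (\<lambda>x. contour_integral (circlepath 0 r) (\<lambda>w. k (x, w)))"
proof -
  have "continuous_on (U \<times> cbox 0 1) (\<lambda>z. k (fst z, circlepath 0 r (snd z)))"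
    by (rule continuous_on_compose2[OF assms(1)])
      (use assms(2) in \<open>auto intro!: continuous_intros simp: circlepath norm_mult\<close>)
  then have "continuous_on (U \<times> cbox 0 1)
      (\<lambda>(x, t). k (x, circlepath 0 r t) * (2 * of_real pi * \<i> * r * exp (2 * of_real pi * \<i> * t)))"
    by (auto simp: case_prod_unfold intro!: continuous_intros)
  from integral_continuous_on_param[OF this] show ?thesis
    by (simp add: contour_integral_integral vector_derivative_circlepath)
qed

text \<open>Fubini: writing \<open>k (x, w)\<close> by Cauchy's formula on the circle of radius
  \<open>r\<close> and exchanging the two contour integrals shows that the integral over
  \<open>w\<close> satisfies Cauchy's formula in \<open>x\<close> itself, and a Cauchy integral of
  continuous data is differentiable.\<close>

lemma holomorphic_contour_integral_param:
  assumes k: "continuous_on (cball 0 r \<times> sphere 0 s) k"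
    and hol: "\<And>w. w \<in> sphere 0 s \<Longrightarrow> (\<lambda>x. k (x, w)) holomorphic_on ball 0 r"
    and r: "0 < r" and s: "0 < s"
  shows "(\<lambda>x. contour_integral (circlepath 0 s) (\<lambda>w. k (x, w))) holomorphic_on ball 0 r"
proof -
  let ?c = "\<lambda>x. contour_integral (circlepath 0 s) (\<lambda>w. k (x, w))"
  have contc: "continuous_on (cball 0 r) ?c"
    using continuous_on_contour_integral_param[OF k] s by simp
  have ps: "path_image (circlepath 0 r) = sphere 0 r" "path_image (circlepath 0 s) = sphere 0 s"
    using r s by auto
  have slice: "continuous_on (cball 0 r) (\<lambda>x. k (x, w))" if "w \<in> sphere 0 s" for w
    by (rule continuous_on_compose2[OF k]) (use that in \<open>auto intro!: continuous_intros\<close>)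
  have int: "((\<lambda>u. ?c u / (u - x) ^ 1) has_contour_integral 2 * of_real pi * \<i> * ?c x) (circlepath 0 r)"
    if x: "x \<in> ball 0 r" for x
  proof -
    have "continuous_on (sphere 0 r) (\<lambda>u. ?c u / (u - x))"
      using x by (auto intro!: continuous_intros continuous_on_subset[OF contc])
    then have I: "(\<lambda>u. ?c u / (u - x)) contour_integrable_on circlepath 0 r"
      using ps by (simp add: contour_integrable_continuous_circlepath)
    have cauchy: "contour_integral (circlepath 0 r) (\<lambda>u. k (u, w) / (u - x)) = 2 * of_real pi * \<i> * k (x, w)"
      if "w \<in> sphere 0 s" for w
      using Cauchy_integral_circlepath[OF slice[OF that] hol[OF that]] x
      by (simp add: contour_integral_unique)
    have "contour_integral (circlepath 0 r) (\<lambda>u. ?c u / (u - x))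
        = contour_integral (circlepath 0 r) (\<lambda>u. contour_integral (circlepath 0 s) (\<lambda>w. k (u, w) / (u - x)))"
    proof (rule contour_integral_cong[OF refl])
      fix u assume u: "u \<in> path_image (circlepath 0 r)"
      have "continuous_on (sphere 0 s) (\<lambda>w. k (u, w))"
        by (rule continuous_on_compose2[OF k]) (use u ps in \<open>auto intro!: continuous_intros\<close>)
      then have "(\<lambda>w. k (u, w)) contour_integrable_on circlepath 0 s"
        using ps by (simp add: contour_integrable_continuous_circlepath)
      then show "?c u / (u - x) = contour_integral (circlepath 0 s) (\<lambda>w. k (u, w) / (u - x))"
        by (simp add: contour_integral_div)
    qed
    also have "\<dots> = contour_integral (circlepath 0 s) (\<lambda>w. contour_integral (circlepath 0 r) (\<lambda>u. k (u, w) / (u - x)))"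
    proof (rule contour_integral_swap)
      have "continuous_on (sphere 0 r \<times> sphere 0 s) (\<lambda>z. k z / (fst z - x))"
        using x by (auto intro!: continuous_intros continuous_on_subset[OF k])
      then show "continuous_on (path_image (circlepath 0 r) \<times> path_image (circlepath 0 s))
          (\<lambda>(y1, y2). k (y1, y2) / (y1 - x))"
        using ps by (simp add: case_prod_unfold)
    qed (auto simp: vector_derivative_circlepath intro!: continuous_intros)
    also have "\<dots> = contour_integral (circlepath 0 s) (\<lambda>w. 2 * of_real pi * \<i> * k (x, w))"
      using cauchy ps by (intro contour_integral_cong) auto
    also have "\<dots> = 2 * of_real pi * \<i> * ?c x"
    proof -
      have "continuous_on (sphere 0 s) (\<lambda>w. k (x, w))"
        by (rule continuous_on_compose2[OF k]) (use x in \<open>auto intro!: continuous_intros\<close>)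
      then have "(\<lambda>w. k (x, w)) contour_integrable_on circlepath 0 s"
        using ps by (simp add: contour_integrable_continuous_circlepath)
      then show ?thesis by (simp add: contour_integral_lmul)
    qed
    finally show ?thesis using I has_contour_integral_integral by fastforce
  qed
  have "(\<lambda>x. 2 * of_real pi * \<i> * ?c x) field_differentiable at x" if x: "x \<in> ball 0 r" for x
  proof -
    have "continuous_on (path_image (circlepath 0 r)) ?c"
      using ps by (auto intro: continuous_on_subset[OF contc])
    from Cauchy_next_derivative_circlepath(2)[OF this int _ x] show ?thesis
      unfolding field_differentiable_def by auto
  qed
  then have "(\<lambda>x. 2 * of_real pi * \<i> * ?c x) holomorphic_on ball 0 r"
    by (metis field_differentiable_at_within holomorphic_on_def)
  then have "(\<lambda>x. 2 * of_real pi * \<i> * ?c x / (2 * of_real pi * \<i>)) holomorphic_on ball 0 r"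
    by (rule holomorphic_on_divide) auto
  then show ?thesis by simp
qed


section \<open>Evaluation of double power series\<close>

definition ps2_eval :: "ps2 \<Rightarrow> complex \<times> complex \<Rightarrow> complex" where
  "ps2_eval a z = (\<Sum>\<^sub>\<infinity>(i, j). a i j * fst z ^ i * snd z ^ j)"

abbreviation ps2_abs_conv :: "ps2 \<Rightarrow> real \<Rightarrow> bool" where
  "ps2_abs_conv a r \<equiv> (\<lambda>(i, j). norm (a i j) * r ^ (i + j)) summable_on (UNIV :: (nat \<times> nat) set)"

lemma ps2_abs_summable:
  fixes a :: ps2
  assumes "ps2_abs_conv a r"
    and "norm x \<le> r" "norm y \<le> r"
  shows "(\<lambda>(i, j). norm (a i j * x ^ i * y ^ j)) summable_on UNIV"
proof (rule summable_on_comparison_test[OF assms(1)])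
  fix p :: "nat \<times> nat"
  obtain i j where p: "p = (i, j)" by force
  have "0 \<le> r" using assms(2) norm_ge_zero order_trans by blast
  then have "norm x ^ i * norm y ^ j \<le> r ^ i * r ^ j"
    using assms(2,3) by (intro mult_mono power_mono) auto
  then show "(case p of (i, j) \<Rightarrow> norm (a i j * x ^ i * y ^ j)) \<le> (case p of (i, j) \<Rightarrow> norm (a i j) * r ^ (i + j))"
    by (simp add: p norm_mult norm_power power_add mult_left_mono mult.assoc)
qed auto

lemma ps2_eval_has_sum:
  assumes "ps2_abs_conv a r"
    and "norm x \<le> r" "norm y \<le> r"
  shows "((\<lambda>(i, j). a i j * x ^ i * y ^ j) has_sum ps2_eval a (x, y)) UNIV"
proof -
  have "(\<lambda>(i, j). a i j * x ^ i * y ^ j) summable_on UNIV"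
    by (rule abs_summable_summable) (use ps2_abs_summable[OF assms] in \<open>simp add: case_prod_unfold\<close>)
  then show ?thesis by (simp add: ps2_eval_def)
qed

text \<open>Fubini for sums: the unordered sum becomes a series in \<open>y\<close> whose terms are
  series in \<open>x\<close>, the form in which one-variable power series theorems apply.\<close>

lemma ps2_eval_iterated:
  assumes "ps2_abs_conv a r"
    and "norm x \<le> r" "norm y \<le> r"
  obtains c where "\<And>j. (\<lambda>i. a i j * x ^ i * y ^ j) sums (c j)" "c sums ps2_eval a (x, y)"
proof -
  have sum: "((\<lambda>(j, i). a i j * x ^ i * y ^ j) has_sum ps2_eval a (x, y)) (UNIV \<times> UNIV)"
    using has_sum_swap[where f = "\<lambda>(i, j). a i j * x ^ i * y ^ j" and A = UNIV and B = UNIV] ps2_eval_has_sum[OF assms]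
    by (simp add: case_prod_unfold)
  then have sm: "(\<lambda>(j, i). a i j * x ^ i * y ^ j) summable_on (UNIV \<times> UNIV)"
    by (rule has_sum_imp_summable)
  define c where "c j = (\<Sum>\<^sub>\<infinity>i. a i j * x ^ i * y ^ j)" for j
  have c: "((\<lambda>i. a i j * x ^ i * y ^ j) has_sum c j) UNIV" for j
    using summable_on_SigmaD1[OF sm, of j] by (simp add: c_def)
  have "(c has_sum ps2_eval a (x, y)) UNIV"
    by (rule has_sum_SigmaD[OF sum]) (use c in auto)
  then show ?thesis using c that by (metis has_sum_imp_sums)
qed

text \<open>Comparison with the double geometric series in \<open>s / \<rho>\<close>.\<close>

lemma ps2_summable_of_bounded:
  fixes a :: ps2
  assumes "\<And>i j. norm (a i j) * \<rho> ^ (i + j) \<le> M" "0 \<le> s" "s < \<rho>"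
  shows "ps2_abs_conv a s"
proof -
  define t where "t = s / \<rho>"
  have t: "0 \<le> t" "t < 1" "\<rho> > 0" using assms(2,3) by (auto simp: t_def)
  have g: "((\<lambda>j. c * t ^ j) has_sum (c * (1 / (1 - t)))) UNIV" if "c \<ge> 0" for c
    using that t by (intro sums_nonneg_imp_has_sum sums_mult geometric_sums) auto
  have M: "M \<ge> 0" using order_trans[OF _ assms(1)[of 0 0]] by simp
  have "(\<lambda>(i, j). M * t ^ i * t ^ j) summable_on (UNIV \<times> UNIV)"
  proof (rule summable_on_SigmaI)
    show "((\<lambda>y. case (x, y) of (i, j) \<Rightarrow> M * t ^ i * t ^ j) has_sum M * t ^ x * (1 / (1 - t))) UNIV" for x :: nat
      using g[of "M * t ^ x"] t M by simp
    have "(\<lambda>x. M * (1 / (1 - t)) * t ^ x) summable_on UNIV"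
      using has_sum_imp_summable[OF g[of "M * (1 / (1 - t))"]] t M by simp
    then show "(\<lambda>x. M * t ^ x * (1 / (1 - t))) summable_on UNIV"
      by (simp add: mult_ac)
  qed (use M t in auto)
  then show ?thesis unfolding UNIV_Times_UNIV
  proof (rule summable_on_comparison_test)
    fix p :: "nat \<times> nat"
    obtain i j where p: "p = (i, j)" by force
    have "norm (a i j) * s ^ (i + j) = norm (a i j) * \<rho> ^ (i + j) * (t ^ i * t ^ j)"
      using t by (simp add: t_def power_divide power_add)
    also have "\<dots> \<le> M * (t ^ i * t ^ j)"
      using assms(1) t by (intro mult_right_mono) auto
    finally show "(case p of (i, j) \<Rightarrow> norm (a i j) * s ^ (i + j)) \<le> (case p of (i, j) \<Rightarrow> M * t ^ i * t ^ j)"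
      by (simp add: p mult.assoc)
  qed (use assms in auto)
qed

text \<open>\<open>k\<close> is boundary data on a circle in the second variable. Its Cauchy
  coefficients \<open>c j x\<close> are holomorphic in \<open>x\<close>, and their Taylor
  coefficients form the double series \<open>a\<close>. The conclusion concerns any single
  \<open>x\<close> at which the data happen to extend holomorphically to the disc in
  \<open>y\<close>, because the extraction of roots supplies such extensions only for x different
  from 0.\<close>

lemma cauchy_kernel_power_series:
  assumes k: "continuous_on (cball 0 r \<times> sphere 0 s) k" and r: "0 < r" and s: "0 < s"
    and hol: "\<And>w. w \<in> sphere 0 s \<Longrightarrow> (\<lambda>x. k (x, w)) holomorphic_on ball 0 r"
  obtains a where "convergent_ps2 a"
    "\<And>x y :: complex. \<And>f. \<lbrakk>norm x < min r s / 4; norm y < min r s / 4; f holomorphic_on ball 0 s; continuous_on (cball 0 s) f;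
        \<And>w. w \<in> sphere 0 s \<Longrightarrow> f w = k (x, w)\<rbrakk> \<Longrightarrow> f y = ps2_eval a (x, y)"
proof -
  define c where "c j x = 1 / (2 * of_real pi * \<i>) * contour_integral (circlepath 0 s) (\<lambda>w. k (x, w) / w ^ Suc j)" for j x
  define a where "a i j = (deriv ^^ i) (c j) 0 / fact i" for i j
  have ps: "path_image (circlepath 0 s) = sphere 0 s" using s by auto
  have ck: "continuous_on (cball 0 r \<times> sphere 0 s) (\<lambda>z. k z / snd z ^ Suc j)" for j
    using s by (auto intro!: continuous_intros continuous_on_subset[OF k])
  have holc: "c j holomorphic_on ball 0 r" for j
  proof -
    have "(\<lambda>x. contour_integral (circlepath 0 s) (\<lambda>w. (\<lambda>z. k z / snd z ^ Suc j) (x, w))) holomorphic_on ball 0 r"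
      by (rule holomorphic_contour_integral_param[OF ck _ r s])
         (use s hol in \<open>force intro!: holomorphic_intros\<close>)
    then show ?thesis unfolding c_def by (auto intro!: holomorphic_intros)
  qed
  have "compact (k ` (cball 0 r \<times> sphere 0 s))"
    by (intro compact_continuous_image k compact_Times) auto
  then obtain M where M: "\<And>z. z \<in> cball 0 r \<times> sphere 0 s \<Longrightarrow> norm (k z) \<le> M"
    by (meson bounded_iff compact_imp_bounded imageI)
  have cb: "norm (c j x) \<le> M / s ^ j" if x: "x \<in> cball 0 r" for j x
  proof -
    have "continuous_on (sphere 0 s) (\<lambda>w. (\<lambda>z. k z / snd z ^ Suc j) (x, w))"
      by (rule continuous_on_compose2[OF ck]) (use x in \<open>auto intro!: continuous_intros\<close>)
    then have "(\<lambda>w. k (x, w) / w ^ Suc j) contour_integrable_on circlepath 0 s"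
      using ps by (simp add: contour_integrable_continuous_circlepath)
    then have "norm (contour_integral (circlepath 0 s) (\<lambda>w. k (x, w) / w ^ Suc j)) \<le> (M / s ^ Suc j) * (2 * pi * s)"
    proof (rule has_contour_integral_bound_circlepath[OF has_contour_integral_integral])
      show "0 \<le> M / s ^ Suc j"
        using order_trans[OF norm_ge_zero M[of "(0, of_real s)"]] r s by simp
      fix w :: complex assume "norm (w - 0) = s"
      then show "norm (k (x, w) / w ^ Suc j) \<le> M / s ^ Suc j"
        using M[of "(x, w)"] x s by (simp add: norm_divide norm_mult norm_power divide_right_mono)
    qed (rule s)
    then have "1 / (2 * pi) * norm (contour_integral (circlepath 0 s) (\<lambda>w. k (x, w) / w ^ Suc j)) \<le> 1 / (2 * pi) * ((M / s ^ Suc j) * (2 * pi * s))"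
      by (intro mult_left_mono) auto
    then show ?thesis using s by (simp add: c_def norm_mult norm_divide field_simps)
  qed
  \<comment> \<open>The Cauchy estimates hold at radius \<open>r / 2\<close> in \<open>x\<close> and
    \<open>s\<close> in \<open>y\<close>, so the coefficients are bounded at radius
    \<open>m / 2\<close> and summable at \<open>m / 4\<close>.\<close>
  define m where "m = min r s"
  have m: "m > 0" "m \<le> r" "m \<le> s" using r s by (auto simp: m_def)
  have M0: "M \<ge> 0" using order_trans[OF norm_ge_zero M[of "(0, of_real s)"]] r s by simp
  have ab: "norm (a i j) * (m / 2) ^ (i + j) \<le> M" for i j
  proof -
    have "norm ((deriv ^^ i) (c j) 0) \<le> fact i * (M / s ^ j) / (r / 2) ^ i"
    proof (rule Cauchy_inequality)
      have "cball 0 (r / 2) \<subseteq> ball (0 :: complex) r" using r by auto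
      then show "continuous_on (cball 0 (r / 2)) (c j)" "c j holomorphic_on ball 0 (r / 2)"
        using holc ball_subset_cball by (meson holomorphic_on_imp_continuous_on holomorphic_on_subset)+
    qed (use cb r in auto)
    then have "norm (a i j) \<le> M / s ^ j / (r / 2) ^ i"
      by (simp add: a_def norm_divide field_simps)
    also have "\<dots> \<le> M / (m / 2) ^ j / (m / 2) ^ i"
      using m M0 by (intro frac_le mult_nonneg_nonneg power_mono divide_nonneg_nonneg) auto
    finally show ?thesis using m by (simp add: power_add field_simps)
  qed
  have sm: "ps2_abs_conv a (m / 4)"
    by (rule ps2_summable_of_bounded[OF ab]) (use m in auto)
  show ?thesis
  proof
    show "convergent_ps2 a" unfolding convergent_ps2_def using sm m by (intro exI[of _ "m / 4"]) auto
    fix x y :: complex and f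
    assume "norm x < min r s / 4" "norm y < min r s / 4" and f: "f holomorphic_on ball 0 s" "continuous_on (cball 0 s) f"
      and fk: "\<And>w. w \<in> sphere 0 s \<Longrightarrow> f w = k (x, w)"
    then have x: "norm x < m / 4" and y: "norm y < m / 4" by (auto simp: m_def)
    obtain d where d: "\<And>j. (\<lambda>i. a i j * x ^ i * y ^ j) sums (d j)" "d sums ps2_eval a (x, y)"
      using ps2_eval_iterated[OF sm] x y by (metis less_imp_le)
    have dj: "d j = (deriv ^^ j) f 0 / fact j * y ^ j" for j
    proof -
      have "(\<lambda>i. (deriv ^^ i) (c j) 0 / fact i * (x - 0) ^ i) sums c j x"
        by (rule holomorphic_power_series[OF holc]) (use x m in auto)
      from sums_mult2[OF this, of "y ^ j"] have "(\<lambda>i. a i j * x ^ i * y ^ j) sums (c j x * y ^ j)"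
        by (simp add: a_def)
      then have "d j = c j x * y ^ j" using d(1) sums_unique2 by blast
      moreover have "contour_integral (circlepath 0 s) (\<lambda>w. k (x, w) / w ^ Suc j)
          = contour_integral (circlepath 0 s) (\<lambda>w. f w / (w - 0) ^ Suc j)"
        using fk ps by (intro contour_integral_cong) auto
      then have "c j x = (deriv ^^ j) f 0 / fact j"
        using Cauchy_has_contour_integral_higher_derivative_circlepath[OF f(2,1), of 0 j] s
        by (simp add: c_def contour_integral_unique)
      ultimately show ?thesis by simp
    qed
    have "(\<lambda>j. (deriv ^^ j) f 0 / fact j * (y - 0) ^ j) sums f y"
      by (rule holomorphic_power_series[OF f(1)]) (use y m in auto)
    then have "d sums f y" by (simp add: dj[abs_def])
    then show "f y = ps2_eval a (x, y)" using d(2) by (rule sums_unique2)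
  qed
qed

section \<open>Double power series as functions\<close>

lemma sums_zero_imp_coeffs_zero:
  fixes a :: "nat \<Rightarrow> complex"
  assumes "r > 0" "\<And>x. norm x < r \<Longrightarrow> (\<lambda>n. a n * x ^ n) sums 0"
  shows "a n = 0"
proof (rule ccontr)
  assume n: "a n \<noteq> 0"
  have "(\<lambda>n. a n * 0 ^ n) sums a 0" by (rule powser_sums_zero)
  then have "a 0 = 0" using assms(2)[of 0] assms(1) sums_unique2 by fastforce
  then have "n > 0" using n by (cases n) auto
  obtain s where "s > 0" "\<And>z. z \<in> cball 0 s - {0} \<Longrightarrow> (\<lambda>_::complex. 0 :: complex) z \<noteq> 0"
    by (rule powser_0_nonzero[of r 0 a "\<lambda>_. 0" n]) (use assms n \<open>n > 0\<close> in auto)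
  moreover have "of_real s \<in> cball (0 :: complex) s - {0}" using \<open>s > 0\<close> by auto
  ultimately show False by blast
qed

lemma ps2_eval_rows:
  assumes a: "ps2_abs_conv a r"
    and x: "norm x \<le> r" and r: "r > 0"
  shows "summable (\<lambda>i. a i j * x ^ i)"
    and "norm y \<le> r \<Longrightarrow> (\<lambda>j. (\<Sum>i. a i j * x ^ i) * y ^ j) sums ps2_eval a (x, y)"
proof -
  show sm: "summable (\<lambda>i. a i j * x ^ i)" for j
  proof -
    obtain c where "\<And>j. (\<lambda>i. a i j * x ^ i * of_real r ^ j) sums (c j)"
      using ps2_eval_iterated[OF a x, of "of_real r"] r by auto
    then have "summable (\<lambda>i. a i j * x ^ i * of_real r ^ j)" using sums_summable by blast
    then have "summable (\<lambda>i. of_real r ^ j * (a i j * x ^ i))" by (simp add: mult_ac)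
    then show ?thesis using r by (simp only: summable_cmult_iff) auto
  qed
  assume "norm y \<le> r"
  from ps2_eval_iterated[OF a x this] obtain c where
    c: "\<And>j. (\<lambda>i. a i j * x ^ i * y ^ j) sums (c j)" "c sums ps2_eval a (x, y)" by metis
  have "c j = (\<Sum>i. a i j * x ^ i) * y ^ j" for j
    using c(1) sums_mult2[OF summable_sums[OF sm]] sums_unique2 by blast
  then show "(\<lambda>j. (\<Sum>i. a i j * x ^ i) * y ^ j) sums ps2_eval a (x, y)"
    using c(2) by presburger
qed

lemma ps2_summable_mono:
  fixes a :: ps2
  assumes "ps2_abs_conv a r" "0 \<le> s" "s \<le> r"
  shows "ps2_abs_conv a s"
  by (rule summable_on_comparison_test[OF assms(1)])
     (use assms(2,3) in \<open>auto intro!: mult_left_mono power_mono\<close>)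

text \<open>One-variable uniqueness twice: for fixed x the series in y vanishes, so every row sum
  vanishes, and each row is then a vanishing series in x.\<close>

lemma ps2_eval_eq_zero_imp_zero:
  assumes "convergent_ps2 a" "\<forall>\<^sub>F z in nhds (0, 0). ps2_eval a z = 0"
  shows "a i j = 0"
proof -
  obtain r0 where r0: "r0 > 0" "ps2_abs_conv a r0"
    using assms(1) by (auto simp: convergent_ps2_def)
  obtain r1 where r1: "r1 > 0" "\<And>z. z \<in> polydisc r1 \<Longrightarrow> ps2_eval a z = 0"
    using assms(2) by (auto simp: eventually_nhds_polydisc)
  define r where "r = min r0 r1"
  have r: "r > 0" "r \<le> r1" using r0 r1 by (auto simp: r_def)
  have sm: "ps2_abs_conv a r"
    by (rule ps2_summable_mono[OF r0(2)]) (use r0 r1 in \<open>auto simp: r_def\<close>)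
  have row: "(\<Sum>i. a i j * x ^ i) = 0" if "norm x < r" for x j
  proof (rule sums_zero_imp_coeffs_zero[OF r(1)])
    fix y :: complex assume "norm y < r"
    then show "(\<lambda>j. (\<Sum>i. a i j * x ^ i) * y ^ j) sums 0"
      using ps2_eval_rows(2)[OF sm _ r(1), of x y] r1(2)[of "(x, y)"] that r(2) by simp
  qed
  have "(\<lambda>i. a i j * x ^ i) sums 0" if "norm x < r" for x
    using summable_sums[OF ps2_eval_rows(1)[OF sm _ r(1), of x j]] row[OF that] that by simp
  then show ?thesis by (rule sums_zero_imp_coeffs_zero[OF r(1)])
qed

lemma ps2_eval_holomorphic2_on:
  assumes "ps2_abs_conv a r"
  shows "ps2_eval a holomorphic2_on polydisc r"
proof -
  have "(\<lambda>z. \<Sum>\<^sub>\<infinity>p. a (fst p) (snd p) * fst z ^ fst p * snd z ^ snd p) holomorphic2_on polydisc r"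
  proof (rule holomorphic2_on_infsum[where M = "\<lambda>(i, j). norm (a i j) * r ^ (i + j)"])
    show "(\<lambda>z. a (fst p) (snd p) * fst z ^ fst p * snd z ^ snd p) holomorphic2_on polydisc r" for p :: "nat \<times> nat"
      by (intro holomorphic2_on_mult holomorphic2_on_power) auto
    fix p :: "nat \<times> nat" and z assume z: "z \<in> polydisc r"
    obtain x y where xy: "z = (x, y)" by force
    have n: "norm x < r" "norm y < r" using z xy by auto
    then have "0 \<le> r" using norm_ge_zero[of x] by linarith
    with n have "norm x ^ fst p * norm y ^ snd p \<le> r ^ fst p * r ^ snd p"
      by (intro mult_mono power_mono) auto
    then show "norm (a (fst p) (snd p) * fst z ^ fst p * snd z ^ snd p) \<le> (case p of (i, j) \<Rightarrow> norm (a i j) * r ^ (i + j))"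
      by (simp add: case_prod_unfold xy norm_mult norm_power power_add mult_left_mono mult.assoc)
  qed (use assms in auto)
  then show ?thesis by (simp add: ps2_eval_def[abs_def] case_prod_unfold)
qed

text \<open>Osgood's lemma: \<open>F\<close> is its own boundary data for the Cauchy kernel, and
  each of its slices is the required extension.\<close>

lemma holomorphic2_on_imp_ps2_eval:
  assumes F: "F holomorphic2_on U" "open U" "(0, 0) \<in> U"
  obtains a where "convergent_ps2 a" "\<forall>\<^sub>F z in nhds (0, 0). F z = ps2_eval a z"
proof -
  obtain R where R: "R > 0" "polydisc R \<subseteq> U" using polydisc_subset_open[OF F(2,3)] .
  then have FR: "F holomorphic2_on polydisc R" using F(1) holomorphic2_on_subset by blast
  define r where "r = R / 2"
  have r: "r > 0" "r < R" using R by (auto simp: r_def)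
  have sub: "cball 0 r \<times> sphere 0 r \<subseteq> polydisc R" using r by (auto simp: polydisc_def)
  have k: "continuous_on (cball 0 r \<times> sphere 0 r) F"
    using FR sub continuous_on_subset unfolding holomorphic2_on_def by blast
  have hol: "(\<lambda>x. F (x, w)) holomorphic_on ball 0 r" if "w \<in> sphere 0 r" for w
    by (rule holomorphic_on_subset[OF holomorphic2_on_slices(1)[OF FR]]) (use that r in auto)
  have hol2: "(\<lambda>y. F (x, y)) holomorphic_on ball 0 R" if "norm x < R" for x
    by (rule holomorphic2_on_slices(2)[OF FR that])
  obtain a where a: "convergent_ps2 a"
    "\<And>x y :: complex. \<And>f. \<lbrakk>norm x < min r r / 4; norm y < min r r / 4; f holomorphic_on ball 0 r; continuous_on (cball 0 r) f;
        \<And>w. w \<in> sphere 0 r \<Longrightarrow> f w = F (x, w)\<rbrakk> \<Longrightarrow> f y = ps2_eval a (x, y)"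
    using cauchy_kernel_power_series[OF k r(1) r(1) hol] by blast
  have "F (x, y) = ps2_eval a (x, y)" if xy: "norm x < r / 4" "norm y < r / 4" for x y
  proof (rule a(2))
    have x: "norm x < R" using xy r by auto
    show "(\<lambda>y. F (x, y)) holomorphic_on ball 0 r" "continuous_on (cball 0 r) (\<lambda>y. F (x, y))"
      using r by (auto intro!: holomorphic_on_subset[OF hol2[OF x]] holomorphic_on_imp_continuous_on)
  qed (use xy in auto)
  then have "\<forall>\<^sub>F z in nhds (0, 0). F z = ps2_eval a z"
    unfolding eventually_nhds_polydisc using r by (intro exI[of _ "r / 4"]) auto
  then show ?thesis using a(1) that by blast
qed

section \<open>Products of double series\<close>

lemma summable_on_times:
  fixes f g :: "'a \<Rightarrow> real"
  assumes "f summable_on UNIV" "g summable_on UNIV" "\<And>p. f p \<ge> 0" "\<And>p. g p \<ge> 0"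
  shows "(\<lambda>(p, q). f p * g q) summable_on UNIV \<times> UNIV"
proof (rule summable_on_SigmaI)
  show "((\<lambda>y. case (x, y) of (p, q) \<Rightarrow> f p * g q) has_sum (f x * infsum g UNIV)) UNIV" for x
    using has_sum_cmult_right[OF has_sum_infsum[OF assms(2)]] by simp
  show "(\<lambda>x. f x * infsum g UNIV) summable_on UNIV" by (rule summable_on_cmult_left[OF assms(1)])
qed (use assms in auto)

lemma has_sum_times:
  fixes f g :: "'a \<Rightarrow> complex"
  assumes "(\<lambda>p. norm (f p)) summable_on UNIV" "(\<lambda>p. norm (g p)) summable_on UNIV"
  shows "((\<lambda>(p, q). f p * g q) has_sum infsum f UNIV * infsum g UNIV) (UNIV \<times> UNIV)"
proof (rule has_sum_SigmaI)
  have s: "f summable_on UNIV" "g summable_on UNIV" using assms abs_summable_summable by auto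
  show "((\<lambda>y. case (x, y) of (p, q) \<Rightarrow> f p * g q) has_sum (f x * infsum g UNIV)) UNIV" for x
    using has_sum_cmult_right[OF has_sum_infsum[OF s(2)]] by simp
  show "((\<lambda>x. f x * infsum g UNIV) has_sum infsum f UNIV * infsum g UNIV) UNIV"
    by (rule has_sum_cmult_left[OF has_sum_infsum[OF s(1)]])
  have "(\<lambda>(p, q). norm (f p) * norm (g q)) summable_on UNIV \<times> UNIV"
    by (rule summable_on_times[OF assms]) auto
  then have "(\<lambda>z. norm ((\<lambda>(p, q). f p * g q) z)) summable_on UNIV \<times> UNIV"
    by (simp add: case_prod_unfold norm_mult)
  then show "(\<lambda>(p, q). f p * g q) summable_on UNIV \<times> UNIV" by (rule abs_summable_summable)
qed

text \<open>Pairs of exponents are regrouped by their sum; each sum has finitely many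
  decompositions.\<close>

lemma has_sum_cauchy_product2:
  fixes f g :: "nat \<times> nat \<Rightarrow> 'a :: {topological_semigroup_mult, semiring_0, topological_comm_monoid_add, t3_space}"
  assumes "((\<lambda>(p, q). f p * g q) has_sum S) (UNIV \<times> UNIV)"
  shows "((\<lambda>(i, j). \<Sum>k\<le>i. \<Sum>l\<le>j. f (k, l) * g (i - k, j - l)) has_sum S) UNIV"
proof -
  let ?B = "\<lambda>p :: nat \<times> nat. {..fst p} \<times> {..snd p}"
  let ?h = "\<lambda>(p, q). f q * g (fst p - fst q, snd p - snd q)"
  have "(?h has_sum S) (Sigma UNIV ?B) \<longleftrightarrow> ((\<lambda>(p, q). f p * g q) has_sum S) (UNIV \<times> UNIV)"
    by (rule has_sum_reindex_bij_witness[where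
          i = "\<lambda>(q, q'). ((fst q + fst q', snd q + snd q'), q)" and
          j = "\<lambda>(p, q). (q, (fst p - fst q, snd p - snd q))"]) auto
  then have "(?h has_sum S) (Sigma UNIV ?B)" using assms by simp
  then show ?thesis
  proof (rule has_sum_SigmaD)
    fix p :: "nat \<times> nat"
    have "((\<lambda>q. ?h (p, q)) has_sum (\<Sum>q\<in>?B p. ?h (p, q))) (?B p)" by (rule has_sum_finite) simp
    also have "(\<Sum>q\<in>?B p. ?h (p, q)) = (case p of (i, j) \<Rightarrow> \<Sum>k\<le>i. \<Sum>l\<le>j. f (k, l) * g (i - k, j - l))"
      by (simp add: case_prod_unfold sum.cartesian_product)
    finally show "((\<lambda>q. ?h (p, q)) has_sum (case p of (i, j) \<Rightarrow> \<Sum>k\<le>i. \<Sum>l\<le>j. f (k, l) * g (i - k, j - l))) (?B p)" .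
  qed
qed

lemma ps2_summable_mult:
  fixes a b :: ps2
  assumes "ps2_abs_conv a r"
    and "ps2_abs_conv b r" and "r \<ge> 0"
  shows "ps2_abs_conv (ps2_mult a b) r"
proof -
  let ?f = "\<lambda>(i, j). norm (a i j) * r ^ (i + j)" and ?g = "\<lambda>(i, j). norm (b i j) * r ^ (i + j)"
  have "(\<lambda>(p, q). ?f p * ?g q) summable_on (UNIV \<times> UNIV)"
    by (rule summable_on_times[OF assms(1,2)]) (use assms(3) in auto)
  then have "(\<lambda>(i, j). \<Sum>k\<le>i. \<Sum>l\<le>j. ?f (k, l) * ?g (i - k, j - l)) summable_on UNIV"
    using has_sum_cauchy_product2 has_sum_infsum has_sum_imp_summable by blast
  then show ?thesis
  proof (rule summable_on_comparison_test)
    fix p :: "nat \<times> nat"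
    obtain i j where p: "p = (i, j)" by force
    have "norm (ps2_mult a b i j) \<le> (\<Sum>k\<le>i. \<Sum>l\<le>j. norm (a k l) * norm (b (i - k) (j - l)))"
      unfolding ps2_mult_def by (intro order_trans[OF norm_sum] sum_mono order_trans[OF norm_sum]) (simp add: norm_mult)
    then have "norm (ps2_mult a b i j) * r ^ (i + j) \<le> (\<Sum>k\<le>i. \<Sum>l\<le>j. norm (a k l) * norm (b (i - k) (j - l))) * r ^ (i + j)"
      using assms(3) by (intro mult_right_mono) auto
    also have "\<dots> = (\<Sum>k\<le>i. \<Sum>l\<le>j. ?f (k, l) * ?g (i - k, j - l))"
      unfolding sum_distrib_right
    proof (intro sum.cong refl)
      fix k l assume "k \<in> {..i}" "l \<in> {..j}"
      then have "i + j = (k + l) + (i - k + (j - l))" by auto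
      then have "r ^ (i + j) = r ^ (k + l) * r ^ (i - k + (j - l))" by (metis power_add)
      then show "norm (a k l) * norm (b (i - k) (j - l)) * r ^ (i + j) = ?f (k, l) * ?g (i - k, j - l)" by simp
    qed
    finally show "(case p of (i, j) \<Rightarrow> norm (ps2_mult a b i j) * r ^ (i + j)) \<le>
       (case p of (i, j) \<Rightarrow> \<Sum>k\<le>i. \<Sum>l\<le>j. ?f (k, l) * ?g (i - k, j - l))" by (simp add: p)
  qed (use assms(3) in auto)
qed

lemma ps2_eval_mult:
  assumes a: "ps2_abs_conv a r"
    and b: "ps2_abs_conv b r"
    and xy: "norm x \<le> r" "norm y \<le> r"
  shows "ps2_eval (ps2_mult a b) (x, y) = ps2_eval a (x, y) * ps2_eval b (x, y)"
proof -
  let ?f = "\<lambda>(i, j). a i j * x ^ i * y ^ j" and ?g = "\<lambda>(i, j). b i j * x ^ i * y ^ j"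
  have r: "r \<ge> 0" using xy(1) norm_ge_zero order_trans by blast
  have "((\<lambda>(p, q). ?f p * ?g q) has_sum infsum ?f UNIV * infsum ?g UNIV) (UNIV \<times> UNIV)"
    by (rule has_sum_times) (use ps2_abs_summable[OF a xy] ps2_abs_summable[OF b xy] in \<open>simp_all add: case_prod_unfold\<close>)
  then have "((\<lambda>(i, j). \<Sum>k\<le>i. \<Sum>l\<le>j. ?f (k, l) * ?g (i - k, j - l)) has_sum infsum ?f UNIV * infsum ?g UNIV) UNIV"
    by (rule has_sum_cauchy_product2)
  also have "(\<lambda>(i, j). \<Sum>k\<le>i. \<Sum>l\<le>j. ?f (k, l) * ?g (i - k, j - l)) = (\<lambda>(i, j). ps2_mult a b i j * x ^ i * y ^ j)"
  proof (rule arg_cong[where f = case_prod], intro ext)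
    fix i j
    show "(\<Sum>k\<le>i. \<Sum>l\<le>j. ?f (k, l) * ?g (i - k, j - l)) = ps2_mult a b i j * x ^ i * y ^ j"
      unfolding ps2_mult_def sum_distrib_right
    proof (intro sum.cong refl)
      fix k l assume "k \<in> {..i}" "l \<in> {..j}"
      then have "x ^ i = x ^ k * x ^ (i - k)" "y ^ j = y ^ l * y ^ (j - l)"
        by (simp_all flip: power_add)
      then show "?f (k, l) * ?g (i - k, j - l) = a k l * b (i - k) (j - l) * x ^ i * y ^ j" by simp
    qed
  qed
  finally show ?thesis
    using ps2_eval_has_sum[OF ps2_summable_mult[OF a b r] xy] has_sum_unique
    unfolding ps2_eval_def by fastforce
qed

text \<open>Identities between germs. \<open>ps2_eval\<close> takes the default value 0 of
  \<open>infsum\<close> where the series is not summable, so algebraic identities between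
  evaluations are asserted only on some neighbourhood of the origin.\<close>

abbreviation near0 :: "(complex \<times> complex \<Rightarrow> bool) \<Rightarrow> bool" (binder \<open>\<forall>\<^sub>0\<close> 10) where
  "near0 P \<equiv> eventually P (nhds (0, 0))"

lemma convergent_ps2_0: "convergent_ps2 (\<lambda>_ _. 0)"
  unfolding convergent_ps2_def by (intro exI[of _ 1]) (simp add: case_prod_unfold)

lemma convergent_ps2_common_radius:
  assumes "convergent_ps2 a" "convergent_ps2 b"
  obtains r where "r > 0" "ps2_abs_conv a r"
    "ps2_abs_conv b r"
proof -
  obtain r s where rs: "r > 0" "ps2_abs_conv a r"
    "s > 0" "ps2_abs_conv b s"
    using assms by (auto simp: convergent_ps2_def)
  show ?thesis
    by (rule that[of "min r s"]) (use rs in \<open>auto intro: ps2_summable_mono\<close>)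
qed

lemma ps2_summable_lincomb:
  fixes a b :: ps2
  assumes "ps2_abs_conv a r"
    and "ps2_abs_conv b r" "r \<ge> 0"
  shows "(\<lambda>(i, j). norm (c * a i j + d * b i j) * r ^ (i + j)) summable_on (UNIV :: (nat \<times> nat) set)"
proof (rule summable_on_comparison_test)
  show "(\<lambda>p. norm c * (case p of (i, j) \<Rightarrow> norm (a i j) * r ^ (i + j)) + norm d * (case p of (i, j) \<Rightarrow> norm (b i j) * r ^ (i + j)))
      summable_on (UNIV :: (nat \<times> nat) set)"
    by (intro summable_on_add summable_on_cmult_right assms(1,2))
  fix p :: "nat \<times> nat"
  have "norm (c * a (fst p) (snd p) + d * b (fst p) (snd p)) * r ^ (fst p + snd p)
      \<le> (norm c * norm (a (fst p) (snd p)) + norm d * norm (b (fst p) (snd p))) * r ^ (fst p + snd p)"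
    by (intro mult_right_mono order_trans[OF norm_triangle_ineq]) (use assms(3) in \<open>auto simp: norm_mult\<close>)
  then show "(case p of (i, j) \<Rightarrow> norm (c * a i j + d * b i j) * r ^ (i + j)) \<le>
      norm c * (case p of (i, j) \<Rightarrow> norm (a i j) * r ^ (i + j)) + norm d * (case p of (i, j) \<Rightarrow> norm (b i j) * r ^ (i + j))"
    by (simp add: case_prod_unfold algebra_simps)
qed (use assms(3) in auto)

lemma ps2_lincomb:
  assumes "convergent_ps2 a" "convergent_ps2 b"
  shows "convergent_ps2 (\<lambda>i j. c * a i j + d * b i j)"
    and "\<forall>\<^sub>0z. ps2_eval (\<lambda>i j. c * a i j + d * b i j) z = c * ps2_eval a z + d * ps2_eval b z"
proof -
  obtain r where r: "r > 0" "ps2_abs_conv a r"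
    "ps2_abs_conv b r"
    using convergent_ps2_common_radius[OF assms] .
  have s: "(\<lambda>(i, j). norm (c * a i j + d * b i j) * r ^ (i + j)) summable_on (UNIV :: (nat \<times> nat) set)"
    using ps2_summable_lincomb[OF r(2,3)] r(1) by simp
  then show "convergent_ps2 (\<lambda>i j. c * a i j + d * b i j)"
    unfolding convergent_ps2_def using r(1) by blast
  have "ps2_eval (\<lambda>i j. c * a i j + d * b i j) (x, y) = c * ps2_eval a (x, y) + d * ps2_eval b (x, y)"
    if "norm x < r" "norm y < r" for x y
  proof -
    have xy: "norm x \<le> r" "norm y \<le> r" using that by auto
    have "((\<lambda>p. c * (case p of (i, j) \<Rightarrow> a i j * x ^ i * y ^ j) + d * (case p of (i, j) \<Rightarrow> b i j * x ^ i * y ^ j))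
       has_sum c * ps2_eval a (x, y) + d * ps2_eval b (x, y)) UNIV"
      by (intro has_sum_add has_sum_cmult_right ps2_eval_has_sum[OF _ xy] r)
    moreover have "(\<lambda>p. c * (case p of (i, j) \<Rightarrow> a i j * x ^ i * y ^ j) + d * (case p of (i, j) \<Rightarrow> b i j * x ^ i * y ^ j))
       = (\<lambda>(i, j). (c * a i j + d * b i j) * x ^ i * y ^ j)"
      by (auto simp: fun_eq_iff algebra_simps)
    ultimately show ?thesis using ps2_eval_has_sum[OF s xy] has_sum_unique by fastforce
  qed
  then show "\<forall>\<^sub>0z. ps2_eval (\<lambda>i j. c * a i j + d * b i j) z = c * ps2_eval a z + d * ps2_eval b z"
    unfolding eventually_nhds_polydisc using r(1) by (intro exI[of _ r]) auto
qed

lemma ps2_mult_near0: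
  assumes "convergent_ps2 a" "convergent_ps2 b"
  shows "convergent_ps2 (ps2_mult a b)" and "\<forall>\<^sub>0z. ps2_eval (ps2_mult a b) z = ps2_eval a z * ps2_eval b z"
proof -
  obtain r where r: "r > 0" "ps2_abs_conv a r"
    "ps2_abs_conv b r"
    using convergent_ps2_common_radius[OF assms] .
  show "convergent_ps2 (ps2_mult a b)"
    unfolding convergent_ps2_def using r(1) ps2_summable_mult[OF r(2,3)] by (intro exI[of _ r]) auto
  show "\<forall>\<^sub>0z. ps2_eval (ps2_mult a b) z = ps2_eval a z * ps2_eval b z"
    unfolding eventually_nhds_polydisc using r(1) ps2_eval_mult[OF r(2,3)]
    by (intro exI[of _ r]) (auto simp: less_imp_le)
qed

lemma ps2_finite_support:
  assumes "finite {(i, j). a i j \<noteq> 0}"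
  shows "convergent_ps2 a" and "ps2_eval a (x, y) = (\<Sum>(i, j)\<in>{(i, j). a i j \<noteq> 0}. a i j * x ^ i * y ^ j)"
proof -
  show "convergent_ps2 a" unfolding convergent_ps2_def
  proof (intro exI[of _ 1] conjI)
    have "(\<lambda>(i, j). norm (a i j) * 1 ^ (i + j)) summable_on {(i, j). a i j \<noteq> 0}"
      using assms by simp
    moreover have "ps2_abs_conv a 1 \<longleftrightarrow>
        (\<lambda>(i, j). norm (a i j) * 1 ^ (i + j)) summable_on {(i, j). a i j \<noteq> 0}"
      by (rule summable_on_cong_neutral) auto
    ultimately show "ps2_abs_conv a 1" by simp
  qed simp
  have "ps2_eval a (x, y) = (\<Sum>\<^sub>\<infinity>(i, j)\<in>{(i, j). a i j \<noteq> 0}. a i j * x ^ i * y ^ j)"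
    unfolding ps2_eval_def by (rule infsum_cong_neutral) auto
  then show "ps2_eval a (x, y) = (\<Sum>(i, j)\<in>{(i, j). a i j \<noteq> 0}. a i j * x ^ i * y ^ j)"
    using assms by simp
qed

section \<open>The ring of convergent power series\<close>

text \<open>Convergent series get a type of their own so that they form an instance of
  \<open>idom\<close>; cancellation, \<open>algebra_simps\<close> and the bound on the number of
  roots of a polynomial then apply to series.\<close>

typedef cps = "{a. convergent_ps2 a}" morphisms coef Cps
  using convergent_ps2_0 by blast

lemma convergent_coef [simp]: "convergent_ps2 (coef s)"
  using coef by simp

lemma coef_Cps [simp]: "convergent_ps2 a \<Longrightarrow> coef (Cps a) = a"
  by (simp add: Cps_inverse)

lemma cps_eqI: "(\<And>i j. coef s i j = coef t i j) \<Longrightarrow> s = t"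
  by (metis coef_inject ext)

definition ev :: "cps \<Rightarrow> complex \<times> complex \<Rightarrow> complex" where
  "ev s = ps2_eval (coef s)"

instantiation cps :: "{zero, one, plus, minus, uminus, times}"
begin
definition "0 = Cps (\<lambda>_ _. 0)"
definition "1 = Cps ps2_one"
definition "s + t = Cps (ps2_add (coef s) (coef t))"
definition "s - t = Cps (\<lambda>i j. coef s i j - coef t i j)"
definition "- s = Cps (\<lambda>i j. - coef s i j)"
definition "s * t = Cps (ps2_mult (coef s) (coef t))"
instance ..
end

definition monom2 :: "complex \<Rightarrow> nat \<Rightarrow> nat \<Rightarrow> cps" where
  "monom2 c i j = Cps (\<lambda>k l. if k = i \<and> l = j then c else 0)"

abbreviation cst :: "complex \<Rightarrow> cps" where "cst c \<equiv> monom2 c 0 0"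

lemma coef_0 [simp]: "coef 0 i j = 0"
  by (simp add: zero_cps_def convergent_ps2_0)

lemma coef_add [simp]: "coef (s + t) i j = coef s i j + coef t i j"
  using ps2_lincomb(1)[of "coef s" "coef t" 1 1] by (simp add: plus_cps_def ps2_add_def)

lemma coef_diff [simp]: "coef (s - t) i j = coef s i j - coef t i j"
  using ps2_lincomb(1)[of "coef s" "coef t" 1 "-1"] by (simp add: minus_cps_def)

lemma coef_uminus [simp]: "coef (- s) i j = - coef s i j"
  using ps2_lincomb(1)[of "coef s" "coef s" "-1" 0] by (simp add: uminus_cps_def)

lemma coef_times: "coef (s * t) = ps2_mult (coef s) (coef t)"
  by (simp add: times_cps_def ps2_mult_near0)

lemma monom2_convergent_eval:
  "convergent_ps2 (\<lambda>k l. if k = i \<and> l = j then c else 0)"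
  "ps2_eval (\<lambda>k l. if k = i \<and> l = j then c else 0) (x, y) = c * x ^ i * y ^ j"
proof -
  have sub: "{(k, l). (if k = i \<and> l = j then c else 0) \<noteq> 0} = (if c = 0 then {} else {(i, j)})"
    by auto
  then have fin: "finite {(k, l). (if k = i \<and> l = j then c else 0) \<noteq> 0}" by simp
  note f = ps2_finite_support[of "\<lambda>k l. if k = i \<and> l = j then c else 0", OF fin]
  show "convergent_ps2 (\<lambda>k l. if k = i \<and> l = j then c else 0)" by (rule f(1))
  show "ps2_eval (\<lambda>k l. if k = i \<and> l = j then c else 0) (x, y) = c * x ^ i * y ^ j"
    unfolding f(2) sub by simp
qed

lemma coef_monom2: "coef (monom2 c i j) k l = (if k = i \<and> l = j then c else 0)"
  by (simp add: monom2_def monom2_convergent_eval)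

lemma ev_monom2: "ev (monom2 c i j) z = c * fst z ^ i * snd z ^ j"
  by (cases z) (simp add: ev_def monom2_def monom2_convergent_eval)

lemma one_cps_monom2: "1 = cst 1"
  by (simp add: one_cps_def monom2_def ps2_one_def)

lemma coef_1 [simp]: "coef 1 i j = (if i = 0 \<and> j = 0 then 1 else 0)"
  by (simp add: one_cps_monom2 coef_monom2)

lemma ev_1 [simp]: "ev 1 z = 1"
  by (simp add: one_cps_monom2 ev_monom2)

lemma ev_0 [simp]: "ev 0 z = 0"
  by (simp add: ev_def ps2_eval_def case_prod_unfold)

lemma ev_add: "\<forall>\<^sub>0z. ev (s + t) z = ev s z + ev t z"
  using ps2_lincomb(2)[of "coef s" "coef t" 1 1] by (simp add: ev_def coef_add[abs_def])

lemma ev_diff: "\<forall>\<^sub>0z. ev (s - t) z = ev s z - ev t z"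
  using ps2_lincomb(2)[of "coef s" "coef t" 1 "-1"] by (simp add: ev_def coef_diff[abs_def])

lemma ev_mult: "\<forall>\<^sub>0z. ev (s * t) z = ev s z * ev t z"
  using ps2_mult_near0(2)[of "coef s" "coef t"] by (simp add: ev_def coef_times)

text \<open>A series is determined by its germ. Ring laws and identities between substitutions are
  thereby reduced to identities between complex numbers.\<close>

lemma ev_eqI:
  assumes "\<forall>\<^sub>0z. ev s z = ev t z"
  shows "s = t"
proof -
  have "\<forall>\<^sub>0z. ps2_eval (coef (s - t)) z = 0"
    using assms ev_diff[of s t] by eventually_elim (simp add: ev_def)
  then have "coef (s - t) i j = 0" for i j by (rule ps2_eval_eq_zero_imp_zero[OF convergent_coef])
  then show ?thesis by (intro cps_eqI) simp
qed

lemma sum_atMost_delta2: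
  "(\<Sum>k\<le>m. \<Sum>l\<le>n. if k = i then if l = j then c else 0 else 0) =
   (if i \<le> m \<and> j \<le> n then c else (0 :: 'a :: comm_monoid_add))" for i j m n :: nat
proof -
  have "(\<Sum>l\<le>n. if k = i then if l = j then c else 0 else 0) = (if k = i then if j \<le> n then c else 0 else 0)" for k
    by (cases "k = i") auto
  then show ?thesis by simp
qed

text \<open>The lexicographically first exponents of nonzero coefficients add: in the convolution at
  their sum a single product survives.\<close>

lemma cps_times_nonzero:
  fixes s t :: cps
  assumes "s \<noteq> 0" "t \<noteq> 0"
  shows "s * t \<noteq> 0"
proof -
  have lead: "\<exists>i j. coef u i j \<noteq> 0 \<and> (\<forall>k<i. \<forall>l. coef u k l = 0) \<and> (\<forall>l<j. coef u i l = 0)" if "u \<noteq> 0" for u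
  proof -
    have ex: "\<exists>i. \<exists>j. coef u i j \<noteq> 0" using that cps_eqI[of u 0] by fastforce
    define i where "i = (LEAST i. \<exists>j. coef u i j \<noteq> 0)"
    have i: "\<exists>j. coef u i j \<noteq> 0" "\<forall>k<i. \<forall>l. coef u k l = 0"
      using LeastI_ex[OF ex] not_less_Least unfolding i_def by (blast, blast)
    define j where "j = (LEAST j. coef u i j \<noteq> 0)"
    have "coef u i j \<noteq> 0" "\<forall>l<j. coef u i l = 0"
      using LeastI_ex[OF i(1)] not_less_Least unfolding j_def by (blast, blast)
    then show ?thesis using i by blast
  qed
  obtain i j where s: "coef s i j \<noteq> 0" "\<And>k l. k < i \<Longrightarrow> coef s k l = 0" "\<And>l. l < j \<Longrightarrow> coef s i l = 0"
    using lead[OF assms(1)] by blast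
  obtain i' j' where t: "coef t i' j' \<noteq> 0" "\<And>k l. k < i' \<Longrightarrow> coef t k l = 0" "\<And>l. l < j' \<Longrightarrow> coef t i' l = 0"
    using lead[OF assms(2)] by blast
  have "coef s k l * coef t (i + i' - k) (j + j' - l) = (if k = i then if l = j then coef s i j * coef t i' j' else 0 else 0)"
    if "k \<le> i + i'" "l \<le> j + j'" for k l
  proof -
    consider "k < i" | "k > i" | "k = i" "l < j" | "k = i" "l > j" | "k = i" "l = j" by linarith
    then show ?thesis
    proof cases
      case 2
      then have "i + i' - k < i'" using that by linarith
      then show ?thesis using 2 t(2) by simp
    next
      case 4
      then have "j + j' - l < j'" using that by linarith
      then show ?thesis using 4 t(3) by simp
    qed (use s in auto)
  qed
  then have "coef (s * t) (i + i') (j + j') = (\<Sum>k\<le>i + i'. \<Sum>l\<le>j + j'. if k = i then if l = j then coef s i j * coef t i' j' else 0 else 0)"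
    unfolding coef_times ps2_mult_def by (intro sum.cong) auto
  also have "\<dots> = coef s i j * coef t i' j'" by (simp add: sum_atMost_delta2)
  finally show ?thesis using s(1) t(1) by auto
qed

instance cps :: idom
proof
  fix a b c :: cps
  show "0 * a = 0" "a * 0 = 0"
    by (rule ev_eqI, use ev_mult[of 0 a] ev_mult[of a 0] in eventually_elim, simp)+
  show "a * (b + c) = a * b + a * c"
    by (rule ev_eqI, use ev_mult[of a "b + c"] ev_add[of b c] ev_add[of "a * b" "a * c"] ev_mult[of a b] ev_mult[of a c]
        in eventually_elim) (simp add: algebra_simps)
  show "a * b * c = a * (b * c)"
    by (rule ev_eqI, use ev_mult[of "a * b" c] ev_mult[of a b] ev_mult[of a "b * c"] ev_mult[of b c] in eventually_elim) simp
  show "a * b = b * a"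
    by (rule ev_eqI, use ev_mult[of a b] ev_mult[of b a] in eventually_elim) simp
  show "1 * a = a"
    by (rule ev_eqI, use ev_mult[of 1 a] in eventually_elim) simp
  show "(a + b) * c = a * c + b * c"
    by (rule ev_eqI, use ev_mult[of "a + b" c] ev_add[of a b] ev_add[of "a * c" "b * c"] ev_mult[of a c] ev_mult[of b c]
        in eventually_elim) (simp add: algebra_simps)
  have "coef (0 :: cps) 0 0 \<noteq> coef 1 0 0" by simp
  then show "(0 :: cps) \<noteq> 1" by metis
  show "a \<noteq> 0 \<Longrightarrow> b \<noteq> 0 \<Longrightarrow> a * b \<noteq> 0" by (rule cps_times_nonzero)
qed (auto intro: cps_eqI)

lemma ev_power: "\<forall>\<^sub>0z. ev (s ^ n) z = ev s z ^ n"
proof (induction n)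
  case (Suc n)
  then show ?case using ev_mult[of s "s ^ n"] by eventually_elim simp
qed simp

lemma ev_0_0: "ev s (0, 0) = coef s 0 0"
proof -
  have "ev s (0, 0) = (\<Sum>\<^sub>\<infinity>p\<in>{(0, 0)}. coef s (fst p) (snd p) * 0 ^ fst p * 0 ^ snd p)"
    unfolding ev_def ps2_eval_def case_prod_unfold by (rule infsum_cong_neutral) auto
  then show ?thesis by simp
qed

lemma monom2_mult: "monom2 c i j * monom2 d k l = monom2 (c * d) (i + k) (j + l)"
  by (rule ev_eqI, use ev_mult[of "monom2 c i j" "monom2 d k l"] in eventually_elim) (simp add: ev_monom2 power_add)

lemma monom2_power: "monom2 c i j ^ n = monom2 (c ^ n) (i * n) (j * n)"
  by (induction n) (auto simp: one_cps_monom2 monom2_mult)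

lemma coef_monom2_mult:
  "coef (monom2 c i j * s) k l = (if i \<le> k \<and> j \<le> l then c * coef s (k - i) (l - j) else 0)"
proof -
  have "coef (monom2 c i j * s) k l
      = (\<Sum>k'\<le>k. \<Sum>l'\<le>l. if k' = i then if l' = j then c * coef s (k - i) (l - j) else 0 else 0)"
    unfolding coef_times ps2_mult_def by (intro sum.cong) (auto simp: coef_monom2)
  then show ?thesis by (simp add: sum_atMost_delta2)
qed

lemma coef_cst_mult [simp]: "coef (cst c * s) i j = c * coef s i j"
  by (simp add: coef_monom2_mult)

lemma coef_sum: "coef (\<Sum>x\<in>I. f x) i j = (\<Sum>x\<in>I. coef (f x) i j)"
  by (induction I rule: infinite_finite_induct) auto

lemma coef_mult_0_0 [simp]: "coef (s * t) 0 0 = coef s 0 0 * coef t 0 0"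
  by (simp add: coef_times ps2_mult_def)

lemma coef_power_0_0 [simp]: "coef (s ^ n) 0 0 = coef s 0 0 ^ n"
  by (induction n) auto

lemma ev_holomorphic2_on:
  obtains r where "r > 0" "ev s holomorphic2_on polydisc r"
proof -
  have "convergent_ps2 (coef s)" by simp
  then obtain r where "r > 0" "ps2_abs_conv (coef s) r"
    unfolding convergent_ps2_def by blast
  then show ?thesis using that ps2_eval_holomorphic2_on by (metis ev_def)
qed

lemma isCont_ev: "isCont (ev s) (0, 0)"
proof -
  obtain r where r: "r > 0" "ev s holomorphic2_on polydisc r" by (rule ev_holomorphic2_on)
  then have "continuous_on (polydisc r) (ev s)" by (simp add: holomorphic2_on_def)
  then show ?thesis using r(1) by (simp add: continuous_on_eq_continuous_at)
qed

lemma holomorphic2_on_imp_ev: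
  assumes "F holomorphic2_on U" "open U" "(0, 0) \<in> U"
  obtains s where "\<forall>\<^sub>0z. ev s z = F z"
proof -
  obtain a where a: "convergent_ps2 a" "\<forall>\<^sub>0z. F z = ps2_eval a z"
    using holomorphic2_on_imp_ps2_eval[OF assms] .
  have "\<forall>\<^sub>0z. ev (Cps a) z = F z" using a(2) by eventually_elim (simp add: ev_def a(1))
  then show ?thesis by (rule that)
qed

text \<open>The inverse is found as a function: the reciprocal of \<open>ev s\<close> is holomorphic
  where \<open>ev s\<close> does not vanish, and is then expanded.\<close>

lemma cps_unit:
  assumes "coef s 0 0 \<noteq> 0"
  obtains t where "s * t = 1"
proof -
  obtain r where r: "r > 0" "ev s holomorphic2_on polydisc r" by (rule ev_holomorphic2_on)
  have c: "continuous_on (polydisc r) (ev s)" using r by (simp add: holomorphic2_on_def)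
  define U where "U = polydisc r \<inter> ev s -` (- {0})"
  have U: "open U" "(0, 0) \<in> U"
    using continuous_open_preimage[OF c] r assms by (auto simp: U_def ev_0_0)
  have "(\<lambda>z. 1 / ev s z) holomorphic2_on U"
    by (intro holomorphic2_on_divide holomorphic2_on_const holomorphic2_on_subset[OF r(2)]) (auto simp: U_def)
  then obtain t where t: "\<forall>\<^sub>0z. ev t z = 1 / ev s z" using holomorphic2_on_imp_ev[OF _ U] by blast
  have nz: "\<forall>\<^sub>0z. z \<in> U" using U eventually_nhds_in_open by blast
  have "s * t = 1"
    by (rule ev_eqI, use ev_mult[of s t] t nz in eventually_elim) (auto simp: U_def)
  then show ?thesis by (rule that)
qed

lemma holomorphic2_on_ps2_eval_compose:
  assumes a: "ps2_abs_conv a r"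
    and FG: "F holomorphic2_on U" "G holomorphic2_on U" "open U"
    and bd: "\<And>z. z \<in> U \<Longrightarrow> norm (F z) \<le> r" "\<And>z. z \<in> U \<Longrightarrow> norm (G z) \<le> r"
  shows "(\<lambda>z. ps2_eval a (F z, G z)) holomorphic2_on U"
proof -
  have "(\<lambda>z. \<Sum>\<^sub>\<infinity>p. a (fst p) (snd p) * F z ^ fst p * G z ^ snd p) holomorphic2_on U"
  proof (rule holomorphic2_on_infsum[where M = "\<lambda>(i, j). norm (a i j) * r ^ (i + j)"])
    show "(\<lambda>z. a (fst p) (snd p) * F z ^ fst p * G z ^ snd p) holomorphic2_on U" for p :: "nat \<times> nat"
      by (intro holomorphic2_on_mult holomorphic2_on_power FG) auto
    fix p :: "nat \<times> nat" and z assume z: "z \<in> U"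
    have "0 \<le> r" using bd(1)[OF z] norm_ge_zero order_trans by blast
    with bd[OF z] have "norm (F z) ^ fst p * norm (G z) ^ snd p \<le> r ^ fst p * r ^ snd p"
      by (intro mult_mono power_mono) auto
    then show "norm (a (fst p) (snd p) * F z ^ fst p * G z ^ snd p) \<le> (case p of (i, j) \<Rightarrow> norm (a i j) * r ^ (i + j))"
      by (simp add: case_prod_unfold norm_mult norm_power power_add mult_left_mono mult.assoc)
  qed (use a FG in auto)
  then show ?thesis by (simp add: ps2_eval_def case_prod_unfold)
qed

text \<open>Composition with the map germ (X, Y), defined through germs rather than coefficients.
  The chosen series is unique by \<open>ev_eqI\<close>, and it exists when \<open>X\<close> and
  \<open>Y\<close> have no constant term.\<close>

definition subst :: "cps \<Rightarrow> cps \<Rightarrow> cps \<Rightarrow> cps" where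
  "subst s X Y = (SOME t. \<forall>\<^sub>0z. ev t z = ev s (ev X z, ev Y z))"

lemma ev_subst:
  assumes XY: "coef X 0 0 = 0" "coef Y 0 0 = 0"
  shows "\<forall>\<^sub>0z. ev (subst s X Y) z = ev s (ev X z, ev Y z)"
proof -
  have "convergent_ps2 (coef s)" by simp
  then obtain r where r: "r > 0" "ps2_abs_conv (coef s) r"
    unfolding convergent_ps2_def by blast
  obtain r1 where r1: "r1 > 0" "ev X holomorphic2_on polydisc r1" by (rule ev_holomorphic2_on)
  obtain r2 where r2: "r2 > 0" "ev Y holomorphic2_on polydisc r2" by (rule ev_holomorphic2_on)
  define V where "V = polydisc (min r1 r2)"
  have h: "ev X holomorphic2_on V" "ev Y holomorphic2_on V"
    unfolding V_def by (rule holomorphic2_on_subset[OF r1(2)] holomorphic2_on_subset[OF r2(2)]; simp add: polydisc_mono)+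
  define U where "U = (V \<inter> ev X -` ball 0 r) \<inter> (V \<inter> ev Y -` ball 0 r)"
  have U: "open U" "(0, 0) \<in> U"
    using r r1 r2 XY h unfolding U_def
    by (auto intro!: continuous_open_preimage simp: holomorphic2_on_def V_def ev_0_0)
  have "(\<lambda>z. ps2_eval (coef s) (ev X z, ev Y z)) holomorphic2_on U"
    by (rule holomorphic2_on_ps2_eval_compose[OF r(2)])
       (use U in \<open>auto simp: U_def less_imp_le intro: holomorphic2_on_subset[OF h(1)] holomorphic2_on_subset[OF h(2)]\<close>)
  then have "\<exists>t. \<forall>\<^sub>0z. ev t z = ev s (ev X z, ev Y z)"
    using holomorphic2_on_imp_ev[OF _ U] unfolding ev_def by metis
  then show ?thesis unfolding subst_def by (rule someI_ex)
qed

section \<open>Substitution, derivatives and local inverses\<close>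

lemma near0_compose:
  assumes "near0 P" "coef X 0 0 = 0" "coef Y 0 0 = 0"
  shows "\<forall>\<^sub>0z. P (ev X z, ev Y z)"
proof -
  have "((\<lambda>z. (ev X z, ev Y z)) \<longlongrightarrow> (ev X (0, 0), ev Y (0, 0))) (nhds (0, 0))"
    using isCont_ev[of X] isCont_ev[of Y] unfolding isCont_def tendsto_at_iff_tendsto_nhds
    by (rule tendsto_Pair)
  then show ?thesis using assms by (simp add: ev_0_0 filterlim_iff)
qed

abbreviation xvar :: cps where "xvar \<equiv> monom2 1 1 0"
abbreviation yvar :: cps where "yvar \<equiv> monom2 1 0 1"

lemma coef_monom2_0_0 [simp]: "coef (monom2 c i j) 0 0 = (if i = 0 \<and> j = 0 then c else 0)"
  by (simp add: coef_monom2)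

lemma coef_linear_monom2_0_0: "coef (monom2 c 1 0) 0 0 = 0" "coef (monom2 c 0 1) 0 0 = 0"
  by simp_all

context
  fixes X Y :: cps
  assumes XY: "coef X 0 0 = 0" "coef Y 0 0 = 0"
begin

lemma subst_add: "subst (s + t) X Y = subst s X Y + subst t X Y"
  by (rule ev_eqI, use ev_subst[OF XY, of "s + t"] ev_subst[OF XY, of s] ev_subst[OF XY, of t]
      near0_compose[OF ev_add XY, of s t] ev_add[of "subst s X Y" "subst t X Y"] in eventually_elim) simp

lemma subst_mult: "subst (s * t) X Y = subst s X Y * subst t X Y"
  by (rule ev_eqI, use ev_subst[OF XY, of "s * t"] ev_subst[OF XY, of s] ev_subst[OF XY, of t]
      near0_compose[OF ev_mult XY, of s t] ev_mult[of "subst s X Y" "subst t X Y"] in eventually_elim) simp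

lemma subst_monom2: "subst (monom2 c i j) X Y = cst c * X ^ i * Y ^ j"
  by (rule ev_eqI, use ev_subst[OF XY, of "monom2 c i j"] ev_mult[of "cst c * X ^ i" "Y ^ j"] ev_mult[of "cst c" "X ^ i"]
      ev_power[of X i] ev_power[of Y j] in eventually_elim) (simp add: ev_monom2)

lemma subst_1: "subst 1 X Y = 1"
  using subst_monom2[of 1 0 0] by (simp flip: one_cps_monom2)

lemma subst_power: "subst (s ^ n) X Y = subst s X Y ^ n"
  by (induction n) (simp_all add: subst_1 subst_mult)

lemma coef_subst_0_0: "coef (subst s X Y) 0 0 = coef s 0 0"
proof -
  have "ev (subst s X Y) (0, 0) = ev s (ev X (0, 0), ev Y (0, 0))"
    using ev_subst[OF XY, of s] by (rule eventually_nhds_x_imp_x)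
  then show ?thesis by (simp add: ev_0_0 XY)
qed

lemma subst_vars: "subst xvar X Y = X" "subst yvar X Y = Y"
  by (simp_all add: subst_monom2 flip: one_cps_monom2)

end

lemma subst_subst:
  assumes "coef X 0 0 = 0" "coef Y 0 0 = 0" "coef X' 0 0 = 0" "coef Y' 0 0 = 0"
  shows "subst (subst s X Y) X' Y' = subst s (subst X X' Y') (subst Y X' Y')"
proof (rule ev_eqI)
  note a = ev_subst[OF assms(3,4)]
  have "\<forall>\<^sub>0z. ev (subst s (subst X X' Y') (subst Y X' Y')) z = ev s (ev (subst X X' Y') z, ev (subst Y X' Y') z)"
    by (rule ev_subst) (simp_all add: coef_subst_0_0 assms)
  with a[of "subst s X Y"] a[of X] a[of Y] near0_compose[OF ev_subst[OF assms(1,2), of s] assms(3,4)]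
  show "\<forall>\<^sub>0z. ev (subst (subst s X Y) X' Y') z = ev (subst s (subst X X' Y') (subst Y X' Y')) z"
    by eventually_elim simp
qed

lemma subst_xvar_yvar: "subst s xvar yvar = s"
  by (rule ev_eqI, use ev_subst[OF coef_linear_monom2_0_0(1)[of 1] coef_linear_monom2_0_0(2)[of 1], of s] in eventually_elim) (simp add: coef_monom2 ev_monom2)

lemma coef_subst_scale: "coef (subst s (monom2 \<alpha> 1 0) (monom2 \<beta> 0 1)) i j = \<alpha> ^ i * \<beta> ^ j * coef s i j"
proof -
  define a where "a = (\<lambda>i j. \<alpha> ^ i * \<beta> ^ j * coef s i j)"
  have "convergent_ps2 (coef s)" by simp
  then obtain r where r: "r > 0" "ps2_abs_conv (coef s) r"
    unfolding convergent_ps2_def by blast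
  define M where "M = 1 + norm \<alpha> + norm \<beta>"
  have M: "M > 0" "norm \<alpha> \<le> M" "norm \<beta> \<le> M" by (auto simp: M_def add_pos_nonneg add_nonneg_nonneg)
  have "ps2_abs_conv a (r / M)"
  proof (rule summable_on_comparison_test[OF r(2)])
    fix p :: "nat \<times> nat"
    obtain i j where p: "p = (i, j)" by force
    have "norm \<alpha> ^ i * norm \<beta> ^ j \<le> M ^ i * M ^ j" using M by (intro mult_mono power_mono) auto
    then have "norm \<alpha> ^ i * norm \<beta> ^ j / M ^ (i + j) \<le> 1" using M by (simp add: power_add)
    then have "(norm \<alpha> ^ i * norm \<beta> ^ j / M ^ (i + j)) * (norm (coef s i j) * r ^ (i + j)) \<le> 1 * (norm (coef s i j) * r ^ (i + j))"
      using r by (intro mult_right_mono) auto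
    then show "(case p of (i, j) \<Rightarrow> norm (a i j) * (r / M) ^ (i + j)) \<le> (case p of (i, j) \<Rightarrow> norm (coef s i j) * r ^ (i + j))"
      by (simp add: p a_def norm_mult norm_power power_divide mult_ac)
  qed (use r M in auto)
  then have c: "convergent_ps2 a" unfolding convergent_ps2_def using r M by (intro exI[of _ "r / M"]) auto
  have "subst s (monom2 \<alpha> 1 0) (monom2 \<beta> 0 1) = Cps a"
  proof (rule ev_eqI, use ev_subst[OF coef_linear_monom2_0_0(1)[of \<alpha>] coef_linear_monom2_0_0(2)[of \<beta>], of s] in eventually_elim)
    case (elim z)
    have "ev (Cps a) z = ev s (\<alpha> * fst z, \<beta> * snd z)"
      unfolding ev_def coef_Cps[OF c] by (simp add: ps2_eval_def a_def power_mult_distrib mult_ac)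
    with elim show ?case by (simp add: ev_monom2)
  qed
  then have "coef (subst s (monom2 \<alpha> 1 0) (monom2 \<beta> 0 1)) i j = a i j" using c by simp
  then show ?thesis by (simp add: a_def)
qed

lemma ps2_transpose:
  shows "convergent_ps2 a \<Longrightarrow> convergent_ps2 (\<lambda>i j. a j i)" and "ps2_eval (\<lambda>i j. a j i) (x, y) = ps2_eval a (y, x)"
proof -
  assume "convergent_ps2 a"
  then obtain r where r: "r > 0" "(\<lambda>(i, j). norm (a i j) * r ^ (i + j)) summable_on (UNIV \<times> UNIV)"
    unfolding convergent_ps2_def by auto
  then show "convergent_ps2 (\<lambda>i j. a j i)" unfolding convergent_ps2_def
    using summable_on_swap[of "\<lambda>(i, j). norm (a i j) * r ^ (i + j)" UNIV UNIV]
    by (intro exI[of _ r]) (simp add: case_prod_unfold add.commute)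
next
  show "ps2_eval (\<lambda>i j. a j i) (x, y) = ps2_eval a (y, x)"
    unfolding ps2_eval_def
    by (rule infsum_reindex_bij_witness[of _ prod.swap prod.swap]) (auto simp: mult_ac)
qed

lemma coef_subst_swap: "coef (subst s yvar xvar) i j = coef s j i"
proof -
  have "subst s yvar xvar = Cps (\<lambda>i j. coef s j i)"
  proof (rule ev_eqI, use ev_subst[OF coef_linear_monom2_0_0(2)[of 1] coef_linear_monom2_0_0(1)[of 1], of s] in eventually_elim)
    case (elim z)
    have "ev (Cps (\<lambda>i j. coef s j i)) z = ev s (snd z, fst z)"
      unfolding ev_def coef_Cps[OF ps2_transpose(1)[OF convergent_coef]] using ps2_transpose(2)[of "coef s" "fst z" "snd z"] by simp
    with elim show ?case by (simp add: ev_monom2)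
  qed
  then show ?thesis by (simp add: ps2_transpose)
qed

section \<open>Partial derivatives and the chain rule\<close>

definition dy :: "cps \<Rightarrow> cps" where "dy s = Cps (\<lambda>i j. of_nat (Suc j) * coef s i (Suc j))"
definition dx :: "cps \<Rightarrow> cps" where "dx s = Cps (\<lambda>i j. of_nat (Suc i) * coef s (Suc i) j)"

lemma convergent_ps2_bounded:
  fixes a :: ps2
  assumes "ps2_abs_conv a r" "r \<ge> 0"
  obtains M where "\<And>i j. norm (a i j) * r ^ (i + j) \<le> M"
proof -
  have "norm (a i j) * r ^ (i + j) \<le> (\<Sum>\<^sub>\<infinity>(i, j). norm (a i j) * r ^ (i + j))" for i j
  proof -
    have "(\<Sum>p\<in>{(i, j)}. case p of (i, j) \<Rightarrow> norm (a i j) * r ^ (i + j)) \<le> (\<Sum>\<^sub>\<infinity>(i, j). norm (a i j) * r ^ (i + j))"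
      by (rule finite_sum_le_infsum[OF assms(1)]) (use assms(2) in auto)
    then show ?thesis by simp
  qed
  then show ?thesis by (rule that)
qed

text \<open>Termwise differentiation. The factor \<open>Suc j\<close> is at most
  \<open>2 ^ j\<close>, which costs half of the radius; passing from bounded to summable costs
  another half.\<close>

lemma ps2_dy:
  assumes a: "ps2_abs_conv a r" and r: "r > 0"
  defines "b \<equiv> \<lambda>i j. of_nat (Suc j) * a i (Suc j)"
  shows "ps2_abs_conv b (r / 4)"
    and "norm x < r / 4 \<Longrightarrow> norm y < r / 4 \<Longrightarrow>
      ((\<lambda>t. ps2_eval a (x, t)) has_field_derivative ps2_eval b (x, y)) (at y)"
proof -
  obtain M where M: "\<And>i j. norm (a i j) * r ^ (i + j) \<le> M"
    using convergent_ps2_bounded[OF a] r by auto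
  have bd: "norm (b i j) * (r / 2) ^ (i + j) \<le> M / r" for i j
  proof -
    have "real (Suc j) \<le> 2 ^ j" by (induction j) auto
    also have "\<dots> \<le> 2 ^ (i + j)" by (simp add: power_increasing)
    finally have j: "real (Suc j) / 2 ^ (i + j) \<le> 1" by simp
    have "norm (b i j) * (r / 2) ^ (i + j) = (real (Suc j) / 2 ^ (i + j)) * ((norm (a i (Suc j)) * r ^ (i + Suc j)) / r)"
      using r by (simp add: b_def norm_mult power_divide del: of_nat_Suc)
    also have "\<dots> \<le> 1 * (M / r)"
      by (rule mult_mono[OF j divide_right_mono[OF M]]) (use r in auto)
    finally show ?thesis by simp
  qed
  show b: "ps2_abs_conv b (r / 4)"
    by (rule ps2_summable_of_bounded[OF bd]) (use r in auto)
  assume x: "norm x < r / 4" and y: "norm y < r / 4"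
  let ?A = "\<lambda>j. \<Sum>i. a i j * x ^ i"
  have xr: "norm x \<le> r" using x r by auto
  have sums: "(\<lambda>j. ?A j * y ^ j) sums ps2_eval a (x, y)" if "norm y \<le> r" for y
    by (rule ps2_eval_rows(2)[OF a xr r that])
  have "((\<lambda>y. \<Sum>j. ?A j * y ^ j) has_field_derivative (\<Sum>j. diffs ?A j * y ^ j)) (at y)"
    by (rule termdiffs_strong[of _ "of_real r"]) (use sums[of "of_real r"] r y in \<open>auto simp: sums_iff\<close>)
  moreover have "(\<Sum>j. diffs ?A j * y ^ j) = ps2_eval b (x, y)"
  proof -
    have "diffs ?A j = (\<Sum>i. b i j * x ^ i)" for j
      unfolding diffs_def b_def using suminf_mult[OF ps2_eval_rows(1)[OF a xr r], of "of_nat (Suc j)" "Suc j"]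
      by (simp add: mult.assoc)
    moreover have "(\<lambda>j. (\<Sum>i. b i j * x ^ i) * y ^ j) sums ps2_eval b (x, y)"
      by (rule ps2_eval_rows(2)[OF b]) (use x y r in auto)
    ultimately show ?thesis by (simp add: sums_iff)
  qed
  ultimately have d: "((\<lambda>y. \<Sum>j. ?A j * y ^ j) has_field_derivative ps2_eval b (x, y)) (at y)" by simp
  have e: "\<forall>\<^sub>F t in nhds y. (\<Sum>j. ?A j * t ^ j) = ps2_eval a (x, t)"
  proof -
    have "\<forall>\<^sub>F t in nhds y. t \<in> ball 0 (r / 4)" using y by (intro eventually_nhds_in_open) auto
    then show ?thesis by eventually_elim (use sums r in \<open>auto simp: sums_iff\<close>)
  qed
  show "((\<lambda>t. ps2_eval a (x, t)) has_field_derivative ps2_eval b (x, y)) (at y)"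
    using iffD1[OF DERIV_cong_ev[OF refl e refl] d] .
qed

lemma coef_dy [simp]: "coef (dy s) i j = of_nat (Suc j) * coef s i (Suc j)"
  and coef_dx [simp]: "coef (dx s) i j = of_nat (Suc i) * coef s (Suc i) j"
proof -
  have *: "convergent_ps2 (\<lambda>i j. of_nat (Suc j) * a i (Suc j))" if "convergent_ps2 a" for a :: ps2
  proof -
    obtain r where r: "r > 0" "ps2_abs_conv a r"
      using \<open>convergent_ps2 a\<close> unfolding convergent_ps2_def by blast
    show ?thesis unfolding convergent_ps2_def
      by (rule exI[of _ "r / 4"]) (use ps2_dy(1)[OF r(2,1)] r(1) in auto)
  qed
  show "coef (dy s) i j = of_nat (Suc j) * coef s i (Suc j)" by (simp add: dy_def * del: of_nat_Suc)
  have "convergent_ps2 (\<lambda>i j. of_nat (Suc i) * coef s (Suc i) j)"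
    using ps2_transpose(1)[OF *[OF ps2_transpose(1)[OF convergent_coef[of s]]]] by simp
  then show "coef (dx s) i j = of_nat (Suc i) * coef s (Suc i) j" by (simp add: dx_def del: of_nat_Suc)
qed

lemma ev_partial_derivatives:
  "\<exists>r>0. (\<forall>x y. norm x < r \<longrightarrow> norm y < r \<longrightarrow>
     ((\<lambda>t. ev s (t, y)) has_field_derivative ev (dx s) (x, y)) (at x) \<and>
     ((\<lambda>t. ev s (x, t)) has_field_derivative ev (dy s) (x, y)) (at y))"
proof -
  have "convergent_ps2 (coef s)" by simp
  then obtain r where r: "r > 0" "ps2_abs_conv (coef s) r"
    unfolding convergent_ps2_def by blast
  let ?t = "\<lambda>i j. coef s j i"
  have t: "ps2_abs_conv ?t r"
    using summable_on_swap[of "\<lambda>(i, j). norm (coef s i j) * r ^ (i + j)" UNIV UNIV] r(2)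
    by (simp add: case_prod_unfold add.commute)
  show ?thesis
  proof (intro exI[of _ "r / 4"] conjI allI impI)
    fix x y :: complex assume xy: "norm x < r / 4" "norm y < r / 4"
    have "((\<lambda>t. ps2_eval ?t (y, t)) has_field_derivative ps2_eval (\<lambda>i j. of_nat (Suc j) * ?t i (Suc j)) (y, x)) (at x)"
      by (rule ps2_dy(2)[OF t r(1) xy(2,1)])
    then show "((\<lambda>t. ev s (t, y)) has_field_derivative ev (dx s) (x, y)) (at x)"
      unfolding ev_def coef_dx[abs_def] ps2_transpose(2)[of "coef s"]
      using ps2_transpose(2)[of "\<lambda>i j. of_nat (Suc i) * coef s (Suc i) j" y x] by simp
    show "((\<lambda>t. ev s (x, t)) has_field_derivative ev (dy s) (x, y)) (at y)"
      unfolding ev_def coef_dy[abs_def] by (rule ps2_dy(2)[OF r(2,1) xy])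
  qed (use r in auto)
qed

text \<open>Continuous partial derivatives give a total derivative, the form in which the chain rule
  and the inverse function theorem are applied.\<close>

lemma ev_has_derivative:
  "\<forall>\<^sub>0z. (ev s has_derivative (\<lambda>h. ev (dx s) z * fst h + ev (dy s) z * snd h)) (at z)"
proof -
  obtain r1 where r1: "r1 > 0" "\<And>x y. norm x < r1 \<Longrightarrow> norm y < r1 \<Longrightarrow>
     ((\<lambda>t. ev s (t, y)) has_field_derivative ev (dx s) (x, y)) (at x)"
     "\<And>x y. norm x < r1 \<Longrightarrow> norm y < r1 \<Longrightarrow>
     ((\<lambda>t. ev s (x, t)) has_field_derivative ev (dy s) (x, y)) (at y)"
    using ev_partial_derivatives[of s] by blast
  obtain r2 where r2: "r2 > 0" "ev (dy s) holomorphic2_on polydisc r2" by (rule ev_holomorphic2_on)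
  define r where "r = min r1 r2"
  have r: "r > 0" "r \<le> r1" "r \<le> r2" using r1 r2 by (auto simp: r_def)
  have "(ev s has_derivative (\<lambda>h. ev (dx s) (x, y) * fst h + ev (dy s) (x, y) * snd h)) (at (x, y))"
    if xy: "norm x < r" "norm y < r" for x y
  proof -
    have cont: "continuous_on (polydisc r) (ev (dy s))"
      using r2(2) r(3) continuous_on_subset polydisc_mono unfolding holomorphic2_on_def by blast
    define B where "B = (\<lambda>x y. Blinfun (\<lambda>k. ev (dy s) (x, y) * k))"
    have Bap: "blinfun_apply (B x y) = (\<lambda>k. ev (dy s) (x, y) * k)" for x y
      unfolding B_def by (simp add: bounded_linear_Blinfun_apply bounded_linear_mult_right)
    have "((\<lambda>(x, y). (\<lambda>x y. ev s (x, y)) x y) has_derivative (\<lambda>(tx, ty). ev (dx s) (x, y) * tx + B x y ty))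
        (at (x, y) within ball 0 r \<times> ball 0 r)"
    proof (rule has_derivative_partialsI)
      show "((\<lambda>x. ev s (x, y)) has_derivative (*) (ev (dx s) (x, y))) (at x within ball 0 r)"
        using r1(2)[of x y] xy r(2) has_field_derivative_at_within unfolding has_field_derivative_def by force
      show "((\<lambda>y. ev s (x, y)) has_derivative blinfun_apply (B x y)) (at y within ball 0 r)"
        if "x \<in> ball 0 r" "y \<in> ball 0 r" for x y
        using r1(3)[of x y] that r(2) has_field_derivative_at_within
        unfolding has_field_derivative_def Bap by force
      have "continuous_on (polydisc r) (\<lambda>z. case z of (x, y) \<Rightarrow> B x y)"
        by (rule continuous_on_blinfun_componentwise)
           (auto simp: Bap case_prod_unfold intro!: continuous_intros cont)
      then show "continuous (at (x, y) within ball 0 r \<times> ball 0 r) (\<lambda>(x, y). B x y)"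
        using xy unfolding continuous_on_eq_continuous_within polydisc_def by auto
    qed (use xy in auto)
    moreover have "(at (x, y) within ball 0 r \<times> ball 0 r) = at (x, y)"
      by (rule at_within_open) (use xy in \<open>auto intro: open_Times\<close>)
    ultimately show ?thesis by (simp add: case_prod_unfold Bap)
  qed
  then show ?thesis unfolding eventually_nhds_polydisc using r(1) by (intro exI[of _ r]) auto
qed


lemma partials_subst:
  assumes XY: "coef X 0 0 = 0" "coef Y 0 0 = 0"
  shows "dx (subst s X Y) = subst (dx s) X Y * dx X + subst (dy s) X Y * dx Y"
    and "dy (subst s X Y) = subst (dx s) X Y * dy X + subst (dy s) X Y * dy Y"
proof -
  \<comment> \<open>To be differentiated at \<open>z\<close>, the identity must hold on a
    neighbourhood of \<open>z\<close> and not only at \<open>z\<close>.\<close>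
  have "\<forall>\<^sub>0z. \<forall>\<^sub>F w in nhds z. ev (subst s X Y) w = ev s (ev X w, ev Y w)"
    using ev_subst[OF XY, of s] by (simp add: eventually_eventually)
  with ev_has_derivative[of "subst s X Y"] near0_compose[OF ev_has_derivative[of s] XY]
    ev_has_derivative[of X] ev_has_derivative[of Y]
  have *: "\<forall>\<^sub>0z. \<forall>h. ev (dx (subst s X Y)) z * fst h + ev (dy (subst s X Y)) z * snd h =
     ev (dx s) (ev X z, ev Y z) * (ev (dx X) z * fst h + ev (dy X) z * snd h) +
     ev (dy s) (ev X z, ev Y z) * (ev (dx Y) z * fst h + ev (dy Y) z * snd h)"
  proof eventually_elim
    case (elim z)
    have "((\<lambda>w. ev s (ev X w, ev Y w)) has_derivative (\<lambda>h.
       ev (dx s) (ev X z, ev Y z) * fst (ev (dx X) z * fst h + ev (dy X) z * snd h, ev (dx Y) z * fst h + ev (dy Y) z * snd h) +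
       ev (dy s) (ev X z, ev Y z) * snd (ev (dx X) z * fst h + ev (dy X) z * snd h, ev (dx Y) z * fst h + ev (dy Y) z * snd h))) (at z)"
      by (rule has_derivative_compose[OF has_derivative_Pair[OF elim(3,4)] elim(2)])
    then have "(ev (subst s X Y) has_derivative (\<lambda>h.
       ev (dx s) (ev X z, ev Y z) * (ev (dx X) z * fst h + ev (dy X) z * snd h) +
       ev (dy s) (ev X z, ev Y z) * (ev (dx Y) z * fst h + ev (dy Y) z * snd h))) (at z)"
      unfolding fst_conv snd_conv
      by (rule has_derivative_transform_eventually)
         (use elim(5) eventually_nhds_x_imp_x[OF elim(5)] in \<open>auto simp: eventually_at_filter elim: eventually_mono\<close>)
    from has_derivative_unique[OF elim(1) this] show ?case by metis
  qed
  note e = ev_subst[OF XY, of "dx s"] ev_subst[OF XY, of "dy s"]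
  show "dx (subst s X Y) = subst (dx s) X Y * dx X + subst (dy s) X Y * dx Y"
  proof (rule ev_eqI, use * e ev_add[of "subst (dx s) X Y * dx X" "subst (dy s) X Y * dx Y"]
        ev_mult[of "subst (dx s) X Y" "dx X"] ev_mult[of "subst (dy s) X Y" "dx Y"] in eventually_elim)
    case (elim z)
    then show ?case using elim(1)[rule_format, of "(1, 0)"] by simp
  qed
  show "dy (subst s X Y) = subst (dx s) X Y * dy X + subst (dy s) X Y * dy Y"
  proof (rule ev_eqI, use * e ev_add[of "subst (dx s) X Y * dy X" "subst (dy s) X Y * dy Y"]
        ev_mult[of "subst (dx s) X Y" "dy X"] ev_mult[of "subst (dy s) X Y" "dy Y"] in eventually_elim)
    case (elim z)
    then show ?case using elim(1)[rule_format, of "(0, 1)"] by simp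
  qed
qed

text \<open>The chain rule at the origin: linear parts compose like matrices.\<close>

lemma linear_coef_subst:
  assumes XY: "coef X 0 0 = 0" "coef Y 0 0 = 0"
  shows "coef (subst s X Y) 1 0 = coef s 1 0 * coef X 1 0 + coef s 0 1 * coef Y 1 0"
    and "coef (subst s X Y) 0 1 = coef s 1 0 * coef X 0 1 + coef s 0 1 * coef Y 0 1"
  using arg_cong[OF partials_subst(1)[OF XY, of s], of "\<lambda>t. coef t 0 0"]
    arg_cong[OF partials_subst(2)[OF XY, of s], of "\<lambda>t. coef t 0 0"]
  by (simp_all add: coef_subst_0_0[OF XY])

section \<open>The holomorphic inverse function theorem\<close>

lemma complex_linear_imp_field_derivative:
  fixes f :: "complex \<Rightarrow> complex"
  assumes "(f has_derivative D) (at x)" "\<And>h. D h = h * c"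
  shows "f field_differentiable at x"
proof -
  have "D = (*) c" using assms(2) by (auto simp: fun_eq_iff)
  then show ?thesis using assms(1) unfolding field_differentiable_def has_field_derivative_def by blast
qed

text \<open>The inverse function theorem is applied to real derivatives; the inverse is holomorphic
  because its derivative inverts a complex-linear map.\<close>

lemma local_inverse_exists:
  assumes XY: "coef X 0 0 = 0" "coef Y 0 0 = 0"
    and det: "coef X 1 0 * coef Y 0 1 - coef X 0 1 * coef Y 1 0 \<noteq> 0"
  obtains P Q where "coef P 0 0 = 0" "coef Q 0 0 = 0" "subst X P Q = xvar" "subst Y P Q = yvar"
    "subst P X Y = xvar" "subst Q X Y = yvar"
proof -
  define f where "f = (\<lambda>z. (ev X z, ev Y z))"
  define A where "A = (\<lambda>z h. (ev (dx X) z * fst h + ev (dy X) z * snd h, ev (dx Y) z * fst h + ev (dy Y) z * snd h))"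
  have "\<forall>\<^sub>0z. (f has_derivative A z) (at z)"
    using ev_has_derivative[of X] ev_has_derivative[of Y] unfolding f_def A_def
    by eventually_elim (rule has_derivative_Pair)
  then obtain r0 where r0: "r0 > 0" "\<And>z. z \<in> polydisc r0 \<Longrightarrow> (f has_derivative A z) (at z)"
    unfolding eventually_nhds_polydisc by blast
  obtain r1 where r1: "r1 > 0" "ev (dx X) holomorphic2_on polydisc r1" by (rule ev_holomorphic2_on)
  obtain r2 where r2: "r2 > 0" "ev (dy X) holomorphic2_on polydisc r2" by (rule ev_holomorphic2_on)
  obtain r3 where r3: "r3 > 0" "ev (dx Y) holomorphic2_on polydisc r3" by (rule ev_holomorphic2_on)
  obtain r4 where r4: "r4 > 0" "ev (dy Y) holomorphic2_on polydisc r4" by (rule ev_holomorphic2_on)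
  define r where "r = min r0 (min (min r1 r2) (min r3 r4))"
  define U where "U = polydisc r"
  have sub: "U \<subseteq> polydisc r0" "U \<subseteq> polydisc r1" "U \<subseteq> polydisc r2" "U \<subseteq> polydisc r3" "U \<subseteq> polydisc r4"
    unfolding U_def by (rule polydisc_mono, simp add: r_def)+
  have cont: "continuous_on U (ev (dx X))" "continuous_on U (ev (dy X))" "continuous_on U (ev (dx Y))" "continuous_on U (ev (dy Y))"
    using sub r1 r2 r3 r4 unfolding holomorphic2_on_def by (blast intro: continuous_on_subset)+
  have U: "open U" "(0, 0) \<in> U" using r0 r1 r2 r3 r4 by (auto simp: U_def r_def)
  have blA: "bounded_linear (A z)" for z unfolding A_def
    by (intro bounded_linear_Pair bounded_linear_add bounded_linear_const_mult bounded_linear_fst bounded_linear_snd)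
  define f' where "f' = (\<lambda>z. Blinfun (A z))"
  have f'ap: "blinfun_apply (f' z) = A z" for z
    unfolding f'_def using blA by (rule bounded_linear_Blinfun_apply)
  have contf': "continuous_on U f'"
    by (rule continuous_on_blinfun_componentwise) (auto simp: f'ap A_def intro!: continuous_intros cont)
  let ?a = "coef X 1 0" and ?b = "coef X 0 1" and ?c = "coef Y 1 0" and ?d = "coef Y 0 1"
  define D where "D = ?a * ?d - ?b * ?c"
  \<comment> \<open>The adjugate of the linear part divided by its determinant, hence a left inverse
    of \<open>A (0, 0)\<close>.\<close>
  define B where "B = (\<lambda>h. (?d / D * fst h + - ?b / D * snd h, - ?c / D * fst h + ?a / D * snd h))"
  have blB: "bounded_linear B" unfolding B_def
    by (intro bounded_linear_Pair bounded_linear_add bounded_linear_const_mult bounded_linear_fst bounded_linear_snd)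
  have A0: "A (0, 0) = (\<lambda>h. (?a * fst h + ?b * snd h, ?c * fst h + ?d * snd h))"
    by (simp add: A_def ev_0_0)
  have "D \<noteq> 0" using det by (simp add: D_def)
  have BA: "B (A (0, 0) h) = h" for h
  proof -
    have "?d * (?a * fst h + ?b * snd h) - ?b * (?c * fst h + ?d * snd h) = D * fst h"
      "?a * (?c * fst h + ?d * snd h) - ?c * (?a * fst h + ?b * snd h) = D * snd h"
      by (simp_all add: D_def algebra_simps)
    then show ?thesis using \<open>D \<noteq> 0\<close> unfolding A0 B_def
      by (cases h) (simp add: diff_divide_distrib[symmetric] add_divide_distrib[symmetric])
  qed
  have inv: "Blinfun B o\<^sub>L f' (0, 0) = id_blinfun"
    by (rule blinfun_eqI) (simp add: f'ap bounded_linear_Blinfun_apply[OF blB] BA)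
  obtain U' V g g' where g: "open U'" "U' \<subseteq> U" "(0, 0) \<in> U'" "open V" "f (0, 0) \<in> V" "homeomorphism U' V f g"
    "\<And>y. y \<in> V \<Longrightarrow> (g has_derivative (g' y)) (at y)"
    "\<And>y. y \<in> V \<Longrightarrow> g' y = inv_into UNIV (blinfun_apply (f'(g y)))"
    "\<And>y. y \<in> V \<Longrightarrow> bij (blinfun_apply (f'(g y)))"
    by (rule inverse_function_theorem[OF U(1) _ contf' U(2) inv, of f])
       (use r0(2) sub(1) in \<open>auto simp: f'ap\<close>)
  have f0: "f (0, 0) = (0, 0)" by (simp add: f_def ev_0_0 XY)
  have g0: "g (0, 0) = (0, 0)" using g(3,6) f0 unfolding homeomorphism_def by metis
  \<comment> \<open>The inverse of a bijective complex-linear map is complex-linear, expressed here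
    as homogeneity under complex scalars.\<close>
  have lin: "g' y (h * fst w, h * snd w) = (h * fst (g' y w), h * snd (g' y w))" if y: "y \<in> V" for y h w
  proof -
    have b: "bij (A (g y))" using g(9)[OF y] by (simp add: f'ap)
    have gi: "g' y = inv_into UNIV (A (g y))" using g(8)[OF y] by (simp add: f'ap)
    obtain v where v: "w = A (g y) v" using b by (metis bij_pointE)
    have "(h * fst w, h * snd w) = A (g y) (h * fst v, h * snd v)"
      by (simp add: v A_def algebra_simps)
    then show ?thesis using b by (simp add: gi v bij_is_inj)
  qed
  have hol: "(\<lambda>z. fst (g z)) holomorphic2_on V" "(\<lambda>z. snd (g z)) holomorphic2_on V"
  proof -
    have contg: "continuous_on V g"
      using g(6) by (simp add: homeomorphism_def)
    have 1: "((\<lambda>t. g (t, y)) has_derivative (\<lambda>h. g' (x, y) (h, 0))) (at x)" if "(x, y) \<in> V" for x y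
      by (rule has_derivative_compose[OF has_derivative_Pair[OF has_derivative_ident has_derivative_const] g(7)[OF that]])
    have 2: "((\<lambda>t. g (x, t)) has_derivative (\<lambda>h. g' (x, y) (0, h))) (at y)" if "(x, y) \<in> V" for x y
      by (rule has_derivative_compose[OF has_derivative_Pair[OF has_derivative_const has_derivative_ident] g(7)[OF that]])
    have l1: "g' (x, y) (h, 0) = (h * fst (g' (x, y) (1, 0)), h * snd (g' (x, y) (1, 0)))" if "(x, y) \<in> V" for x y h
      using lin[OF that, of h "(1, 0)"] by simp
    have l2: "g' (x, y) (0, h) = (h * fst (g' (x, y) (0, 1)), h * snd (g' (x, y) (0, 1)))" if "(x, y) \<in> V" for x y h
      using lin[OF that, of h "(0, 1)"] by simp
    have d: "(\<lambda>t. fst (g (t, y))) field_differentiable at x" "(\<lambda>t. snd (g (t, y))) field_differentiable at x"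
      "(\<lambda>t. fst (g (x, t))) field_differentiable at y" "(\<lambda>t. snd (g (x, t))) field_differentiable at y"
      if V: "(x, y) \<in> V" for x y
         apply (rule complex_linear_imp_field_derivative[OF has_derivative_fst[OF 1[OF V]]], subst l1[OF V], unfold fst_conv snd_conv, rule refl)
        apply (rule complex_linear_imp_field_derivative[OF has_derivative_snd[OF 1[OF V]]], subst l1[OF V], unfold fst_conv snd_conv, rule refl)
       apply (rule complex_linear_imp_field_derivative[OF has_derivative_fst[OF 2[OF V]]], subst l2[OF V], unfold fst_conv snd_conv, rule refl)
      apply (rule complex_linear_imp_field_derivative[OF has_derivative_snd[OF 2[OF V]]], subst l2[OF V], unfold fst_conv snd_conv, rule refl)
      done
    show "(\<lambda>z. fst (g z)) holomorphic2_on V" "(\<lambda>z. snd (g z)) holomorphic2_on V"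
      unfolding holomorphic2_on_def using d continuous_on_fst[OF contg] continuous_on_snd[OF contg] by blast+
  qed
  have V0: "(0, 0) \<in> V" using g(5) f0 by simp
  obtain P where P: "\<forall>\<^sub>0z. ev P z = fst (g z)" using holomorphic2_on_imp_ev[OF hol(1) g(4) V0] .
  obtain Q where Q: "\<forall>\<^sub>0z. ev Q z = snd (g z)" using holomorphic2_on_imp_ev[OF hol(2) g(4) V0] .
  have P0: "coef P 0 0 = 0" using eventually_nhds_x_imp_x[OF P] by (simp add: ev_0_0 g0)
  have Q0: "coef Q 0 0 = 0" using eventually_nhds_x_imp_x[OF Q] by (simp add: ev_0_0 g0)
  have nU: "\<forall>\<^sub>0z. z \<in> U'" and nV: "\<forall>\<^sub>0z. z \<in> V" using g V0 by (auto intro: eventually_nhds_in_open)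
  have fg: "f (g z) = z" if "z \<in> V" for z using g(6) that by (simp add: homeomorphism_def)
  have gf: "g (f z) = z" if "z \<in> U'" for z using g(6) that by (simp add: homeomorphism_def)
  have "subst X P Q = xvar"
    by (rule ev_eqI, use ev_subst[OF P0 Q0, of X] P Q nV in eventually_elim)
       (use fg in \<open>auto simp: f_def ev_monom2 prod_eq_iff\<close>)
  moreover have "subst Y P Q = yvar"
    by (rule ev_eqI, use ev_subst[OF P0 Q0, of Y] P Q nV in eventually_elim)
       (use fg in \<open>auto simp: f_def ev_monom2 prod_eq_iff\<close>)
  moreover have "subst P X Y = xvar"
    by (rule ev_eqI, use ev_subst[OF XY, of P] near0_compose[OF P XY] nU in eventually_elim)
       (use gf in \<open>auto simp: f_def ev_monom2 prod_eq_iff\<close>)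
  moreover have "subst Q X Y = yvar"
    by (rule ev_eqI, use ev_subst[OF XY, of Q] near0_compose[OF Q XY] nU in eventually_elim)
       (use gf in \<open>auto simp: f_def ev_monom2 prod_eq_iff\<close>)
  ultimately show ?thesis using that P0 Q0 by blast
qed

section \<open>Roots of power series\<close>

text \<open>Off \<open>a\<close> the factor \<open>(y - a) ^ k\<close> is invertible, so the
  cofactor of the local factorisation extends to all of \<open>S\<close>.\<close>

lemma holomorphic_factor_zero_global:
  assumes f: "f holomorphic_on S" "open S" "connected S" "a \<in> S" "f a = 0" and nz: "\<not> f constant_on S"
  obtains k F where "k > 0" "F holomorphic_on S" "F a \<noteq> 0" "\<And>y. y \<in> S \<Longrightarrow> f y = (y - a) ^ k * F y"
proof -
  obtain g r k where g: "0 < k" "0 < r" "ball a r \<subseteq> S" "g holomorphic_on ball a r"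
    "\<And>w. w \<in> ball a r \<Longrightarrow> f w = (w - a) ^ k * g w" "\<And>w. w \<in> ball a r \<Longrightarrow> g w \<noteq> 0"
    by (rule holomorphic_factor_zero_nonconstant[OF f nz], rule that)
  define F where "F = (\<lambda>y. if y \<in> ball a r then g y else f y / (y - a) ^ k)"
  have "F holomorphic_on (ball a r \<union> (S - {a}))"
    unfolding F_def
  proof (rule holomorphic_on_If_Un[OF g(4)])
    show "(\<lambda>y. f y / (y - a) ^ k) holomorphic_on S - {a}"
      by (intro holomorphic_intros holomorphic_on_subset[OF f(1)]) auto
  qed (use g f in \<open>auto intro: open_delete\<close>)
  moreover have "ball a r \<union> (S - {a}) = S" using g f by auto
  ultimately have "F holomorphic_on S" by simp
  moreover have "F a \<noteq> 0" using g by (simp add: F_def)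
  moreover have "f y = (y - a) ^ k * F y" if "y \<in> S" for y using g that by (auto simp: F_def)
  ultimately show ?thesis using that g(1) by blast
qed

lemma isCont_eq_of_eventually_at:
  fixes U V :: "complex \<Rightarrow> complex"
  assumes "isCont U a" "isCont V a" "\<forall>\<^sub>F y in at a. U y = V y"
  shows "U a = V a"
proof -
  have "(V \<longlongrightarrow> U a) (at a)"
    using assms(1,3) unfolding isCont_def by (rule Lim_transform_eventually)
  then show ?thesis using assms(2) unfolding isCont_def by (rule LIM_unique)
qed

lemma vanishing_order_unique:
  fixes U V :: "complex \<Rightarrow> complex"
  assumes "isCont U a" "isCont V a" "U a \<noteq> 0" "V a \<noteq> 0"
    and "\<forall>\<^sub>F y in at a. (y - a) ^ p * U y = (y - a) ^ q * V y"
  shows "p = q"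
proof -
  have le: "q \<le> p" if "isCont U a" "isCont V a" "U a \<noteq> 0"
    and ev: "\<forall>\<^sub>F y in at a. (y - a) ^ p * U y = (y - a) ^ q * V y" for U V :: "complex \<Rightarrow> complex" and p q
  proof (rule ccontr)
    assume "\<not> q \<le> p"
    then have pq: "q = p + (q - p)" "q - p > 0" by auto
    have "\<forall>\<^sub>F y in at a. y \<noteq> a" by (simp add: eventually_at_filter)
    with ev have "\<forall>\<^sub>F y in at a. U y = (y - a) ^ (q - p) * V y"
    proof eventually_elim
      case (elim y)
      have "(y - a) ^ p * U y = (y - a) ^ p * ((y - a) ^ (q - p) * V y)"
        using elim(1) pq(1) by (metis mult.assoc power_add)
      then show ?case using elim(2) by simp
    qed
    then have "U a = (a - a) ^ (q - p) * V a"
      by (intro isCont_eq_of_eventually_at[where V = "\<lambda>y. (y - a) ^ (q - p) * V y"])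
         (use that in \<open>auto intro!: continuous_intros\<close>)
    then show False using pq(2) that(3) by simp
  qed
  have "\<forall>\<^sub>F y in at a. (y - a) ^ q * V y = (y - a) ^ p * U y"
    using assms(5) by eventually_elim simp
  then show ?thesis using le[of U V p q] le[of V U q p] assms by auto
qed

text \<open>Induction on the number of zeros of \<open>f\<close>. At a zero \<open>a\<close> the
  factor \<open>g\<close> is nonzero, so comparing orders gives k i = l n; as i is prime to n, n
  divides the order k of \<open>f\<close>, and a full n-th power splits off. When no zeros are left,
  a logarithm provides the root.\<close>

lemma nth_root_on_ball:
  assumes "finite {y \<in> ball 0 \<rho>. f y = 0}" "0 < \<rho>"
    and "f holomorphic_on ball 0 \<rho>" "g holomorphic_on ball 0 \<rho>" "h holomorphic_on ball 0 \<rho>"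
    and "\<And>y. y \<in> ball 0 \<rho> \<Longrightarrow> f y ^ i * g y = h y ^ n" "coprime i n" "0 < n"
    and "\<And>y. y \<in> ball 0 \<rho> \<Longrightarrow> f y = 0 \<Longrightarrow> g y \<noteq> 0"
  shows "\<exists>p. p holomorphic_on ball 0 \<rho> \<and> (\<forall>y\<in>ball 0 \<rho>. f y = p y ^ n)"
  using assms
proof (induction "card {y \<in> ball 0 \<rho>. f y = 0}" arbitrary: f h rule: less_induct)
  case less
  let ?B = "ball 0 \<rho> :: complex set"
  show ?case
  proof (cases "\<exists>a\<in>?B. f a = 0")
    case False
    then obtain L where L: "L holomorphic_on ?B" "\<And>y. y \<in> ?B \<Longrightarrow> exp (L y) = f y"
      using holomorphic_logarithm_exists[of ?B f 0] less.prems(2,3) by auto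
    have "(\<lambda>y. exp (L y / of_nat n)) holomorphic_on ?B"
      using less.prems(8) by (intro holomorphic_intros L) auto
    moreover have "f y = exp (L y / of_nat n) ^ n" if "y \<in> ?B" for y
      using L(2)[OF that] less.prems(8) by (simp flip: exp_of_nat_mult)
    ultimately show ?thesis by blast
  next
    case True
    then obtain a where a: "a \<in> ?B" "f a = 0" by blast
    show ?thesis
    proof (cases "i = 0")
      case True
      then have "n = 1" using less.prems(7) by simp
      then show ?thesis using less.prems(3) by (intro exI[of _ f]) auto
    next
      case i: False
      have fnc: "\<not> f constant_on ?B"
      proof
        assume "f constant_on ?B"
        then have "{y \<in> ?B. f y = 0} = ?B" using a by (auto simp: constant_on_def)
        then show False using less.prems(1,2) finite_imp_not_open[of ?B] by auto
      qed
      obtain k F where F: "k > 0" "F holomorphic_on ?B" "F a \<noteq> 0" "\<And>y. y \<in> ?B \<Longrightarrow> f y = (y - a) ^ k * F y"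
        by (rule holomorphic_factor_zero_global[OF less.prems(3) open_ball connected_ball a fnc], rule that)
      have cont: "isCont u a" if "u holomorphic_on ?B" for u
        using holomorphic_on_imp_continuous_on[OF that] a(1) continuous_on_eq_continuous_at[OF open_ball] by blast
      have inB: "\<forall>\<^sub>F y in at a. y \<in> ?B" by (rule eventually_at_in_open'[OF open_ball a(1)])
      have ga: "g a \<noteq> 0" using less.prems(9) a by blast
      have ne: "\<forall>\<^sub>F y in at a. y \<noteq> a" by (simp add: eventually_at_filter)
      have ha: "h a = 0" using less.prems(6)[OF a(1)] a(2) i less.prems(8) by (simp add: zero_power)
      have hnc: "\<not> h constant_on ?B"
      proof
        assume "h constant_on ?B"
        then have h0: "h y = 0" if "y \<in> ?B" for y using a(1) ha that by (metis constant_on_def)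
        have "\<forall>\<^sub>F y in at a. F y ^ i * g y = 0"
          using inB ne
        proof eventually_elim
          case (elim y)
          then show ?case using less.prems(6)[OF elim(1)] F(4)[OF elim(1)] h0[OF elim(1)] less.prems(8)
            by (simp add: power_mult_distrib zero_power)
        qed
        then have "(\<lambda>y. F y ^ i * g y) a = (\<lambda>_. 0) a"
          by (rule isCont_eq_of_eventually_at[rotated -1]) (auto intro!: cont holomorphic_intros F less.prems)
        then show False using F(3) ga by simp
      qed
      obtain l H where H: "l > 0" "H holomorphic_on ?B" "H a \<noteq> 0" "\<And>y. y \<in> ?B \<Longrightarrow> h y = (y - a) ^ l * H y"
        by (rule holomorphic_factor_zero_global[OF less.prems(5) open_ball connected_ball a(1) ha hnc], rule that)
      have eq: "(y - a) ^ (k * i) * (F y ^ i * g y) = (y - a) ^ (l * n) * H y ^ n" if "y \<in> ?B" for y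
        using less.prems(6)[OF that] F(4)[OF that] H(4)[OF that]
        by (simp add: power_mult_distrib power_mult mult.assoc)
      have kl: "k * i = l * n"
      proof (rule vanishing_order_unique[where U = "\<lambda>y. F y ^ i * g y" and V = "\<lambda>y. H y ^ n" and a = a])
        show "\<forall>\<^sub>F y in at a. (y - a) ^ (k * i) * (F y ^ i * g y) = (y - a) ^ (l * n) * H y ^ n"
          using inB by eventually_elim (rule eq)
      qed (use F H ga in \<open>auto intro!: cont holomorphic_intros less.prems\<close>)
      then have "n dvd k * i" by simp
      then have "n dvd k" using less.prems(7) by (simp add: coprime_commute coprime_dvd_mult_left_iff)
      then obtain k' where k': "k = k' * n" by (metis dvd_def mult.commute)
      have eqne: "F y ^ i * g y = H y ^ n" if "y \<in> ?B" "y \<noteq> a" for y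
        using eq[OF that(1)] that(2) kl by simp
      have "F a ^ i * g a = H a ^ n"
      proof (rule isCont_eq_of_eventually_at[where U = "\<lambda>y. F y ^ i * g y" and V = "\<lambda>y. H y ^ n"])
        show "\<forall>\<^sub>F y in at a. F y ^ i * g y = H y ^ n"
          using inB ne by eventually_elim (rule eqne)
      qed (auto intro!: cont holomorphic_intros F H less.prems)
      then have eq': "F y ^ i * g y = H y ^ n" if "y \<in> ?B" for y
        using eqne that by (cases "y = a") auto
      have zs: "{y \<in> ?B. F y = 0} = {y \<in> ?B. f y = 0} - {a}"
        using F by auto
      have card: "card {y \<in> ?B. F y = 0} < card {y \<in> ?B. f y = 0}"
        unfolding zs using less.prems(1) a by (intro card_Diff1_less) auto
      have "\<exists>p. p holomorphic_on ?B \<and> (\<forall>y\<in>?B. F y = p y ^ n)"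
        by (rule less.hyps[OF card _ less.prems(2) F(2) less.prems(4) H(2) eq' less.prems(7,8)])
           (use zs less.prems(1,9) F(4) in auto)
      then obtain p where p: "p holomorphic_on ?B" "\<And>y. y \<in> ?B \<Longrightarrow> F y = p y ^ n" by blast
      have "(\<lambda>y. (y - a) ^ k' * p y) holomorphic_on ?B" by (intro holomorphic_intros p)
      moreover have "f y = ((y - a) ^ k' * p y) ^ n" if "y \<in> ?B" for y
        using F(4)[OF that] p(2)[OF that] by (simp add: k' power_mult power_mult_distrib)
      ultimately show ?thesis by (intro exI[of _ "\<lambda>y. (y - a) ^ k' * p y"]) auto
    qed
  qed
qed


text \<open>Fibrewise roots exist for x different from 0, where \<open>F\<close> and
  \<open>G\<close> have no common zero, but each is determined only up to a root of unity, and the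
  fibre x = 0 is not covered. Coherence comes from a circle |w| = \<rho> on which \<open>F\<close>
  has no zero for small x: there a root \<open>k\<close> depends holomorphically on x, and
  \<open>cauchy_kernel_power_series\<close> fills in the disc.\<close>

lemma nth_root_two_variables:
  assumes FGH: "F holomorphic2_on polydisc R" "G holomorphic2_on polydisc R" "H holomorphic2_on polydisc R"
    and eq: "\<And>z. z \<in> polydisc R \<Longrightarrow> F z ^ i * G z = H z ^ n" and n: "coprime i n" "0 < n"
    and common: "\<And>z. z \<in> polydisc R \<Longrightarrow> F z = 0 \<Longrightarrow> G z = 0 \<Longrightarrow> z = (0, 0)"
    and reg: "norm y0 < R" "F (0, y0) \<noteq> 0"
  obtains s where "\<forall>\<^sub>0z. F z = ev s z ^ n"
proof -
  have R: "R > 0" using reg(1) norm_ge_zero[of y0] by linarith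
  have slice: "(\<lambda>t. K (x, t)) holomorphic_on ball 0 R" if "K holomorphic2_on polydisc R" "norm x < R" for K x
    by (rule holomorphic2_on_slices(2)[OF that])
  \<comment> \<open>\<open>reg\<close> says that F(0, .) is not identically zero, so some punctured
    disc is free of its zeros; the circle is placed there.\<close>
  obtain e where e: "e > 0" "e \<le> R" "\<And>w. w \<in> ball 0 e - {0} \<Longrightarrow> F (0, w) \<noteq> 0"
  proof (cases "F (0, 0) = 0")
    case True
    have c: "norm (0 :: complex) < R" "0 \<in> ball (0 :: complex) R" "y0 \<in> ball 0 R" using R reg(1) by auto
    obtain e where "0 < e" "ball (0 :: complex) e \<subseteq> ball 0 R" "\<And>w. w \<in> ball 0 e - {0} \<Longrightarrow> F (0, w) \<noteq> 0"
      by (rule isolated_zeros[OF slice[OF FGH(1) c(1)] open_ball connected_ball c(2) True c(3) reg(2)], rule that)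
    then show ?thesis using that[of e] by (auto simp: ball_subset_ball_iff)
  next
    case False
    have "continuous_on (ball 0 R) (\<lambda>t. F (0, t))"
      using slice[OF FGH(1), of 0] R by (auto intro: holomorphic_on_imp_continuous_on)
    then have "open (ball 0 R \<inter> (\<lambda>t. F (0, t)) -` (- {0}))"
      by (intro continuous_open_preimage) auto
    then obtain e where e: "e > 0" "ball 0 e \<subseteq> ball 0 R \<inter> (\<lambda>t. F (0, t)) -` (- {0})"
      using False R unfolding open_contains_ball by (metis ComplI Int_iff centre_in_ball singletonD vimageI2)
    then have "ball (0 :: complex) e \<subseteq> ball 0 R" by blast
    then have "e \<le> R" using e(1) by (auto simp: ball_subset_ball_iff)
    then show ?thesis using that[of e] e by blast
  qed
  define \<rho> where "\<rho> = e / 2"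
  have \<rho>: "0 < \<rho>" "\<rho> < e" "\<rho> < R" using e by (auto simp: \<rho>_def)
  have contF: "continuous_on (polydisc R) F" using FGH(1) by (simp add: holomorphic2_on_def)
  have nz0: "F (0, w) \<noteq> 0" if "w \<in> sphere 0 \<rho>" for w using e(3)[of w] that \<rho> by auto
  have "continuous_on (sphere 0 \<rho>) (\<lambda>w. norm (F (0, w)))"
    by (intro continuous_on_norm continuous_on_compose2[OF contF] continuous_intros) (use \<rho> in auto)
  moreover have "sphere (0 :: complex) \<rho> \<noteq> {}" using \<rho> by simp
  ultimately obtain w0 where w0: "w0 \<in> sphere 0 \<rho>" "\<And>w. w \<in> sphere 0 \<rho> \<Longrightarrow> norm (F (0, w0)) \<le> norm (F (0, w))"
    using continuous_attains_inf[OF compact_sphere] by metis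
  define \<mu> where "\<mu> = norm (F (0, w0))"
  have \<mu>: "\<mu> > 0" "\<And>w. w \<in> sphere 0 \<rho> \<Longrightarrow> \<mu> \<le> norm (F (0, w))"
    using nz0[OF w0(1)] w0(2) by (auto simp: \<mu>_def)
  have "compact (cball (0 :: complex) (R / 2) \<times> sphere (0 :: complex) \<rho>)" by (intro compact_Times) auto
  moreover have "cball 0 (R / 2) \<times> sphere 0 \<rho> \<subseteq> polydisc R" using \<rho> R by (auto simp: polydisc_def)
  ultimately have "uniformly_continuous_on (cball 0 (R / 2) \<times> sphere 0 \<rho>) F"
    by (intro compact_uniformly_continuous continuous_on_subset[OF contF])
  moreover have "\<mu> / 4 > 0" using \<mu>(1) by simp
  ultimately obtain d0 where d0: "d0 > 0" "\<And>z z'. z \<in> cball 0 (R / 2) \<times> sphere 0 \<rho> \<Longrightarrow> z' \<in> cball 0 (R / 2) \<times> sphere 0 \<rho> \<Longrightarrow>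
      dist z' z < d0 \<Longrightarrow> dist (F z') (F z) < \<mu> / 4"
    unfolding uniformly_continuous_on_def by metis
  define \<delta> where "\<delta> = min (d0 / 2) (R / 2)"
  have \<delta>: "0 < \<delta>" "\<delta> < d0" "\<delta> \<le> R / 2" "\<delta> < R" using d0(1) R by (auto simp: \<delta>_def)
  \<comment> \<open>With the margin \<mu> / 4 both for \<open>x\<close> and for the reference point
    \<open>x1\<close> below, F(x, w) is within \<mu> / 2 of F(x1, w), whose modulus exceeds \<mu> /
    2; their quotient then has positive real part.\<close>
  have close: "norm (F (x, w) - F (0, w)) < \<mu> / 4" if "norm x \<le> \<delta>" "w \<in> sphere 0 \<rho>" for x w
    using d0(2)[of "(0, w)" "(x, w)"] that \<delta> R by (auto simp: dist_norm)
  have nz: "F (x, w) \<noteq> 0" if "norm x \<le> \<delta>" "w \<in> sphere 0 \<rho>" for x w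
    using close[OF that] \<mu>(2)[OF that(2)] \<mu>(1) norm_triangle_ineq2[of "F (0, w)" "F (x, w)"]
    by (auto simp: norm_minus_commute)
  \<comment> \<open>A radius strictly between \<rho> and \<open>e\<close>: the fibrewise roots must
    live on a neighbourhood of the closed disc of radius \<rho>.\<close>
  define \<sigma> where "\<sigma> = 3 * e / 4"
  have \<sigma>: "0 < \<sigma>" "\<rho> < \<sigma>" "\<sigma> < R" using e by (auto simp: \<sigma>_def \<rho>_def)
  have root: "\<exists>p. p holomorphic_on ball 0 \<sigma> \<and> (\<forall>y\<in>ball 0 \<sigma>. F (x, y) = p y ^ n)" if x: "x \<noteq> 0" "norm x \<le> \<delta>" for x
  proof (rule nth_root_on_ball)
    have xR: "norm x < R" using x \<delta> by linarith
    have sub: "ball 0 \<sigma> \<subseteq> ball (0 :: complex) R" using \<sigma> by auto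
    show "(\<lambda>y. F (x, y)) holomorphic_on ball 0 \<sigma>" "(\<lambda>y. G (x, y)) holomorphic_on ball 0 \<sigma>" "(\<lambda>y. H (x, y)) holomorphic_on ball 0 \<sigma>"
      using holomorphic_on_subset[OF slice[OF _ xR] sub] FGH by blast+
    have hol: "(\<lambda>y. F (x, y)) holomorphic_on ball 0 R" using FGH slice xR by blast
    show "finite {y \<in> ball 0 \<sigma>. F (x, y) = 0}"
    proof (cases "(\<lambda>y. F (x, y)) constant_on ball 0 R")
      case True
      have wR: "of_real \<rho> \<in> ball (0 :: complex) R" using \<rho> by auto
      have "F (x, of_real \<rho>) \<noteq> 0" using nz[OF x(2), of "of_real \<rho>"] \<rho> by simp
      then have "F (x, y) \<noteq> 0" if "y \<in> ball 0 R" for y using True that wR unfolding constant_on_def by metis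
      then have "{y \<in> ball 0 \<sigma>. F (x, y) = 0} = {}" using sub by blast
      then show ?thesis by (simp only: finite.emptyI)
    next
      case False
      have "finite {y \<in> cball 0 \<sigma>. F (x, y) = 0}"
        by (rule holomorphic_compact_finite_zeros[OF hol open_ball connected_ball compact_cball _ False]) (use \<sigma> in auto)
      then show ?thesis by (rule rev_finite_subset) auto
    qed
    show "F (x, y) ^ i * G (x, y) = H (x, y) ^ n" if "y \<in> ball 0 \<sigma>" for y
      using eq[of "(x, y)"] xR that sub by auto
    show "F (x, y) = 0 \<Longrightarrow> G (x, y) \<noteq> 0" if "y \<in> ball 0 \<sigma>" for y
      using common[of "(x, y)"] xR that sub x(1) by auto
  qed (use \<sigma> n in auto)
  define x1 :: complex where "x1 = of_real \<delta>"
  have x1: "x1 \<noteq> 0" "norm x1 \<le> \<delta>" using \<delta> by (auto simp: x1_def)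
  obtain p1 where p1: "p1 holomorphic_on ball 0 \<sigma>" "\<And>y. y \<in> ball 0 \<sigma> \<Longrightarrow> F (x1, y) = p1 y ^ n"
    using root[OF x1] by blast
  have ratio: "F (x, w) / F (x1, w) \<notin> \<real>\<^sub>\<le>\<^sub>0" "F (x, w) / F (x1, w) \<noteq> 0" if xw: "norm x \<le> \<delta>" "w \<in> sphere 0 \<rho>" for x w
  proof -
    have "norm (F (x, w) - F (x1, w)) < \<mu> / 2"
      using close[OF xw] close[OF x1(2) xw(2)] norm_triangle_ineq4[of "F (x, w) - F (0, w)" "F (x1, w) - F (0, w)"] by simp
    also have "\<mu> / 2 < norm (F (x1, w))"
      using close[OF x1(2) xw(2)] \<mu>(2)[OF xw(2)] \<mu>(1) norm_triangle_ineq2[of "F (0, w)" "F (x1, w)"]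
      by (simp add: norm_minus_commute)
    finally have "norm (F (x, w) - F (x1, w)) / norm (F (x1, w)) < 1"
      using nz[OF x1(2) xw(2)] by simp
    then have "norm (F (x, w) / F (x1, w) - 1) < 1"
      using nz[OF x1(2) xw(2)] by (simp add: norm_divide[symmetric] diff_divide_distrib)
    then have "Re (F (x, w) / F (x1, w)) > 0"
      using abs_Re_le_cmod[of "F (x, w) / F (x1, w) - 1"] by (auto simp: abs_le_iff)
    then show "F (x, w) / F (x1, w) \<notin> \<real>\<^sub>\<le>\<^sub>0" by (auto simp: complex_nonpos_Reals_iff)
    show "F (x, w) / F (x1, w) \<noteq> 0" using nz[OF xw] nz[OF x1(2) xw(2)] by simp
  qed
  \<comment> \<open>The root \<open>p1\<close> chosen on the reference fibre is continued to the
    other fibres by the principal n-th root of the quotient.\<close>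
  define k where "k = (\<lambda>z. p1 (snd z) * exp (Ln (F z / F (x1, snd z)) / of_nat n))"
  have kn: "k (x, w) ^ n = F (x, w)" if xw: "norm x \<le> \<delta>" "w \<in> sphere 0 \<rho>" for x w
  proof -
    have "k (x, w) ^ n = p1 w ^ n * exp (Ln (F (x, w) / F (x1, w)))"
      using n(2) by (simp add: k_def power_mult_distrib flip: exp_of_nat_mult)
    also have "\<dots> = F (x, w)"
      using p1(2)[of w] xw(2) \<sigma> ratio(2)[OF xw] nz[OF x1(2) xw(2)] by simp
    finally show ?thesis .
  qed
  have contp: "continuous_on (ball 0 \<sigma>) p1" using p1 holomorphic_on_imp_continuous_on by blast
  have contk: "continuous_on (cball 0 \<delta> \<times> sphere 0 \<rho>) k"
    unfolding k_def
  proof (intro continuous_intros)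
    show "continuous_on (cball 0 \<delta> \<times> sphere 0 \<rho>) (\<lambda>z. p1 (snd z))"
      by (intro continuous_on_compose2[OF contp] continuous_intros) (use \<sigma> in auto)
    show "continuous_on (cball 0 \<delta> \<times> sphere 0 \<rho>) F"
      by (rule continuous_on_subset[OF contF]) (use \<delta> \<rho> in \<open>auto simp: polydisc_def\<close>)
    show "continuous_on (cball 0 \<delta> \<times> sphere 0 \<rho>) (\<lambda>z. F (x1, snd z))"
      by (intro continuous_on_compose2[OF contF] continuous_intros) (use \<delta> \<rho> x1 in auto)
  qed (use ratio nz x1 n in \<open>auto simp: case_prod_unfold\<close>)
  have holk: "(\<lambda>x. k (x, w)) holomorphic_on ball 0 \<delta>" if w: "w \<in> sphere 0 \<rho>" for w
  proof -
    have "(\<lambda>x. F (x, w)) holomorphic_on ball 0 \<delta>"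
      by (rule holomorphic_on_subset[OF holomorphic2_on_slices(1)[OF FGH(1)]]) (use w \<rho> \<delta> in auto)
    then show ?thesis unfolding k_def snd_conv
      by (intro holomorphic_intros) (use ratio[OF _ w] nz[OF x1(2) w] n in auto)
  qed
  obtain a where a: "convergent_ps2 a"
    "\<And>x y :: complex. \<And>f. \<lbrakk>norm x < min \<delta> \<rho> / 4; norm y < min \<delta> \<rho> / 4; f holomorphic_on ball 0 \<rho>; continuous_on (cball 0 \<rho>) f;
        \<And>w. w \<in> sphere 0 \<rho> \<Longrightarrow> f w = k (x, w)\<rbrakk> \<Longrightarrow> f y = ps2_eval a (x, y)"
    using cauchy_kernel_power_series[OF contk \<delta>(1) \<rho>(1) holk] by blast
  have pow: "ps2_eval a (x, y) ^ n = F (x, y)" if x: "x \<noteq> 0" "norm x < min \<delta> \<rho> / 4" and y: "norm y < min \<delta> \<rho> / 4" for x y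
  proof -
    have xd: "norm x \<le> \<delta>" using x \<delta> by auto
    obtain p where p: "p holomorphic_on ball 0 \<sigma>" "\<And>y. y \<in> ball 0 \<sigma> \<Longrightarrow> F (x, y) = p y ^ n"
      using root[OF x(1) xd] by blast
    have pnz: "p w \<noteq> 0" if "w \<in> sphere 0 \<rho>" for w
      using p(2)[of w] nz[OF xd that] that \<sigma> n(2) by (auto simp: zero_power)
    have contps: "continuous_on (ball 0 \<sigma>) p" using p holomorphic_on_imp_continuous_on by blast
    \<comment> \<open>Two continuous n-th roots of the same nonvanishing function on a connected
      circle differ by a constant root of unity.\<close>
    have "(\<lambda>w. k (x, w) / p w) constant_on sphere 0 \<rho>"
    proof (rule continuous_finite_range_constant)
      show "connected (sphere (0 :: complex) \<rho>)" by (rule connected_sphere) simp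
      have "continuous_on (sphere 0 \<rho>) (\<lambda>w. k (x, w))"
        by (intro continuous_on_compose2[OF contk] continuous_intros) (use xd in auto)
      then show "continuous_on (sphere 0 \<rho>) (\<lambda>w. k (x, w) / p w)"
        by (intro continuous_intros continuous_on_subset[OF contps]) (use pnz \<sigma> in auto)
      have "(\<lambda>w. k (x, w) / p w) ` sphere 0 \<rho> \<subseteq> {c. c ^ n = 1}"
      proof (clarify)
        fix w :: complex assume w: "w \<in> sphere 0 \<rho>"
        have "k (x, w) ^ n = p w ^ n" using kn[OF xd w] p(2)[of w] w \<sigma> by simp
        then show "(k (x, w) / p w) ^ n = 1" using pnz[OF w] by (simp add: power_divide)
      qed
      then show "finite ((\<lambda>w. k (x, w) / p w) ` sphere 0 \<rho>)"
        by (rule finite_subset) (rule finite_roots_unity, use n(2) in simp)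
    qed
    then obtain c where c: "\<And>w. w \<in> sphere 0 \<rho> \<Longrightarrow> k (x, w) / p w = c" unfolding constant_on_def by blast
    have wr: "of_real \<rho> \<in> sphere (0 :: complex) \<rho>" using \<rho> by simp
    have "c ^ n = 1"
    proof -
      have "k (x, of_real \<rho>) ^ n = p (of_real \<rho>) ^ n" using kn[OF xd wr] p(2)[of "of_real \<rho>"] \<rho> \<sigma> by simp
      then show ?thesis using c[OF wr, symmetric] pnz[OF wr] by (simp add: power_divide)
    qed
    have "c * p y = ps2_eval a (x, y)"
    proof (rule a(2)[OF x(2) y])
      have "cball 0 \<rho> \<subseteq> ball (0 :: complex) \<sigma>" using \<sigma> by auto
      then show "(\<lambda>y. c * p y) holomorphic_on ball 0 \<rho>" "continuous_on (cball 0 \<rho>) (\<lambda>y. c * p y)"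
        using ball_subset_cball[of "0 :: complex" \<rho>]
        by (auto intro!: holomorphic_intros continuous_intros holomorphic_on_subset[OF p(1)] continuous_on_subset[OF contps])
      show "c * p w = k (x, w)" if "w \<in> sphere 0 \<rho>" for w using c[OF that] pnz[OF that] by (simp add: field_simps)
    qed
    then have "ps2_eval a (x, y) ^ n = p y ^ n" using \<open>c ^ n = 1\<close> by (metis mult_1 power_mult_distrib)
    moreover have "y \<in> ball 0 \<sigma>" using y \<sigma> \<rho> by auto
    ultimately show ?thesis using p(2) by simp
  qed
  define s where "s = Cps a"
  have evs: "ev s = ps2_eval a" by (simp add: ev_def s_def a(1))
  obtain r where r: "r > 0" "ev s holomorphic2_on polydisc r" by (rule ev_holomorphic2_on)
  define r' where "r' = min r (min \<delta> \<rho> / 4)"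
  have r': "r' > 0" "r' \<le> r" "r' \<le> min \<delta> \<rho> / 4" "r' < R" using r(1) \<delta> \<rho> by (auto simp: r'_def min_def)
  have "F (x, y) = ev s (x, y) ^ n" if xy: "norm x < r'" "norm y < r'" for x y
  proof (cases "x = 0")
    case False
    then show ?thesis using pow[of x y] xy r' by (simp add: evs)
  next
    case True
    \<comment> \<open>The fibre x = 0 is reached by continuity in x.\<close>
    have "F (0, y) = ev s (0, y) ^ n"
    proof (rule isCont_eq_of_eventually_at[where U = "\<lambda>t. F (t, y)" and V = "\<lambda>t. ev s (t, y) ^ n"])
      show "isCont (\<lambda>t. F (t, y)) 0" "isCont (\<lambda>t. ev s (t, y) ^ n) 0"
        using holomorphic2_on_slices(1)[OF FGH(1), of y] holomorphic2_on_slices(1)[OF r(2), of y] xy r' r(1) R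
        by (auto intro!: continuous_intros dest!: holomorphic_on_imp_continuous_on simp: continuous_on_eq_continuous_at)
      have "\<forall>\<^sub>F t in at 0. t \<in> ball (0 :: complex) r'" by (rule eventually_at_in_open') (use r' in auto)
      moreover have "\<forall>\<^sub>F t in at 0. t \<noteq> (0 :: complex)" by (simp add: eventually_at_filter)
      ultimately show "\<forall>\<^sub>F t in at 0. F (t, y) = ev s (t, y) ^ n"
        by eventually_elim (use pow xy r' in \<open>auto simp: evs\<close>)
    qed
    then show ?thesis using True by simp
  qed
  then have "\<forall>\<^sub>0z. F z = ev s z ^ n"
    unfolding eventually_nhds_polydisc using r'(1) by (intro exI[of _ r']) auto
  then show ?thesis by (rule that)
qed


section \<open>Division by powers of x\<close>

lemma convergent_ps2_iff_bounded:
  "convergent_ps2 a \<longleftrightarrow> (\<exists>r>0. \<exists>M. \<forall>i j. norm (a i j) * r ^ (i + j) \<le> M)"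
proof
  assume "convergent_ps2 a"
  then obtain r where r: "r > 0" "ps2_abs_conv a r"
    unfolding convergent_ps2_def by blast
  then show "\<exists>r>0. \<exists>M. \<forall>i j. norm (a i j) * r ^ (i + j) \<le> M"
    using convergent_ps2_bounded[OF r(2)] by (meson less_imp_le)
next
  assume "\<exists>r>0. \<exists>M. \<forall>i j. norm (a i j) * r ^ (i + j) \<le> M"
  then obtain r M where r: "r > 0" "\<And>i j. norm (a i j) * r ^ (i + j) \<le> M" by blast
  have "ps2_abs_conv a (r / 2)"
    by (rule ps2_summable_of_bounded[OF r(2)]) (use r in auto)
  then show "convergent_ps2 a" unfolding convergent_ps2_def using r(1) by (intro exI[of _ "r / 2"]) auto
qed

lemma convergent_ps2_mono:
  assumes "convergent_ps2 a" "\<And>i j. norm (b i j) \<le> norm (a i j)"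
  shows "convergent_ps2 b"
proof -
  obtain r M where r: "r > 0" "\<And>i j. norm (a i j) * r ^ (i + j) \<le> M"
    using assms(1) convergent_ps2_iff_bounded by blast
  have "norm (b i j) * r ^ (i + j) \<le> M" for i j
    by (rule order_trans[OF mult_right_mono[OF assms(2)] r(2)]) (use r in auto)
  then show ?thesis using r(1) convergent_ps2_iff_bounded by blast
qed

lemma cps_divide_monom2:
  assumes "\<And>i j. coef s i j \<noteq> 0 \<Longrightarrow> k \<le> i \<and> l \<le> j"
  obtains t where "s = monom2 1 k l * t" "\<And>i j. coef t i j = coef s (i + k) (j + l)"
proof -
  define b where "b = (\<lambda>i j. coef s (i + k) (j + l))"
  obtain r M where r: "r > 0" "\<And>i j. norm (coef s i j) * r ^ (i + j) \<le> M"
    using convergent_coef[of s] convergent_ps2_iff_bounded by blast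
  have "norm (b i j) * r ^ (i + j) \<le> M / r ^ (k + l)" for i j
    using r(2)[of "i + k" "j + l"] r(1) by (simp add: b_def field_simps power_add)
  then have b: "convergent_ps2 b" using r(1) convergent_ps2_iff_bounded by blast
  have "coef s i j = coef (monom2 1 k l * Cps b) i j" for i j
  proof -
    have "coef (monom2 1 k l * Cps b) i j = (if k \<le> i \<and> l \<le> j then b (i - k) (j - l) else 0)"
      using b by (simp add: coef_monom2_mult)
    then show ?thesis using assms[of i j] by (auto simp: b_def)
  qed
  then have "s = monom2 1 k l * Cps b" by (rule cps_eqI)
  moreover have "coef (Cps b) i j = coef s (i + k) (j + l)" for i j
    unfolding coef_Cps[OF b] by (simp add: b_def)
  ultimately show ?thesis by (rule that)
qed

text \<open>Classically called regular in y, as in the Weierstrass preparation theorem: x does not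
  divide \<open>s\<close>.\<close>

definition x_regular :: "cps \<Rightarrow> bool" where
  "x_regular s \<longleftrightarrow> (\<exists>j. coef s 0 j \<noteq> 0)"

lemma x_regular_mult:
  assumes "x_regular s" "x_regular t"
  shows "x_regular (s * t)"
proof -
  have least: "\<exists>j. coef u 0 j \<noteq> 0 \<and> (\<forall>l<j. coef u 0 l = 0)" if "x_regular u" for u
    using exists_least_iff[of "\<lambda>j. coef u 0 j \<noteq> 0"] that by (simp add: x_regular_def)
  obtain j where j: "coef s 0 j \<noteq> 0" "\<And>l. l < j \<Longrightarrow> coef s 0 l = 0" using least[OF assms(1)] by blast
  obtain k where k: "coef t 0 k \<noteq> 0" "\<And>l. l < k \<Longrightarrow> coef t 0 l = 0" using least[OF assms(2)] by blast
  have "coef (s * t) 0 (j + k) = (\<Sum>l\<le>j + k. coef s 0 l * coef t 0 (j + k - l))"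
    by (simp add: coef_times ps2_mult_def)
  also have "\<dots> = (\<Sum>l\<le>j + k. if l = j then coef s 0 j * coef t 0 k else 0)"
  proof (intro sum.cong refl)
    fix l assume "l \<in> {..j + k}"
    then consider "l < j" | "l = j" | "j + k - l < k" by force
    then show "coef s 0 l * coef t 0 (j + k - l) = (if l = j then coef s 0 j * coef t 0 k else 0)"
      by cases (use j k in auto)
  qed
  also have "\<dots> = coef s 0 j * coef t 0 k" by simp
  finally show ?thesis using j(1) k(1) unfolding x_regular_def by (metis mult_eq_0_iff)
qed

lemma x_regular_power: "x_regular s \<Longrightarrow> x_regular (s ^ n)"
  by (induction n) (auto intro: x_regular_mult, auto simp: x_regular_def)

lemma x_regular_factor:
  assumes "s \<noteq> 0"
  obtains k t where "s = monom2 1 k 0 * t" "x_regular t"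
proof -
  have ex: "\<exists>i j. coef s i j \<noteq> 0" using assms cps_eqI[of s 0] by fastforce
  obtain k where k: "\<exists>j. coef s k j \<noteq> 0" "\<forall>i<k. \<not> (\<exists>j. coef s i j \<noteq> 0)"
    using exists_least_iff[of "\<lambda>i. \<exists>j. coef s i j \<noteq> 0"] ex by blast
  have k2: "k \<le> i" if "coef s i j \<noteq> 0" for i j using k(2) that not_less by blast
  obtain t where "s = monom2 1 k 0 * t" "\<And>i j. coef t i j = coef s (i + k) (j + 0)"
    using cps_divide_monom2[of s k 0] k2 by auto
  then show ?thesis using that k(1) unfolding x_regular_def by simp
qed

lemma x_order_unique:
  assumes "monom2 1 k 0 * s = monom2 1 l 0 * t" "x_regular s" "x_regular t"
  shows "k = l" "s = t"
proof -
  obtain i j where ij: "coef s 0 i \<noteq> 0" "coef t 0 j \<noteq> 0" using assms(2,3) by (auto simp: x_regular_def)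
  show "k = l"
    using arg_cong[OF assms(1), of "\<lambda>u. coef u k i"] arg_cong[OF assms(1), of "\<lambda>u. coef u l j"] ij
    by (auto simp: coef_monom2_mult split: if_splits)
  moreover have "monom2 1 l 0 \<noteq> (0 :: cps)"
    using coef_monom2[of 1 l 0 l 0] by auto
  ultimately show "s = t" using assms(1) by simp
qed

lemma x_regular_nth_root:
  assumes eq: "s ^ i * t = u ^ n" and n: "coprime i n" "0 < n" and reg: "x_regular s"
    and common: "\<forall>\<^sub>0z. ev s z = 0 \<longrightarrow> ev t z = 0 \<longrightarrow> z = (0, 0)"
  obtains v where "s = v ^ n"
proof -
  have "\<forall>\<^sub>0z. ev s z ^ i * ev t z = ev u z ^ n"
    using ev_power[of s i] ev_power[of u n] ev_mult[of "s ^ i" t] by eventually_elim (simp add: eq)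
  then obtain r0 where r0: "r0 > 0" "\<And>z. z \<in> polydisc r0 \<Longrightarrow> ev s z ^ i * ev t z = ev u z ^ n"
    unfolding eventually_nhds_polydisc by blast
  obtain r1 where r1: "r1 > 0" "\<And>z. z \<in> polydisc r1 \<Longrightarrow> ev s z = 0 \<longrightarrow> ev t z = 0 \<longrightarrow> z = (0, 0)"
    using common unfolding eventually_nhds_polydisc by blast
  obtain r2 where r2: "r2 > 0" "ev s holomorphic2_on polydisc r2" by (rule ev_holomorphic2_on)
  obtain r3 where r3: "r3 > 0" "ev t holomorphic2_on polydisc r3" by (rule ev_holomorphic2_on)
  obtain r4 where r4: "r4 > 0" "ev u holomorphic2_on polydisc r4" by (rule ev_holomorphic2_on)
  obtain r5 where r5: "r5 > 0" "ps2_abs_conv (coef s) r5"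
    using convergent_coef[of s] unfolding convergent_ps2_def by blast
  define R where "R = min (min (min r0 r1) (min r2 r3)) (min r4 r5)"
  have R: "R > 0" using r0 r1 r2 r3 r4 r5 by (simp add: R_def)
  have sub: "polydisc R \<subseteq> polydisc r0" "polydisc R \<subseteq> polydisc r1" "polydisc R \<subseteq> polydisc r2"
    "polydisc R \<subseteq> polydisc r3" "polydisc R \<subseteq> polydisc r4"
    by (rule polydisc_mono, simp add: R_def)+
  have "\<exists>y. norm y < R \<and> ev s (0, y) \<noteq> 0"
  proof (rule ccontr)
    assume *: "\<not> ?thesis"
    have "coef s 0 j = 0" for j
    proof (rule sums_zero_imp_coeffs_zero[OF R])
      fix y :: complex assume y: "norm y < R"
      have "(\<lambda>j. (\<Sum>i. coef s i j * 0 ^ i) * y ^ j) sums ps2_eval (coef s) (0, y)"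
        by (rule ps2_eval_rows(2)[OF r5(2)]) (use r5 y in \<open>auto simp: R_def\<close>)
      then show "(\<lambda>j. coef s 0 j * y ^ j) sums 0" using * y by (simp add: ev_def)
    qed
    then show False using reg by (simp add: x_regular_def)
  qed
  then obtain y0 where y0: "norm y0 < R" "ev s (0, y0) \<noteq> 0" by blast
  obtain v where v: "\<forall>\<^sub>0z. ev s z = ev v z ^ n"
  proof (rule nth_root_two_variables[where F = "ev s" and G = "ev t" and H = "ev u", OF _ _ _ _ n _ y0])
    show "ev s holomorphic2_on polydisc R" "ev t holomorphic2_on polydisc R" "ev u holomorphic2_on polydisc R"
      using r2 r3 r4 sub holomorphic2_on_subset by blast+
    show "ev s z ^ i * ev t z = ev u z ^ n" if "z \<in> polydisc R" for z using r0 sub that by blast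
    show "z = (0, 0)" if "z \<in> polydisc R" "ev s z = 0" "ev t z = 0" for z using r1 sub that by blast
  qed
  have "s = v ^ n"
    by (rule ev_eqI, use v ev_power[of v n] in eventually_elim) simp
  then show ?thesis by (rule that)
qed

text \<open>No factoriality of the power series ring is needed: off the origin the fibrewise zeros of
  \<open>s\<close> have multiplicity divisible by \<open>n\<close>, and the fibrewise roots are glued by a Cauchy integral.\<close>

lemma cps_nth_root:
  assumes eq: "s ^ i * t = u ^ n" and n: "coprime i n" "0 < n"
    and common: "\<forall>\<^sub>0z. ev s z = 0 \<longrightarrow> ev t z = 0 \<longrightarrow> z = (0, 0)"
  obtains v where "s = v ^ n"
proof (cases "s = 0")
  case True
  then show ?thesis using that[of 0] n by (simp add: zero_power)
next
  case s: False
  obtain a s' where s': "s = monom2 1 a 0 * s'" "x_regular s'" using x_regular_factor[OF s] .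
  show ?thesis
  proof (cases "a = 0")
    case True
    then have "x_regular s" using s' by (simp flip: one_cps_monom2)
    then show ?thesis using x_regular_nth_root[OF eq n _ common] that by blast
  next
    case a: False
    \<comment> \<open>Here x divides \<open>s\<close>; if it also divided \<open>t\<close>, the
      whole line x = 0 would consist of common zeros.\<close>
    have t: "x_regular t"
    proof (rule ccontr)
      assume "\<not> x_regular t"
      then have "coef t i j \<noteq> 0 \<Longrightarrow> 1 \<le> i \<and> 0 \<le> j" for i j
        by (cases i) (auto simp: x_regular_def)
      then obtain t' where t': "t = monom2 1 1 0 * t'" using cps_divide_monom2[of t 1 0] by metis
      have "\<forall>\<^sub>0z. fst z = 0 \<longrightarrow> z = (0, 0)"
        using common ev_mult[of "monom2 1 a 0" s'] ev_mult[of "monom2 1 1 0" t']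
        by eventually_elim (use a in \<open>auto simp: s'(1) t' ev_monom2 zero_power\<close>)
      then obtain r where r: "r > 0" "\<And>z. z \<in> polydisc r \<Longrightarrow> fst z = 0 \<longrightarrow> z = (0, 0)"
        unfolding eventually_nhds_polydisc by blast
      then show False using r(2)[of "(0, of_real (r / 2))"] by auto
    qed
    have "s ^ i * t = monom2 1 (a * i) 0 * (s' ^ i * t)"
      by (simp add: s'(1) power_mult_distrib monom2_power mult.assoc)
    moreover have "x_regular (s' ^ i * t)" using s'(2) t x_regular_mult x_regular_power by blast
    ultimately have u: "u ^ n = monom2 1 (a * i) 0 * (s' ^ i * t)" "x_regular (s' ^ i * t)" using eq by auto
    have "u \<noteq> 0"
    proof
      assume "u = 0"
      then have "monom2 1 (a * i) 0 * (s' ^ i * t) = (0 :: cps)" using u n by (simp add: zero_power)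
      moreover obtain j where "coef (s' ^ i * t) 0 j \<noteq> 0" using u(2) by (auto simp: x_regular_def)
      ultimately show False using coef_monom2_mult[of 1 "a * i" 0 "s' ^ i * t" "a * i" j] by (simp del: mult_eq_0_iff)
    qed
    then obtain l u' where u': "u = monom2 1 l 0 * u'" "x_regular u'" using x_regular_factor by blast
    have "monom2 1 (a * i) 0 * (s' ^ i * t) = monom2 1 (l * n) 0 * u' ^ n"
      using u(1) by (simp add: u'(1) power_mult_distrib monom2_power)
    \<comment> \<open>Equality of the x-orders gives n | a, so the power of x in \<open>s\<close> is
      itself an n-th power; the cofactor \<open>s'\<close> is covered by the regular case.\<close>
    from x_order_unique[OF this u(2) x_regular_power[OF u'(2)]]
    have al: "a * i = l * n" "s' ^ i * t = u' ^ n" by auto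
    have "\<forall>\<^sub>0z. ev s' z = 0 \<longrightarrow> ev t z = 0 \<longrightarrow> z = (0, 0)"
      using common ev_mult[of "monom2 1 a 0" s'] by eventually_elim (simp add: s'(1))
    then obtain v where v: "s' = v ^ n" using x_regular_nth_root[OF al(2) n s'(2)] by blast
    have "n dvd a * i" using al(1) by simp
    then have "n dvd a" using n(1) by (simp add: coprime_commute coprime_dvd_mult_left_iff)
    then obtain b where "a = b * n" by (metis dvd_def mult.commute)
    then have "s = (monom2 1 b 0 * v) ^ n" by (simp add: s'(1) v power_mult_distrib monom2_power)
    then show ?thesis by (rule that)
  qed
qed

section \<open>Homomorphisms of invariant rings\<close>

definition inv_ring :: "nat \<Rightarrow> nat \<Rightarrow> cps set" where
  "inv_ring m q = {s. \<forall>i j. coef s i j \<noteq> 0 \<longrightarrow> m dvd i + q * j}"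

text \<open>The target is the whole type, so that maps into a subring and maps into C{x,y} are
  treated alike; where the image lies is stated separately. The notion is purely algebraic, without
  continuity.\<close>

definition cps_hom :: "cps set \<Rightarrow> (cps \<Rightarrow> cps) \<Rightarrow> bool" where
  "cps_hom A f \<longleftrightarrow> (\<forall>a\<in>A. \<forall>b\<in>A. f (a + b) = f a + f b \<and> f (a * b) = f a * f b) \<and>
     (\<forall>c. \<forall>a\<in>A. f (cst c * a) = cst c * f a) \<and> f 1 = 1"

definition cps_iso :: "cps set \<Rightarrow> cps set \<Rightarrow> bool" where
  "cps_iso A B \<longleftrightarrow> (\<exists>f. cps_hom A f \<and> bij_betw f A B)"

lemma cqs_ring_eq: "cqs_ring m q = coef ` inv_ring m q"
proof
  show "cqs_ring m q \<subseteq> coef ` inv_ring m q"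
  proof
    fix a assume a: "a \<in> cqs_ring m q"
    then have "coef (Cps a) = a" by (simp add: cqs_ring_def)
    then show "a \<in> coef ` inv_ring m q" using a by (intro image_eqI[of _ _ "Cps a"]) (auto simp: cqs_ring_def inv_ring_def)
  qed
qed (auto simp: cqs_ring_def inv_ring_def)

lemma inv_ring_1 [simp]: "inv_ring (Suc 0) q = UNIV"
  by (auto simp: inv_ring_def)

lemma smooth_ring_eq: "smooth_ring = coef ` UNIV"
  using cqs_ring_eq[of 1 1] by (simp add: smooth_ring_def cqs_ring_def)

lemma coef_ops:
  "ps2_add (coef a) (coef b) = coef (a + b)" "ps2_mult (coef a) (coef b) = coef (a * b)"
  "ps2_smult c (coef a) = coef (cst c * a)" "ps2_one = coef 1"
  by (simp_all add: ps2_add_def ps2_smult_def ps2_one_def fun_eq_iff) (simp add: coef_times)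

lemma alg_hom_imp_cps_hom:
  assumes "alg_hom (coef ` A) B f" "B \<subseteq> Collect convergent_ps2"
  shows "cps_hom A (\<lambda>s. Cps (f (coef s)))"
    and "\<And>s. s \<in> A \<Longrightarrow> coef (Cps (f (coef s))) = f (coef s)"
proof -
  have B: "f (coef s) \<in> B" if "s \<in> A" for s using assms that by (auto simp: alg_hom_def)
  show c: "coef (Cps (f (coef s))) = f (coef s)" if "s \<in> A" for s
    using assms(2) B[OF that] by (intro coef_Cps) auto
  note h = assms(1)[unfolded alg_hom_def]
  show "cps_hom A (\<lambda>s. Cps (f (coef s)))"
    unfolding cps_hom_def
  proof (intro conjI ballI allI)
    fix a b assume ab: "a \<in> A" "b \<in> A"
    have "f (coef (a + b)) = ps2_add (f (coef a)) (f (coef b))" using h ab by (simp flip: coef_ops)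
    also have "\<dots> = coef (Cps (f (coef a)) + Cps (f (coef b)))" using c ab by (simp flip: coef_ops)
    finally show "Cps (f (coef (a + b))) = Cps (f (coef a)) + Cps (f (coef b))" by (simp add: coef_inverse)
    have "f (coef (a * b)) = ps2_mult (f (coef a)) (f (coef b))" using h ab by (simp flip: coef_ops)
    also have "\<dots> = coef (Cps (f (coef a)) * Cps (f (coef b)))" using c ab by (simp flip: coef_ops)
    finally show "Cps (f (coef (a * b))) = Cps (f (coef a)) * Cps (f (coef b))" by (simp add: coef_inverse)
  next
    fix d a assume a: "a \<in> A"
    have "f (coef (cst d * a)) = ps2_smult d (f (coef a))" using h a by (simp flip: coef_ops(3))
    also have "\<dots> = coef (cst d * Cps (f (coef a)))" using c a by (simp flip: coef_ops(3))
    finally show "Cps (f (coef (cst d * a))) = cst d * Cps (f (coef a))" by (simp add: coef_inverse)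
  next
    show "Cps (f (coef 1)) = 1" using h by (simp add: coef_ops coef_inverse)
  qed
qed

lemma alg_iso_iff_cps_iso: "alg_iso (coef ` A) (coef ` B) \<longleftrightarrow> cps_iso A B"
proof
  assume "alg_iso (coef ` A) (coef ` B)"
  then obtain f where f: "alg_hom (coef ` A) (coef ` B) f" "bij_betw f (coef ` A) (coef ` B)"
    by (auto simp: alg_iso_def)
  have inj: "inj_on coef X" for X by (simp add: coef_inject inj_on_def)
  have "bij_betw (f \<circ> coef) A (coef ` B)"
    by (rule bij_betw_trans[OF _ f(2)]) (simp add: inj_on_imp_bij_betw inj)
  moreover have "bij_betw Cps (coef ` B) B"
    by (rule bij_betwI[of _ _ _ coef]) (auto simp: coef_inverse)
  ultimately have "bij_betw (Cps \<circ> (f \<circ> coef)) A B" by (rule bij_betw_trans)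
  moreover have "coef ` B \<subseteq> Collect convergent_ps2" by auto
  ultimately show "cps_iso A B" using alg_hom_imp_cps_hom(1)[OF f(1)] unfolding cps_iso_def comp_def by blast
next
  assume "cps_iso A B"
  then obtain f where f: "cps_hom A f" "bij_betw f A B" by (auto simp: cps_iso_def)
  let ?g = "coef \<circ> (f \<circ> Cps)"
  have "bij_betw Cps (coef ` A) A"
    by (rule bij_betwI[of _ _ _ coef]) (auto simp: coef_inverse)
  then have "bij_betw (f \<circ> Cps) (coef ` A) B" using f(2) by (rule bij_betw_trans)
  moreover have "bij_betw coef B (coef ` B)" by (simp add: bij_betw_def coef_inject inj_on_def)
  ultimately have bij: "bij_betw ?g (coef ` A) (coef ` B)" by (rule bij_betw_trans)
  moreover have "alg_hom (coef ` A) (coef ` B) ?g"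
    unfolding alg_hom_def using f(1) bij_betwE[OF f(2)]
    by (auto simp: coef_ops coef_inverse cps_hom_def)
  ultimately show "alg_iso (coef ` A) (coef ` B)" unfolding alg_iso_def by blast
qed

lemma cps_iso_sym:
  assumes "cps_iso A B" and A: "1 \<in> A" "\<And>a b. a \<in> A \<Longrightarrow> b \<in> A \<Longrightarrow> a + b \<in> A \<and> a * b \<in> A" "\<And>a c. a \<in> A \<Longrightarrow> cst c * a \<in> A"
  obtains g where "cps_hom B g" "bij_betw g B A"
proof -
  obtain f where f: "cps_hom A f" "bij_betw f A B" using assms(1) by (auto simp: cps_iso_def)
  let ?g = "inv_into A f"
  have b: "bij_betw ?g B A" using f(2) by (rule bij_betw_inv_into)
  have fg: "f (?g y) = y" if "y \<in> B" for y using f(2) that by (rule bij_betw_inv_into_right)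
  have gf: "?g (f x) = x" if "x \<in> A" for x using f(2) that by (rule bij_betw_inv_into_left)
  have gA: "?g y \<in> A" if "y \<in> B" for y using b that by (auto dest: bij_betwE)
  have "?g (x + y) = ?g x + ?g y \<and> ?g (x * y) = ?g x * ?g y" if "x \<in> B" "y \<in> B" for x y
  proof -
    have "f (?g x + ?g y) = x + y" "f (?g x * ?g y) = x * y"
      using f(1) gA fg that by (auto simp: cps_hom_def)
    then show ?thesis using gf A(2) gA that by metis
  qed
  moreover have "?g (cst c * x) = cst c * ?g x" if "x \<in> B" for c x
  proof -
    have "f (cst c * ?g x) = cst c * x" using f(1) gA fg that by (auto simp: cps_hom_def)
    then show ?thesis using gf A(3) gA that by metis
  qed
  moreover have "?g 1 = 1" using gf[OF A(1)] f(1) by (simp add: cps_hom_def)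
  ultimately show ?thesis using that b unfolding cps_hom_def by blast
qed

lemma inv_ring_closed:
  assumes "a \<in> inv_ring m q" "b \<in> inv_ring m q"
  shows "a + b \<in> inv_ring m q" "a * b \<in> inv_ring m q" "a - b \<in> inv_ring m q"
proof -
  show "a * b \<in> inv_ring m q" unfolding inv_ring_def
  proof (clarify)
    fix i j assume "coef (a * b) i j \<noteq> 0"
    then obtain k l where kl: "k \<le> i" "l \<le> j" "coef a k l * coef b (i - k) (j - l) \<noteq> 0"
      unfolding coef_times ps2_mult_def by (metis (no_types, lifting) atMost_iff sum.not_neutral_contains_not_neutral)
    then have "coef a k l \<noteq> 0" "coef b (i - k) (j - l) \<noteq> 0" by auto
    then have "m dvd k + q * l" "m dvd (i - k) + q * (j - l)" using assms unfolding inv_ring_def by blast+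
    then have "m dvd (k + q * l) + ((i - k) + q * (j - l))" by (rule dvd_add)
    also have "(k + q * l) + ((i - k) + q * (j - l)) = i + q * j"
    proof -
      obtain i' j' where "i = k + i'" "j = l + j'" using kl le_Suc_ex by blast
      then show ?thesis by (simp add: algebra_simps)
    qed
    finally show "m dvd i + q * j" .
  qed
  show "a + b \<in> inv_ring m q" unfolding inv_ring_def
  proof (clarify)
    fix i j assume "coef (a + b) i j \<noteq> 0"
    then have "coef a i j \<noteq> 0 \<or> coef b i j \<noteq> 0" by auto
    then show "m dvd i + q * j" using assms by (auto simp: inv_ring_def)
  qed
  show "a - b \<in> inv_ring m q" unfolding inv_ring_def
  proof (clarify)
    fix i j assume "coef (a - b) i j \<noteq> 0"
    then have "coef a i j \<noteq> 0 \<or> coef b i j \<noteq> 0" by auto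
    then show "m dvd i + q * j" using assms by (auto simp: inv_ring_def)
  qed
qed

lemma cst_mult_in_inv_ring: "a \<in> inv_ring m q \<Longrightarrow> cst c * a \<in> inv_ring m q"
  by (auto simp: inv_ring_def)

lemma monom2_in_inv_ring: "m dvd i + q * j \<Longrightarrow> monom2 c i j \<in> inv_ring m q"
  by (auto simp: inv_ring_def coef_monom2)

lemma one_in_inv_ring [simp]: "1 \<in> inv_ring m q" and zero_in_inv_ring [simp]: "0 \<in> inv_ring m q"
  by (auto simp: inv_ring_def)

lemma power_in_inv_ring: "a \<in> inv_ring m q \<Longrightarrow> a ^ n \<in> inv_ring m q"
  by (induction n) (auto intro: inv_ring_closed)

lemma sum_in_inv_ring: "(\<And>x. x \<in> I \<Longrightarrow> f x \<in> inv_ring m q) \<Longrightarrow> (\<Sum>x\<in>I. f x) \<in> inv_ring m q"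
  by (induction I rule: infinite_finite_induct) (auto intro: inv_ring_closed)

lemma cst_0: "cst 0 = 0"
  by (rule cps_eqI) (simp add: coef_monom2)

context
  fixes \<psi> m q
  assumes hom: "cps_hom (inv_ring m q) \<psi>"
begin

lemma hom_add: "a \<in> inv_ring m q \<Longrightarrow> b \<in> inv_ring m q \<Longrightarrow> \<psi> (a + b) = \<psi> a + \<psi> b"
  and hom_mult: "a \<in> inv_ring m q \<Longrightarrow> b \<in> inv_ring m q \<Longrightarrow> \<psi> (a * b) = \<psi> a * \<psi> b"
  and hom_cst_mult: "a \<in> inv_ring m q \<Longrightarrow> \<psi> (cst c * a) = cst c * \<psi> a"
  and hom_1: "\<psi> 1 = 1"
  using hom by (auto simp: cps_hom_def)

lemma hom_cst: "\<psi> (cst c) = cst c"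
  using hom_cst_mult[OF one_in_inv_ring, of c] by (simp add: hom_1)

lemma hom_0: "\<psi> 0 = 0"
  using hom_cst[of 0] by (simp add: cst_0)

lemma hom_power: "a \<in> inv_ring m q \<Longrightarrow> \<psi> (a ^ n) = \<psi> a ^ n"
  by (induction n) (simp_all add: hom_1 hom_mult power_in_inv_ring)

lemma hom_sum: "(\<And>x. x \<in> I \<Longrightarrow> f x \<in> inv_ring m q) \<Longrightarrow> \<psi> (\<Sum>x\<in>I. f x) = (\<Sum>x\<in>I. \<psi> (f x))"
  by (induction I rule: infinite_finite_induct) (auto simp: hom_0 hom_add sum_in_inv_ring)

end

section \<open>Roots of unity and invariance\<close>

lemma primitive_root_exists:
  assumes "0 < m"
  obtains \<zeta> :: complex where "\<And>k. \<zeta> ^ k = 1 \<longleftrightarrow> m dvd k"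
proof -
  have "exp (2 * of_real pi * \<i> / of_nat m) ^ k = 1 \<longleftrightarrow> m dvd k" for k
    using complex_root_unity_eq_1[of m k] assms by (simp flip: exp_of_nat_mult add: mult_ac)
  then show ?thesis by (rule that)
qed

lemma primitive_root_power_eq:
  assumes "\<And>k. \<zeta> ^ k = (1 :: complex) \<longleftrightarrow> m dvd k" "0 < m"
  shows "\<zeta> ^ a = \<zeta> ^ b \<longleftrightarrow> [a = b] (mod m)"
proof -
  have "\<zeta> ^ m = 1" using assms(1) by simp
  then have "\<zeta> \<noteq> 0" using assms(2) by (auto simp: zero_power)
  have *: "\<zeta> ^ a = \<zeta> ^ b \<longleftrightarrow> [a = b] (mod m)" if "a \<le> b" for a b
  proof -
    have "\<zeta> ^ b = \<zeta> ^ a * \<zeta> ^ (b - a)" using that by (simp flip: power_add)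
    then have "\<zeta> ^ a = \<zeta> ^ b \<longleftrightarrow> \<zeta> ^ (b - a) = 1" using \<open>\<zeta> \<noteq> 0\<close> by auto
    also have "\<dots> \<longleftrightarrow> [a = b] (mod m)" using assms(1) that by (metis cong_altdef_nat cong_sym)
    finally show ?thesis .
  qed
  show ?thesis using *[of a b] *[of b a] by (metis cong_sym nat_le_linear)
qed

abbreviation scale :: "complex \<Rightarrow> complex \<Rightarrow> cps \<Rightarrow> cps" where
  "scale \<alpha> \<beta> s \<equiv> subst s (monom2 \<alpha> 1 0) (monom2 \<beta> 0 1)"

text \<open>A generator of \<mu>_m detects invariance. The support condition becomes an equation,
  which can be transported through products and substitutions.\<close>

lemma inv_ring_iff_scale:
  assumes \<zeta>: "\<And>k. \<zeta> ^ k = 1 \<longleftrightarrow> m dvd k"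
  shows "s \<in> inv_ring m q \<longleftrightarrow> scale \<zeta> (\<zeta> ^ q) s = s"
proof -
  have "scale \<zeta> (\<zeta> ^ q) s = s \<longleftrightarrow> (\<forall>i j. \<zeta> ^ (i + q * j) * coef s i j = coef s i j)"
  proof -
    have "coef (scale \<zeta> (\<zeta> ^ q) s) i j = \<zeta> ^ (i + q * j) * coef s i j" for i j
      unfolding coef_subst_scale by (simp add: power_add power_mult)
    then show ?thesis by (metis cps_eqI)
  qed
  also have "\<dots> \<longleftrightarrow> s \<in> inv_ring m q" by (auto simp: inv_ring_def \<zeta>)
  finally show ?thesis by simp
qed

lemma inv_ring_unit:
  assumes "s \<in> inv_ring m q" "coef s 0 0 \<noteq> 0" "0 < m"
  obtains t where "t \<in> inv_ring m q" "s * t = 1"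
proof -
  obtain \<zeta> :: complex where \<zeta>: "\<And>k. \<zeta> ^ k = 1 \<longleftrightarrow> m dvd k" using primitive_root_exists[OF assms(3)] by blast
  obtain t where t: "s * t = 1" using cps_unit[OF assms(2)] .
  have "scale \<zeta> (\<zeta> ^ q) s * scale \<zeta> (\<zeta> ^ q) t = 1"
    using arg_cong[OF t, of "scale \<zeta> (\<zeta> ^ q)"] by (simp add: subst_mult subst_1)
  then have "s * scale \<zeta> (\<zeta> ^ q) t = s * t" using assms(1) inv_ring_iff_scale[OF \<zeta>] t by metis
  moreover have "s \<noteq> 0" using t by auto
  ultimately have "scale \<zeta> (\<zeta> ^ q) t = t" by simp
  then show ?thesis using that t inv_ring_iff_scale[OF \<zeta>] by blast
qed

text \<open>If the image had a nonzero constant term c, then b - c would be a unit of the invariant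
  ring whose image vanishes at the origin.\<close>

lemma hom_local:
  assumes "cps_hom (inv_ring m q) \<psi>" "b \<in> inv_ring m q" "coef b 0 0 = 0" "0 < m"
  shows "coef (\<psi> b) 0 0 = 0"
proof (rule ccontr)
  assume c: "coef (\<psi> b) 0 0 \<noteq> 0"
  define c where "c = coef (\<psi> b) 0 0"
  have C: "cst (- c) \<in> inv_ring m q" by (rule monom2_in_inv_ring) simp
  have "b + cst (- c) \<in> inv_ring m q" by (rule inv_ring_closed[OF assms(2) C])
  moreover have "coef (b + cst (- c)) 0 0 \<noteq> 0" using assms(3) c by (simp add: c_def)
  ultimately obtain t where t: "t \<in> inv_ring m q" "(b + cst (- c)) * t = 1" using inv_ring_unit assms(4) by blast
  have "(\<psi> b + cst (- c)) * \<psi> t = 1"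
    using arg_cong[OF t(2), of \<psi>] assms(2) C t(1)
    by (simp add: hom_1[OF assms(1)] hom_mult[OF assms(1)] hom_add[OF assms(1)] hom_cst[OF assms(1)] inv_ring_closed)
  then have "coef ((\<psi> b + cst (- c)) * \<psi> t) 0 0 = 1" by simp
  then show False by (simp add: c_def)
qed

lemma coef_mult_low_order:
  assumes "\<And>i j. i + j < M \<Longrightarrow> coef s i j = 0" "\<And>i j. i + j < N \<Longrightarrow> coef t i j = 0" "i + j < M + N"
  shows "coef (s * t) i j = 0"
  unfolding coef_times ps2_mult_def
proof (intro sum.neutral ballI)
  fix k l assume "k \<in> {..i}" "l \<in> {..j}"
  then have "k + l < M \<or> (i - k) + (j - l) < N" using assms(3) by auto
  then show "coef s k l * coef t (i - k) (j - l) = 0" using assms(1,2) by auto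
qed

lemma coef_power_low_order:
  assumes "coef s 0 0 = 0" "i + j < n"
  shows "coef (s ^ n) i j = 0"
  using assms(2)
proof (induction n arbitrary: i j)
  case (Suc n)
  have "coef (s * s ^ n) i j = 0"
    by (rule coef_mult_low_order[where M = 1 and N = n]) (use Suc assms in auto)
  then show ?case by simp
qed simp

text \<open>Reduction modulo x^(mN) and y^(mN). The cut-off is a multiple of m so that the cofactors
  stay invariant. A homomorphism is thereby controlled to any finite order from its values on
  monomials.\<close>

lemma inv_ring_split:
  assumes b: "b \<in> inv_ring m q"
  obtains b1 b2 where "b1 \<in> inv_ring m q" "b2 \<in> inv_ring m q"
    "b = (\<Sum>(i, j)\<in>{..<m * N} \<times> {..<m * N}. monom2 (coef b i j) i j) + monom2 1 (m * N) 0 * b1 + monom2 1 0 (m * N) * b2"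
proof -
  let ?K = "m * N"
  let ?P = "\<Sum>(i, j)\<in>{..<?K} \<times> {..<?K}. monom2 (coef b i j) i j"
  define r1 where "r1 = Cps (\<lambda>i j. if ?K \<le> i then coef b i j else 0)"
  define r2 where "r2 = Cps (\<lambda>i j. if i < ?K \<and> ?K \<le> j then coef b i j else 0)"
  have c1: "coef r1 i j = (if ?K \<le> i then coef b i j else 0)" for i j
    unfolding r1_def by (subst coef_Cps) (auto intro: convergent_ps2_mono[OF convergent_coef[of b]])
  have c2: "coef r2 i j = (if i < ?K \<and> ?K \<le> j then coef b i j else 0)" for i j
    unfolding r2_def by (subst coef_Cps) (auto intro: convergent_ps2_mono[OF convergent_coef[of b]])
  obtain b1 where b1: "r1 = monom2 1 ?K 0 * b1" "\<And>i j. coef b1 i j = coef r1 (i + ?K) (j + 0)"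
    using cps_divide_monom2[of r1 ?K 0] c1 by (metis le0)
  obtain b2 where b2: "r2 = monom2 1 0 ?K * b2" "\<And>i j. coef b2 i j = coef r2 (i + 0) (j + ?K)"
    using cps_divide_monom2[of r2 0 ?K] c2 by (metis le0)
  have P: "coef ?P k l = (if k < ?K \<and> l < ?K then coef b k l else 0)" for k l
  proof -
    have "coef ?P k l = (\<Sum>p\<in>{..<?K} \<times> {..<?K}. if p = (k, l) then coef b k l else 0)"
      unfolding coef_sum case_prod_unfold by (intro sum.cong) (auto simp: coef_monom2)
    then show ?thesis by (auto simp: sum.delta)
  qed
  have "m dvd i + q * j" if "coef b1 i j \<noteq> 0" for i j
  proof -
    have "m dvd (i + ?K) + q * j" using that b unfolding b1(2) c1 by (auto simp: inv_ring_def)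
    then show ?thesis by (metis add.assoc add.commute dvd_add_right_iff dvd_triv_left)
  qed
  moreover have "m dvd i + q * j" if "coef b2 i j \<noteq> 0" for i j
  proof -
    have "m dvd i + q * (j + ?K)" using that b unfolding b2(2) c2 by (auto simp: inv_ring_def split: if_splits)
    then have "m dvd (i + q * j) + m * (q * N)" by (simp add: algebra_simps)
    then show ?thesis by (simp add: dvd_add_left_iff)
  qed
  moreover have "b = ?P + r1 + r2"
    by (rule cps_eqI) (auto simp: P c1 c2)
  ultimately show ?thesis using that[of b1 b2] b1(1) b2(1) by (auto simp: inv_ring_def)
qed


section \<open>Lifting homomorphisms to substitutions\<close>

lemma cst_mult_cst: "cst a * (cst b * s) = cst (a * b) * s"
  using monom2_mult[of a 0 0 b 0 0] by (simp flip: mult.assoc)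

lemma cst_1_mult: "cst 1 * s = s"
  by (simp flip: one_cps_monom2)

lemma cst_power: "cst c ^ n = cst (c ^ n)"
  by (simp add: monom2_power)

text \<open>Over the domain \<open>cps\<close> the polynomial T^n - b^n has at most n roots, and the
  n multiples of b by roots of unity exhaust them.\<close>

lemma cps_power_eq_imp:
  fixes a b :: cps
  assumes "a ^ n = b ^ n" "0 < n"
  obtains \<theta> where "\<theta> ^ n = 1" "a = cst \<theta> * b"
proof (cases "b = 0")
  case True
  then show ?thesis using that[of 1] assms by (simp add: zero_power)
next
  case b: False
  let ?S = "(\<lambda>c. cst c * b) ` {c. c ^ n = 1}"
  let ?p = "Polynomial.monom 1 n - [:b ^ n:]"
  have pp: "poly ?p x = x ^ n - b ^ n" for x by (simp add: poly_monom)
  have "Polynomial.coeff ?p n = 1" using assms(2) by (cases n) auto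
  then have p0: "?p \<noteq> 0" by (metis Polynomial.coeff_0 zero_neq_one)
  have deg: "Polynomial.degree ?p \<le> n"
    by (rule order_trans[OF degree_diff_le_max]) (auto simp: degree_monom_le)
  have inj: "inj_on (\<lambda>c. cst c * b) {c. c ^ n = 1}"
  proof (rule inj_onI)
    fix c d assume "cst c * b = cst d * b"
    then have "cst c = cst d" using mult_right_cancel[OF b] by blast
    from arg_cong[OF this, of "\<lambda>s. coef s 0 0"] show "c = d" by simp
  qed
  have card: "card ?S = n"
    unfolding card_image[OF inj] by (rule card_roots_unity_eq) (use assms(2) in simp)
  have "a \<in> ?S"
  proof (rule ccontr)
    assume "a \<notin> ?S"
    have fin: "finite ?S" using finite_roots_unity[of n] assms(2) by (intro finite_imageI) auto
    have "insert a ?S \<subseteq> {x. poly ?p x = 0}"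
      unfolding pp using assms(1) by (auto simp: power_mult_distrib cst_power cst_1_mult)
    then have "card (insert a ?S) \<le> card {x. poly ?p x = 0}"
      by (rule card_mono[OF poly_roots_finite[OF p0]])
    also have "\<dots> \<le> n" using card_poly_roots_bound[OF p0] deg by linarith
    finally show False using card fin \<open>a \<notin> ?S\<close> by simp
  qed
  then show ?thesis using that by blast
qed

text \<open>The exponent \<open>(m - 1) * q\<close> is a nonnegative representative of \<open>- q\<close> modulo \<open>m\<close>, so the
  monomial \<open>x ^ ((m - 1) * q) * y\<close> is invariant.\<close>

lemma inv_ring_hom_lift:
  assumes m: "0 < m" "coprime q m" and hom: "cps_hom (inv_ring m q) \<psi>"
    and nz: "\<psi> (monom2 1 m 0) \<noteq> 0"
    and common: "\<forall>\<^sub>0z. ev (\<psi> (monom2 1 m 0)) z = 0 \<longrightarrow> ev (\<psi> (monom2 1 0 m)) z = 0 \<longrightarrow> z = (0, 0)"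
  obtains X Y where "coef X 0 0 = 0" "coef Y 0 0 = 0" "\<And>b. b \<in> inv_ring m q \<Longrightarrow> \<psi> b = subst b X Y"
proof -
  let ?A = "inv_ring m q"
  define e where "e = (m - 1) * q"
  have eq: "e + q = m * q" using m(1) by (cases m) (auto simp: e_def)
  define F G H where "F = \<psi> (monom2 1 m 0)" and "G = \<psi> (monom2 1 0 m)" and "H = \<psi> (monom2 1 e 1)"
  have inA: "monom2 1 m 0 \<in> ?A" "monom2 1 0 m \<in> ?A" "monom2 1 e 1 \<in> ?A"
    by (rule monom2_in_inv_ring, simp add: eq)+
  have "monom2 1 m 0 ^ e * monom2 1 0 m = monom2 1 e 1 ^ m"
    by (simp add: monom2_power monom2_mult mult.commute)
  from arg_cong[OF this, of \<psi>] have FGH: "F ^ e * G = H ^ m"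
    using inA by (simp add: hom_mult[OF hom] hom_power[OF hom] power_in_inv_ring F_def G_def H_def)
  have "coprime (m - 1) m" using m(1) by (metis Suc_diff_1 coprime_Suc_right_nat)
  then have ce: "coprime e m" using m(2) by (simp add: e_def)
  obtain X where X: "F = X ^ m"
    by (rule cps_nth_root[OF FGH ce m(1)]) (use common in \<open>simp_all add: F_def G_def\<close>)
  obtain Y0 where Y0: "G = Y0 ^ m"
  proof (rule cps_nth_root[of G 1 "F ^ e" H m])
    show "\<forall>\<^sub>0z. ev G z = 0 \<longrightarrow> ev (F ^ e) z = 0 \<longrightarrow> z = (0, 0)"
      using common ev_power[of F e] by eventually_elim (auto simp: F_def G_def)
  qed (use FGH m in \<open>auto simp: mult.commute\<close>)
  have "H ^ m = (X ^ e * Y0) ^ m"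
    using FGH by (simp add: X Y0 power_mult_distrib mult.commute flip: power_mult)
  then obtain \<theta> where \<theta>: "\<theta> ^ m = 1" "H = cst \<theta> * (X ^ e * Y0)" using cps_power_eq_imp[OF _ m(1)] by blast
  \<comment> \<open>The roots of \<open>F\<close> and \<open>G\<close> were chosen independently;
    the root of unity relating \<open>H\<close> to X^e Y0 is absorbed into \<open>Y\<close>, which
    leaves the m-th power unchanged.\<close>
  define Y where "Y = cst \<theta> * Y0"
  have Y: "H = X ^ e * Y" "G = Y ^ m"
    using \<theta> by (simp_all add: Y_def Y0 power_mult_distrib cst_power mult_ac flip: one_cps_monom2)
  have X0: "coef X 0 0 = 0"
    using hom_local[OF hom inA(1)] X m(1) coef_power_0_0[of X m] by (simp add: F_def)
  have Y00: "coef Y 0 0 = 0"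
    using hom_local[OF hom inA(2)] Y(2) m(1) coef_power_0_0[of Y m] by (simp add: G_def)
  have Xnz: "X \<noteq> 0" using nz X m(1) by (auto simp: F_def zero_power)
  \<comment> \<open>After multiplication by a power of x^m, an invariant monomial is a product of
    powers of x^m and x^e y. The power of \<open>F\<close> is cancelled afterwards, which is where
    \<open>nz\<close> enters.\<close>
  have mon: "\<psi> (monom2 1 i j) = X ^ i * Y ^ j" if ij: "m dvd i + q * j" for i j
  proof -
    obtain k where k: "i + q * j = m * k" using ij by (auto simp: dvd_def)
    have ex: "i + m * (q * j) = e * j + m * k"
    proof -
      have "e * j + (i + q * j) = i + (e + q) * j" by (simp add: algebra_simps)
      then show ?thesis by (simp add: eq k mult.assoc)
    qed
    have "monom2 1 i j * monom2 1 m 0 ^ (q * j) = monom2 1 e 1 ^ j * monom2 1 m 0 ^ k"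
      by (simp add: monom2_power monom2_mult ex)
    from arg_cong[OF this, of \<psi>] have "\<psi> (monom2 1 i j) * F ^ (q * j) = H ^ j * F ^ k"
      using inA monom2_in_inv_ring[OF ij, of 1]
      by (simp add: hom_mult[OF hom] hom_power[OF hom] power_in_inv_ring F_def H_def)
    also have "\<dots> = X ^ (e * j + m * k) * Y ^ j"
      by (simp add: X Y power_mult_distrib power_add mult_ac flip: power_mult)
    also have "\<dots> = (X ^ i * Y ^ j) * F ^ (q * j)"
      unfolding ex[symmetric] by (simp add: X power_add mult_ac flip: power_mult)
    finally show ?thesis using Xnz m(1) by (simp add: X)
  qed
  have "\<psi> b = subst b X Y" if b: "b \<in> ?A" for b
  proof (rule cps_eqI)
    fix i j
    \<comment> \<open>To compare one coefficient, N is taken larger than i + j: the remainders are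
      multiples of X^(mN) and Y^(mN) and do not reach it.\<close>
    define N where "N = Suc (i + j)"
    define P where "P = (\<Sum>(i, j)\<in>{..<m * N} \<times> {..<m * N}. monom2 (coef b i j) i j)"
    obtain b1 b2 where "b1 \<in> ?A" "b2 \<in> ?A"
      "b = (\<Sum>(i, j)\<in>{..<m * N} \<times> {..<m * N}. monom2 (coef b i j) i j) + monom2 1 (m * N) 0 * b1 + monom2 1 0 (m * N) * b2"
      by (rule inv_ring_split[OF b, of N], rule that)
    note bb = this[folded P_def]
    have mA: "monom2 (coef b i j) i j \<in> ?A" for i j
      using b by (auto simp: inv_ring_def coef_monom2)
    have PA: "P \<in> ?A" unfolding P_def by (rule sum_in_inv_ring) (use mA in auto)
    have mon': "\<psi> (monom2 (coef b i j) i j) = cst (coef b i j) * X ^ i * Y ^ j" for i j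
    proof (cases "coef b i j = 0")
      case True
      then have "monom2 (coef b i j) i j = 0" by (intro cps_eqI) (simp add: coef_monom2)
      then show ?thesis using True hom_0[OF hom] cst_0 by simp
    next
      case False
      then have d: "m dvd i + q * j" using b by (auto simp: inv_ring_def)
      have "monom2 (coef b i j) i j = cst (coef b i j) * monom2 1 i j" by (simp add: monom2_mult)
      then show ?thesis using hom_cst_mult[OF hom monom2_in_inv_ring[OF d]] mon[OF d] by (simp add: mult.assoc)
    qed
    have "\<psi> P = (\<Sum>(i, j)\<in>{..<m * N} \<times> {..<m * N}. cst (coef b i j) * X ^ i * Y ^ j)"
      unfolding P_def by (subst hom_sum[OF hom]) (auto simp: mA mon' case_prod_unfold)
    also have "\<dots> = subst P X Y"
    proof -
      have "subst (\<Sum>x\<in>I. f x) X Y = (\<Sum>x\<in>I. subst (f x) X Y)" for I and f :: "nat \<times> nat \<Rightarrow> cps"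
      proof (induction I rule: infinite_finite_induct)
        case (insert x F)
        then show ?case by (simp add: subst_add[OF X0 Y00])
      qed (use subst_monom2[OF X0 Y00, of 0 0 0] cst_0 in auto)
      then show ?thesis unfolding P_def by (simp add: subst_monom2[OF X0 Y00] case_prod_unfold)
    qed
    finally have P: "\<psi> P = subst P X Y" .
    have d1: "\<psi> (monom2 1 (m * N) 0) = X ^ (m * N)" "\<psi> (monom2 1 0 (m * N)) = Y ^ (m * N)"
      using mon[of "m * N" 0] mon[of 0 "m * N"] by simp_all
    have mA': "monom2 1 (m * N) 0 \<in> ?A" "monom2 1 0 (m * N) \<in> ?A" by (rule monom2_in_inv_ring, simp)+
    have "\<psi> b = subst P X Y + X ^ (m * N) * \<psi> b1 + Y ^ (m * N) * \<psi> b2"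
      using bb mA' PA by (simp add: hom_add[OF hom] hom_mult[OF hom] inv_ring_closed P d1)
    moreover have "subst b X Y = subst P X Y + X ^ (m * N) * subst b1 X Y + Y ^ (m * N) * subst b2 X Y"
      by (subst bb(3)) (simp add: subst_add[OF X0 Y00] subst_mult[OF X0 Y00] subst_monom2[OF X0 Y00] cst_1_mult)
    ultimately have "\<psi> b - subst b X Y = X ^ (m * N) * (\<psi> b1 - subst b1 X Y) + Y ^ (m * N) * (\<psi> b2 - subst b2 X Y)"
      by (simp add: algebra_simps)
    moreover have low: "coef (Z ^ (m * N) * t) i j = 0" if "coef Z 0 0 = 0" for Z t
    proof (rule coef_mult_low_order[where M = "m * N" and N = 0])
      show "i + j < m * N + 0" using m(1) by (cases m) (auto simp: N_def)
    qed (use coef_power_low_order[OF that] in auto)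
    ultimately have "coef (\<psi> b - subst b X Y) i j = 0" using X0 Y00 by simp
    then show "coef (\<psi> b) i j = coef (subst b X Y) i j" by simp
  qed
  then show ?thesis using that X0 Y00 by blast
qed

text \<open>Every monomial of degree at least 2m is divisible by x^m or y^m, so a^(2m) lies in the
  ideal that x^m and y^m generate in the invariant ring. Applied to two elements whose images have
  only the origin as common zero, this yields the finite-fibre condition of
  \<open>inv_ring_hom_lift\<close>.\<close>

lemma hom_image_vanishes_at_common_zeros:
  assumes hom: "cps_hom (inv_ring m q) \<psi>" and m: "0 < m" and a: "a \<in> inv_ring m q" "coef a 0 0 = 0"
  shows "\<forall>\<^sub>0z. ev (\<psi> (monom2 1 m 0)) z = 0 \<longrightarrow> ev (\<psi> (monom2 1 0 m)) z = 0 \<longrightarrow> ev (\<psi> a) z = 0"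
proof -
  let ?A = "inv_ring m q"
  define c where "c = a ^ (2 * m)"
  have c: "c \<in> ?A" using a(1) by (simp add: c_def power_in_inv_ring)
  obtain b1 b2 where bb: "b1 \<in> ?A" "b2 \<in> ?A"
    "c = (\<Sum>(i, j)\<in>{..<m * 1} \<times> {..<m * 1}. monom2 (coef c i j) i j) + monom2 1 (m * 1) 0 * b1 + monom2 1 0 (m * 1) * b2"
    by (rule inv_ring_split[OF c, of 1], rule that)
  have "(\<Sum>(i, j)\<in>{..<m * 1} \<times> {..<m * 1}. monom2 (coef c i j) i j) = 0"
  proof (intro sum.neutral ballI)
    fix p assume "p \<in> {..<m * 1} \<times> {..<m * 1}"
    then have "fst p + snd p < 2 * m" by auto
    then have "coef c (fst p) (snd p) = 0" unfolding c_def by (rule coef_power_low_order[OF a(2)])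
    then show "(case p of (i, j) \<Rightarrow> monom2 (coef c i j) i j) = 0"
      by (intro cps_eqI) (simp add: coef_monom2 case_prod_unfold)
  qed
  then have ceq: "a ^ (2 * m) = monom2 1 m 0 * b1 + monom2 1 0 m * b2" using bb(3) by (simp add: c_def)
  have mA: "monom2 1 m 0 \<in> ?A" "monom2 1 0 m \<in> ?A" by (rule monom2_in_inv_ring, simp)+
  have eqn: "\<psi> a ^ (2 * m) = \<psi> (monom2 1 m 0) * \<psi> b1 + \<psi> (monom2 1 0 m) * \<psi> b2"
    using arg_cong[OF ceq, of \<psi>] mA a bb by (simp add: hom_add[OF hom] hom_mult[OF hom] hom_power[OF hom] inv_ring_closed)
  have "\<forall>\<^sub>0z. ev (\<psi> a) z ^ (2 * m) = ev (\<psi> (monom2 1 m 0)) z * ev (\<psi> b1) z + ev (\<psi> (monom2 1 0 m)) z * ev (\<psi> b2) z"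
    using ev_power[of "\<psi> a" "2 * m"] ev_add[of "\<psi> (monom2 1 m 0) * \<psi> b1" "\<psi> (monom2 1 0 m) * \<psi> b2"]
      ev_mult[of "\<psi> (monom2 1 m 0)" "\<psi> b1"] ev_mult[of "\<psi> (monom2 1 0 m)" "\<psi> b2"]
    by eventually_elim (simp add: eqn)
  then show ?thesis by eventually_elim auto
qed

text \<open>Minimum principle. If the zero were isolated, 1 / J(x, .) would be holomorphic on the
  disc for x different from 0 and bounded by its values on |y| = \<rho>, uniformly in x because the
  compact set \<open>?K\<close> avoids the origin. Letting x tend to 0 bounds |J(0, 0)| away from
  0.\<close>

lemma cps_zero_not_isolated:
  assumes "coef J 0 0 = 0"
  shows "\<not> (\<forall>\<^sub>0z. z \<noteq> (0, 0) \<longrightarrow> ev J z \<noteq> 0)"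
proof
  assume "\<forall>\<^sub>0z. z \<noteq> (0, 0) \<longrightarrow> ev J z \<noteq> 0"
  then obtain r1 where r1: "r1 > 0" "\<And>z. z \<in> polydisc r1 \<Longrightarrow> z \<noteq> (0, 0) \<Longrightarrow> ev J z \<noteq> 0"
    unfolding eventually_nhds_polydisc by blast
  obtain r2 where r2: "r2 > 0" "ev J holomorphic2_on polydisc r2" by (rule ev_holomorphic2_on)
  define r where "r = min r1 r2"
  have r: "r > 0" "r \<le> r1" "r \<le> r2" using r1 r2 by (auto simp: r_def)
  have hol: "ev J holomorphic2_on polydisc r" by (rule holomorphic2_on_subset[OF r2(2) polydisc_mono[OF r(3)]])
  have nz: "ev J (x, y) \<noteq> 0" if "norm x < r" "norm y < r" "(x, y) \<noteq> (0, 0)" for x y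
    using r1(2)[of "(x, y)"] that r(2) by auto
  define \<rho> where "\<rho> = r / 2"
  have \<rho>: "0 < \<rho>" "\<rho> < r" using r by (auto simp: \<rho>_def)
  let ?K = "cball (0 :: complex) \<rho> \<times> sphere (0 :: complex) \<rho>"
  have "continuous_on ?K (\<lambda>z. norm (ev J z))"
    using hol \<rho> unfolding holomorphic2_on_def
    by (intro continuous_on_norm) (auto intro!: continuous_on_subset[of "polydisc r"])
  moreover have "compact ?K" by (intro compact_Times compact_cball compact_sphere)
  moreover have "?K \<noteq> {}" using \<rho> by simp
  ultimately obtain z0 where z0: "z0 \<in> ?K" "\<And>z. z \<in> ?K \<Longrightarrow> norm (ev J z0) \<le> norm (ev J z)"
    using continuous_attains_inf[of ?K "\<lambda>z. norm (ev J z)"] by blast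
  define \<mu> where "\<mu> = norm (ev J z0)"
  have \<mu>: "\<mu> > 0" using z0(1) \<rho> nz[of "fst z0" "snd z0"] by (auto simp: \<mu>_def)
  have low: "\<mu> \<le> norm (ev J (x, 0))" if x: "x \<noteq> 0" "norm x \<le> \<rho>" for x
  proof -
    have xr: "norm x < r" using x \<rho> by linarith
    have h: "(\<lambda>y. 1 / ev J (x, y)) holomorphic_on ball 0 r"
      using holomorphic2_on_slices(2)[OF hol xr] nz[OF xr] x(1) by (intro holomorphic_intros) auto
    have "norm ((deriv ^^ 0) (\<lambda>y. 1 / ev J (x, y)) 0) \<le> fact 0 * (1 / \<mu>) / \<rho> ^ 0"
    proof (rule Cauchy_inequality)
      have "cball 0 \<rho> \<subseteq> ball (0 :: complex) r" using \<rho> by auto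
      then show "continuous_on (cball 0 \<rho>) (\<lambda>y. 1 / ev J (x, y))"
        using h holomorphic_on_imp_continuous_on holomorphic_on_subset by blast
      show "(\<lambda>y. 1 / ev J (x, y)) holomorphic_on ball 0 \<rho>"
        by (rule holomorphic_on_subset[OF h]) (use \<rho> in auto)
      show "norm (1 / ev J (x, w)) \<le> 1 / \<mu>" if "norm (0 - w) = \<rho>" for w
        using z0(2)[of "(x, w)"] x(2) that \<mu> by (auto simp: norm_divide \<mu>_def intro!: divide_left_mono mult_pos_pos)
    qed (rule \<rho>)
    then have "1 / norm (ev J (x, 0)) \<le> 1 / \<mu>" by (simp add: norm_divide)
    then show ?thesis using nz[OF xr, of 0] x(1) \<mu> r by (simp add: field_simps)
  qed
  have "isCont (\<lambda>x. ev J (x, 0)) 0"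
    using holomorphic2_on_slices(1)[OF hol, of 0] r(1)
    by (auto dest!: holomorphic_on_imp_continuous_on simp: continuous_on_eq_continuous_at)
  then have "((\<lambda>x. norm (ev J (x, 0))) \<longlongrightarrow> norm (ev J (0, 0))) (at 0)"
    unfolding isCont_def by (rule tendsto_norm)
  then have "\<mu> \<le> norm (ev J (0, 0))"
  proof (rule tendsto_lowerbound)
    have "\<forall>\<^sub>F x in at 0. x \<in> ball (0 :: complex) \<rho>" by (rule eventually_at_in_open') (use \<rho> in auto)
    moreover have "\<forall>\<^sub>F x in at 0. x \<noteq> (0 :: complex)" by (simp add: eventually_at_filter)
    ultimately show "\<forall>\<^sub>F x in at 0. \<mu> \<le> norm (ev J (x, 0))"
      by eventually_elim (use low in auto)
  qed simp
  then show False using \<mu> assms by (simp add: ev_0_0)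
qed

section \<open>Invariant rings are not smooth\<close>

lemma linear_dependence_three:
  fixes x1 y1 x2 y2 x3 y3 :: complex
  obtains a b c where "a * x1 + b * x2 + c * x3 = 0" "a * y1 + b * y2 + c * y3 = 0" "a \<noteq> 0 \<or> b \<noteq> 0 \<or> c \<noteq> 0"
proof (cases "x1 * y2 - x2 * y1 = 0 \<and> x2 * y3 - x3 * y2 = 0 \<and> x3 * y1 - x1 * y3 = 0")
  case False
  show ?thesis
    by (rule that[of "x2 * y3 - x3 * y2" "x3 * y1 - x1 * y3" "x1 * y2 - x2 * y1"])
       (use False in \<open>auto simp: algebra_simps\<close>)
next
  case True
  show ?thesis
  proof (cases "x1 = 0 \<and> y1 = 0")
    case True
    then show ?thesis by (intro that[of 1 0 0]) auto
  next
    case False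
    then consider "x1 \<noteq> 0" | "y1 \<noteq> 0" by blast
    then show ?thesis
    proof cases
      case 1
      then show ?thesis using True by (intro that[of "- x2" x1 0]) (auto simp: algebra_simps)
    next
      case 2
      then show ?thesis using True by (intro that[of "- y2" y1 0]) (auto simp: algebra_simps)
    qed
  qed
qed

text \<open>The convolution sees only invariant divisors of the monomial, here 1 and the monomial
  itself; each of these two terms contains a vanishing constant coefficient.\<close>

lemma coef_mult_irreducible:
  assumes "p \<in> inv_ring a c" "r \<in> inv_ring a c" "coef p 0 0 = 0" "coef r 0 0 = 0"
    and irr: "\<And>k l. k \<le> i \<Longrightarrow> l \<le> j \<Longrightarrow> a dvd k + c * l \<Longrightarrow> (k = 0 \<and> l = 0) \<or> (k = i \<and> l = j)"
  shows "coef (p * r) i j = 0"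
  unfolding coef_times ps2_mult_def
proof (intro sum.neutral ballI)
  fix k l assume kl: "k \<in> {..i}" "l \<in> {..j}"
  show "coef p k l * coef r (i - k) (j - l) = 0"
  proof (cases "a dvd k + c * l")
    case True
    then show ?thesis using irr[of k l] kl assms(3,4) by auto
  next
    case False
    then show ?thesis using assms(1) by (auto simp: inv_ring_def)
  qed
qed

text \<open>Embedding dimension: if a does not divide c, the irreducible invariant monomials x^a,
  x^i y and y^b are independent modulo the square of the maximal ideal, while the cotangent space of
  C{x,y} has dimension two.\<close>

lemma inv_ring_not_smooth:
  assumes iso: "cps_iso (inv_ring a c) UNIV" and a: "0 < a"
  shows "a dvd c"
proof (rule ccontr)
  assume nd: "\<not> a dvd c"
  let ?A = "inv_ring a c"
  obtain f where f: "cps_hom ?A f" "bij_betw f ?A UNIV" using iso by (auto simp: cps_iso_def)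
  have fA: "f x = f y \<Longrightarrow> x = y" if "x \<in> ?A" "y \<in> ?A" for x y
    using f(2) that by (auto simp: bij_betw_def inj_on_def)
  \<comment> \<open>The least exponent making x^i y invariant; it is positive because a does not
    divide c. Below, y^b is the least invariant power of y.\<close>
  define i where "i = a - c mod a"
  have i: "0 < i" "i < a" "a dvd i + c * 1"
  proof -
    have "0 < c mod a" using nd by (simp add: dvd_eq_mod_eq_0)
    moreover have "c mod a < a" using a by simp
    ultimately show "0 < i" "i < a" unfolding i_def by auto
    have "i + c = a + a * (c div a)" using \<open>c mod a < a\<close> mult_div_mod_eq[of a c] unfolding i_def by linarith
    then show "a dvd i + c * 1" by simp
  qed
  define b where "b = (LEAST b. 0 < b \<and> a dvd c * b)"
  have b: "0 < b" "a dvd c * b"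
    using LeastI[of "\<lambda>b. 0 < b \<and> a dvd c * b" a] a unfolding b_def by auto
  have bmin: "l = 0 \<or> l = b" if "l \<le> b" "a dvd c * l" for l
    using Least_le[of "\<lambda>b. 0 < b \<and> a dvd c * b" l] that unfolding b_def by (cases "l = 0") auto
  have b1: "b \<noteq> 1" using b(2) nd by auto
  define e1 e2 e3 where "e1 = monom2 1 a 0" and "e2 = monom2 1 i 1" and "e3 = monom2 1 0 b"
  have eA: "e1 \<in> ?A" "e2 \<in> ?A" "e3 \<in> ?A"
    unfolding e1_def e2_def e3_def using i(3) b(2) by (auto intro!: monom2_in_inv_ring)
  have e0: "coef e1 0 0 = 0" "coef e2 0 0 = 0" "coef e3 0 0 = 0"
    using a i b by (simp_all add: e1_def e2_def e3_def)
  \<comment> \<open>Three linear parts lie in a plane, so some combination \<open>h\<close> has an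
    image without linear part. This image is in the square of the maximal ideal, and pulling back
    its factors puts \<open>h\<close> in the square of the maximal ideal of
    \<open>?A\<close>.\<close>
  obtain u v w where uvw: "u * coef (f e1) 1 0 + v * coef (f e2) 1 0 + w * coef (f e3) 1 0 = 0"
    "u * coef (f e1) 0 1 + v * coef (f e2) 0 1 + w * coef (f e3) 0 1 = 0" "u \<noteq> 0 \<or> v \<noteq> 0 \<or> w \<noteq> 0"
    by (rule linear_dependence_three, rule that)
  define h where "h = cst u * e1 + cst v * e2 + cst w * e3"
  have hA: "h \<in> ?A" unfolding h_def by (intro inv_ring_closed(1) cst_mult_in_inv_ring eA)
  have fh: "f h = cst u * f e1 + cst v * f e2 + cst w * f e3"
    unfolding h_def using eA by (simp add: hom_add[OF f(1)] hom_cst_mult[OF f(1)] inv_ring_closed cst_mult_in_inv_ring)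
  have "coef (f h) 0 0 = 0" "coef (f h) 1 0 = 0" "coef (f h) 0 1 = 0"
    using uvw hom_local[OF f(1) _ _ a] eA e0 by (simp_all add: fh)
  moreover obtain s1 s2 where "f h = (\<Sum>(i, j)\<in>{..<1 * 1} \<times> {..<1 * 1}. monom2 (coef (f h) i j) i j) + monom2 1 (1 * 1) 0 * s1 + monom2 1 0 (1 * 1) * s2"
    using inv_ring_split[of "f h" 1 1 1] by auto
  ultimately have s: "f h = xvar * s1 + yvar * s2" "coef s1 0 0 = 0" "coef s2 0 0 = 0"
  proof -
    assume *: "coef (f h) 0 0 = 0" "coef (f h) 1 0 = 0" "coef (f h) 0 1 = 0"
      "f h = (\<Sum>(i, j)\<in>{..<1 * 1} \<times> {..<1 * 1}. monom2 (coef (f h) i j) i j) + monom2 1 (1 * 1) 0 * s1 + monom2 1 0 (1 * 1) * s2"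
    have "{..<1 * 1} \<times> {..<1 * 1} = {(0 :: nat, 0 :: nat)}" by auto
    then have "f h = monom2 0 0 0 + xvar * s1 + yvar * s2" using * by simp
    then show eq: "f h = xvar * s1 + yvar * s2" by (simp add: cst_0)
    show "coef s1 0 0 = 0" using *(2) unfolding eq by (simp add: coef_monom2_mult)
    show "coef s2 0 0 = 0" using *(3) unfolding eq by (simp add: coef_monom2_mult)
  qed
  have fg: "\<exists>p\<in>?A. f p = t \<and> coef p 0 0 = 0" if "coef t 0 0 = 0" for t
  proof -
    obtain p where p: "p \<in> ?A" "f p = t" using f(2) by (metis UNIV_I bij_betw_iff_bijections)
    have "coef p 0 0 = 0"
    proof (rule ccontr)
      assume "coef p 0 0 \<noteq> 0"
      then obtain p' where "p' \<in> ?A" "p * p' = 1" using inv_ring_unit[OF p(1) _ a] by blast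
      then have "t * f p' = 1" using hom_mult[OF f(1) p(1)] hom_1[OF f(1)] p(2) by metis
      then show False using that by (metis coef_1 coef_mult_0_0 mult_zero_left zero_neq_one)
    qed
    then show ?thesis using p by blast
  qed
  have x0: "coef xvar 0 0 = 0" "coef yvar 0 0 = 0" by simp_all
  obtain p1 where p1: "p1 \<in> ?A" "f p1 = xvar" "coef p1 0 0 = 0" using fg[OF x0(1)] by blast
  obtain p2 where p2: "p2 \<in> ?A" "f p2 = yvar" "coef p2 0 0 = 0" using fg[OF x0(2)] by blast
  obtain r1 where r1: "r1 \<in> ?A" "f r1 = s1" "coef r1 0 0 = 0" using fg[OF s(2)] by blast
  obtain r2 where r2: "r2 \<in> ?A" "f r2 = s2" "coef r2 0 0 = 0" using fg[OF s(3)] by blast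
  have "f (p1 * r1 + p2 * r2) = f h"
    unfolding s(1) using p1 p2 r1 r2 by (simp add: hom_add[OF f(1)] hom_mult[OF f(1)] inv_ring_closed)
  then have hh: "h = p1 * r1 + p2 * r2"
    using fA hA p1 p2 r1 r2 inv_ring_closed by metis
  have irr1: "(k = 0 \<and> l = 0) \<or> (k = a \<and> l = 0)" if "k \<le> a" "l \<le> 0" "a dvd k + c * l" for k l
    using that by (auto dest: dvd_imp_le)
  have irr2: "(k = 0 \<and> l = 0) \<or> (k = i \<and> l = 1)" if "k \<le> i" "l \<le> 1" "a dvd k + c * l" for k l
  proof (cases "l = 0")
    case True
    then show ?thesis using that i by (auto dest: dvd_imp_le)
  next
    case False
    then have l: "l = 1" using that by auto
    have "a dvd (i + c * 1) - (k + c * l)" using that(3) i(3) by (rule dvd_diff_nat[rotated])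
    then have "a dvd i - k" using l by simp
    then have "i - k = 0" using i by (metis dvd_imp_le diff_le_self le_less_trans not_gr0 not_le)
    then show ?thesis using l that(1) by simp
  qed
  have irr3: "(k = 0 \<and> l = 0) \<or> (k = 0 \<and> l = b)" if "k \<le> 0" "l \<le> b" "a dvd k + c * l" for k l
    using that bmin by auto
  have "coef h a 0 = 0"
    using coef_mult_irreducible[OF p1(1) r1(1) p1(3) r1(3) irr1] coef_mult_irreducible[OF p2(1) r2(1) p2(3) r2(3) irr1]
    by (simp add: hh)
  moreover have "coef h i 1 = 0"
    using coef_mult_irreducible[OF p1(1) r1(1) p1(3) r1(3) irr2] coef_mult_irreducible[OF p2(1) r2(1) p2(3) r2(3) irr2]
    by (simp add: hh)
  moreover have "coef h 0 b = 0"
    using coef_mult_irreducible[OF p1(1) r1(1) p1(3) r1(3) irr3] coef_mult_irreducible[OF p2(1) r2(1) p2(3) r2(3) irr3]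
    by (simp add: hh)
  ultimately show False
    using uvw(3) i a b b1 by (auto simp: h_def e1_def e2_def e3_def coef_monom2)
qed

section \<open>Coordinate changes\<close>

lemma subst_hom: "coef X 0 0 = 0 \<Longrightarrow> coef Y 0 0 = 0 \<Longrightarrow> cps_hom A (\<lambda>s. subst s X Y)"
  by (simp add: cps_hom_def subst_add subst_mult subst_1 subst_monom2)

lemma subst_scale:
  assumes "coef X 0 0 = 0" "coef Y 0 0 = 0"
  shows "subst (scale \<alpha> \<beta> s) X Y = subst s (cst \<alpha> * X) (cst \<beta> * Y)"
proof -
  have "subst (scale \<alpha> \<beta> s) X Y = subst s (subst (monom2 \<alpha> 1 0) X Y) (subst (monom2 \<beta> 0 1) X Y)"
    by (rule subst_subst) (use assms in auto)
  then show ?thesis by (simp add: subst_monom2[OF assms])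
qed

lemma scale_subst:
  assumes "coef X 0 0 = 0" "coef Y 0 0 = 0"
  shows "scale \<alpha> \<beta> (subst s X Y) = subst s (scale \<alpha> \<beta> X) (scale \<alpha> \<beta> Y)"
  by (rule subst_subst) (use assms in auto)

text \<open>Series that are eigenvectors with characters \<omega> and \<omega>^p turn the action of
  one cyclic group into that of another. The orders m and n agree for coordinate changes; for the
  symmetric functions n is a divisor of m.\<close>

lemma subst_in_inv_ring_iff:
  assumes XY: "coef \<xi> 0 0 = 0" "coef \<eta> 0 0 = 0"
    and inj: "\<And>s t. subst s \<xi> \<eta> = subst t \<xi> \<eta> \<Longrightarrow> s = t"
    and \<zeta>: "\<And>k. \<zeta> ^ k = 1 \<longleftrightarrow> m dvd k" and \<omega>: "\<And>k. \<omega> ^ k = 1 \<longleftrightarrow> n dvd k"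
    and sc: "scale \<zeta> (\<zeta> ^ q) \<xi> = cst \<omega> * \<xi>" "scale \<zeta> (\<zeta> ^ q) \<eta> = cst (\<omega> ^ p) * \<eta>"
  shows "subst s \<xi> \<eta> \<in> inv_ring m q \<longleftrightarrow> s \<in> inv_ring n p"
proof -
  have "scale \<zeta> (\<zeta> ^ q) (subst s \<xi> \<eta>) = subst (scale \<omega> (\<omega> ^ p) s) \<xi> \<eta>"
    by (simp only: scale_subst[OF XY] sc subst_scale[OF XY])
  then show ?thesis
    unfolding inv_ring_iff_scale[OF \<zeta>] inv_ring_iff_scale[OF \<omega>] using inj by metis
qed

text \<open>A coordinate change compatible with \<mu>_m preserves the invariant ring and conjugates
  \<open>t\<close>. The transported ring is written without the inverse coordinates, so only the
  images of \<xi> and \<eta> under the lift have to be known.\<close>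

lemma fixed_ring_in_coordinates:
  assumes XY: "coef X 0 0 = 0" "coef Y 0 0 = 0" and t: "\<And>a. a \<in> inv_ring m q \<Longrightarrow> t a = subst a X Y"
    and \<xi>\<eta>: "coef \<xi> 0 0 = 0" "coef \<eta> 0 0 = 0" "coef \<xi> 1 0 * coef \<eta> 0 1 - coef \<xi> 0 1 * coef \<eta> 1 0 \<noteq> 0"
    and \<zeta>: "\<And>k. \<zeta> ^ k = 1 \<longleftrightarrow> m dvd k"
    and sc: "scale \<zeta> (\<zeta> ^ q) \<xi> = cst \<zeta> * \<xi>" "scale \<zeta> (\<zeta> ^ q) \<eta> = cst (\<zeta> ^ q) * \<eta>"
  shows "cps_iso {a \<in> inv_ring m q. t a = a}
     {s \<in> inv_ring m q. subst s (subst \<xi> X Y) (subst \<eta> X Y) = subst s \<xi> \<eta>}" (is "cps_iso ?F ?G")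
proof -
  obtain P Q where PQ: "coef P 0 0 = 0" "coef Q 0 0 = 0" "subst \<xi> P Q = xvar" "subst \<eta> P Q = yvar"
    "subst P \<xi> \<eta> = xvar" "subst Q \<xi> \<eta> = yvar"
    by (rule local_inverse_exists[OF \<xi>\<eta>], rule that)
  have inv1: "subst (subst s \<xi> \<eta>) P Q = s" for s
    unfolding subst_subst[OF \<xi>\<eta>(1,2) PQ(1,2)] PQ(3,4) by (rule subst_xvar_yvar)
  have inv2: "subst (subst s P Q) \<xi> \<eta> = s" for s
    unfolding subst_subst[OF PQ(1,2) \<xi>\<eta>(1,2)] PQ(5,6) by (rule subst_xvar_yvar)
  have inA: "subst s \<xi> \<eta> \<in> inv_ring m q \<longleftrightarrow> s \<in> inv_ring m q" for s
    by (rule subst_in_inv_ring_iff[OF \<xi>\<eta>(1,2) _ \<zeta> \<zeta> sc]) (metis inv1)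
  have "bij_betw (\<lambda>s. subst s P Q) ?F ?G"
  proof (rule bij_betw_byWitness[where f' = "\<lambda>s. subst s \<xi> \<eta>"])
    show "(\<lambda>s. subst s P Q) ` ?F \<subseteq> ?G"
    proof (clarify, intro conjI)
      fix a assume a: "a \<in> inv_ring m q" "t a = a"
      show "subst a P Q \<in> inv_ring m q" using inA[of "subst a P Q"] a(1) by (simp add: inv2)
      have "subst (subst a P Q) (subst \<xi> X Y) (subst \<eta> X Y) = subst (subst (subst a P Q) \<xi> \<eta>) X Y"
        by (rule subst_subst[OF \<xi>\<eta>(1,2) XY, symmetric])
      then show "subst (subst a P Q) (subst \<xi> X Y) (subst \<eta> X Y) = subst (subst a P Q) \<xi> \<eta>"
        using a t by (simp add: inv2)
    qed
    show "(\<lambda>s. subst s \<xi> \<eta>) ` ?G \<subseteq> ?F"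
    proof (clarify, intro conjI)
      fix s assume s: "s \<in> inv_ring m q" "subst s (subst \<xi> X Y) (subst \<eta> X Y) = subst s \<xi> \<eta>"
      show sA: "subst s \<xi> \<eta> \<in> inv_ring m q" using inA s(1) by simp
      show "t (subst s \<xi> \<eta>) = subst s \<xi> \<eta>"
        unfolding t[OF sA] subst_subst[OF \<xi>\<eta>(1,2) XY] by (rule s(2))
    qed
  qed (simp_all add: inv1 inv2)
  then show ?thesis using subst_hom[OF PQ(1,2)] unfolding cps_iso_def by blast
qed

section \<open>Series even in one variable\<close>

lemma coef_subst_y_square:
  "coef (subst b xvar (monom2 1 0 2)) i j = (if even j then coef b i (j div 2) else 0)"
proof -
  define c where "c = (\<lambda>i j. if even j then coef b i (j div 2) else 0)"
  obtain r M where r: "r > 0" "\<And>i j. norm (coef b i j) * r ^ (i + j) \<le> M"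
    using convergent_coef[of b] convergent_ps2_iff_bounded by blast
  define \<rho> where "\<rho> = min r 1"
  have \<rho>: "0 < \<rho>" "\<rho> \<le> r" "\<rho> \<le> 1" using r by (auto simp: \<rho>_def)
  have M: "M \<ge> 0" using order_trans[OF _ r(2)[of 0 0]] by simp
  have "norm (c i j) * \<rho> ^ (i + j) \<le> M" for i j
  proof (cases "even j")
    case True
    then obtain l where l: "j = 2 * l" by auto
    have "\<rho> ^ (i + j) \<le> \<rho> ^ (i + l)" using \<rho> by (intro power_decreasing) (auto simp: l)
    also have "\<dots> \<le> r ^ (i + l)" using \<rho> by (intro power_mono) auto
    finally have "norm (coef b i l) * \<rho> ^ (i + j) \<le> norm (coef b i l) * r ^ (i + l)" by (intro mult_left_mono) auto
    then show ?thesis using r(2)[of i l] by (simp add: c_def l)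
  qed (use M in \<open>auto simp: c_def\<close>)
  then have c: "convergent_ps2 c" using \<rho>(1) convergent_ps2_iff_bounded by blast
  have eval: "ps2_eval c (x, y) = ps2_eval (coef b) (x, y ^ 2)" for x y
  proof -
    define h where "h = (\<lambda>p :: nat \<times> nat. (fst p, 2 * snd p))"
    have inj: "inj h" by (auto simp: h_def inj_on_def prod_eq_iff)
    have "ps2_eval c (x, y) = (\<Sum>\<^sub>\<infinity>p\<in>range h. c (fst p) (snd p) * x ^ fst p * y ^ snd p)"
      unfolding ps2_eval_def case_prod_unfold fst_conv snd_conv
    proof (rule infsum_cong_neutral)
      fix p :: "nat \<times> nat" assume p: "p \<in> UNIV - range h"
      have "odd (snd p)"
      proof
        assume "even (snd p)"
        then obtain l where "snd p = 2 * l" by auto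
        then have "p = h (fst p, l)" by (simp add: h_def prod_eq_iff)
        then show False using p by blast
      qed
      then show "c (fst p) (snd p) * x ^ fst p * y ^ snd p = 0" by (simp add: c_def)
    qed auto
    also have "\<dots> = (\<Sum>\<^sub>\<infinity>p. c (fst (h p)) (snd (h p)) * x ^ fst (h p) * y ^ snd (h p))"
      using infsum_reindex[OF inj, of "\<lambda>p. c (fst p) (snd p) * x ^ fst p * y ^ snd p"] by (simp add: comp_def)
    also have "\<dots> = ps2_eval (coef b) (x, y ^ 2)"
      unfolding ps2_eval_def by (simp add: h_def case_prod_unfold c_def power_mult)
    finally show ?thesis .
  qed
  have y0: "coef xvar 0 0 = 0" "coef (monom2 1 0 2) 0 0 = 0" by simp_all
  have "subst b xvar (monom2 1 0 2) = Cps c"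
  proof (rule ev_eqI, use ev_subst[OF y0, of b] in eventually_elim)
    case (elim z)
    have "ev (Cps c) z = ev b (fst z, snd z ^ 2)"
      unfolding ev_def coef_Cps[OF c] using eval[of "fst z" "snd z"] by simp
    with elim show ?case by (simp add: ev_monom2)
  qed
  then have "coef (subst b xvar (monom2 1 0 2)) i j = c i j" using coef_Cps[OF c] by simp
  then show ?thesis by (simp add: c_def)
qed

text \<open>Replacing y by y^2 identifies all series with those even in y and doubles the weight of
  y.\<close>

lemma even_part_iso:
  "cps_iso {s \<in> inv_ring m q. \<forall>i j. coef s i j \<noteq> 0 \<longrightarrow> even j} (inv_ring m (2 * q))" (is "cps_iso ?E ?B")
proof -
  have y0: "coef xvar 0 0 = 0" "coef (monom2 1 0 2) 0 0 = 0" by simp_all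
  let ?g = "\<lambda>b. subst b xvar (monom2 1 0 2)"
  have "bij_betw ?g ?B ?E"
    unfolding bij_betw_def
  proof
    show "inj_on ?g ?B"
    proof (rule inj_onI)
      fix a b assume e: "?g a = ?g b"
      have "coef a i j = coef b i j" for i j
        using arg_cong[OF e, of "\<lambda>s. coef s i (2 * j)"] unfolding coef_subst_y_square by simp
      then show "a = b" by (rule cps_eqI)
    qed
    show "?g ` ?B = ?E"
    proof
      show "?g ` ?B \<subseteq> ?E"
      proof
        fix s assume "s \<in> ?g ` ?B"
        then obtain b where b: "b \<in> ?B" "s = ?g b" by blast
        have cs: "coef s i j = (if even j then coef b i (j div 2) else 0)" for i j
          unfolding b(2) by (rule coef_subst_y_square)
        have "m dvd i + q * j \<and> even j" if "coef s i j \<noteq> 0" for i j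
        proof -
          have j: "even j" "coef b i (j div 2) \<noteq> 0" using that unfolding cs by (auto split: if_splits)
          then have "m dvd i + 2 * q * (j div 2)" using b(1) unfolding inv_ring_def by blast
          then show ?thesis using j(1) by (metis dvd_mult_div_cancel mult.assoc mult.commute)
        qed
        then show "s \<in> ?E" by (auto simp: inv_ring_def)
      qed
      show "?E \<subseteq> ?g ` ?B"
      proof
        fix s assume s: "s \<in> ?E"
        define a where "a = (\<lambda>i j. coef s i (2 * j))"
        obtain r M where r: "r > 0" "\<And>i j. norm (coef s i j) * r ^ (i + j) \<le> M"
          using convergent_coef[of s] convergent_ps2_iff_bounded by blast
        \<comment> \<open>Here y^2 becomes the variable, so its radius is
          \<open>r ^ 2\<close>.\<close>
        define \<rho> where "\<rho> = min r (r ^ 2)"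
        have \<rho>: "0 < \<rho>" "\<rho> \<le> r" "\<rho> \<le> r ^ 2" using r by (auto simp: \<rho>_def)
        have "norm (a i j) * \<rho> ^ (i + j) \<le> M" for i j
        proof -
          have "\<rho> ^ i * \<rho> ^ j \<le> r ^ i * (r ^ 2) ^ j" using \<rho> r by (intro mult_mono power_mono) auto
          then have "\<rho> ^ (i + j) \<le> r ^ (i + 2 * j)" by (simp add: power_add power_mult)
          then have "norm (a i j) * \<rho> ^ (i + j) \<le> norm (a i j) * r ^ (i + 2 * j)" by (intro mult_left_mono) auto
          then show ?thesis using r(2)[of i "2 * j"] by (simp add: a_def)
        qed
        then have a: "convergent_ps2 a" using \<rho>(1) convergent_ps2_iff_bounded by blast
        have ca: "coef (Cps a) i j = coef s i (2 * j)" for i j using coef_Cps[OF a] by (simp add: a_def)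
        have "?g (Cps a) = s"
        proof (rule cps_eqI)
          fix i j
          show "coef (?g (Cps a)) i j = coef s i j" using s unfolding coef_subst_y_square ca by auto
        qed
        moreover have "Cps a \<in> ?B"
        proof -
          have "m dvd i + 2 * q * j" if "coef s i (2 * j) \<noteq> 0" for i j
          proof -
            have "m dvd i + q * (2 * j)" using s that unfolding inv_ring_def by blast
            then show ?thesis by (simp add: mult.left_commute mult.assoc)
          qed
          then show ?thesis by (simp add: inv_ring_def ca)
        qed
        ultimately show "s \<in> ?g ` ?B" by (metis image_eqI)
      qed
    qed
  qed
  then have "cps_iso ?B ?E" using subst_hom[OF y0] unfolding cps_iso_def by blast
  then obtain f where "cps_hom ?E f" "bij_betw f ?E ?B"
    by (rule cps_iso_sym) (auto intro: inv_ring_closed cst_mult_in_inv_ring that)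
  then show ?thesis unfolding cps_iso_def by blast
qed

section \<open>Symmetric invariants\<close>

lemma complex_nth_root_exists:
  assumes "0 < n"
  obtains w :: complex where "w ^ n = z"
proof (cases "z = 0")
  case True
  then show ?thesis using that[of 0] assms by (simp add: zero_power)
next
  case False
  have "exp (Ln z / of_nat n) ^ n = z"
    using False assms by (simp flip: exp_of_nat_mult)
  then show ?thesis by (rule that)
qed

text \<open>x^d and y^d are the roots of T^2 - v T + u^d. For small v and u both roots are below
  \<open>r ^ d\<close> in modulus, so x and y are small as well.\<close>

lemma solve_symmetric:
  assumes d: "0 < d" and r: "0 < r" "r \<le> 1"
    and vu: "norm v < (r ^ d) ^ 2 / 4" "norm u < (r ^ d) ^ 2 / 4"
  obtains x y :: complex where "norm x < r" "norm y < r" "x ^ d + y ^ d = v" "x * y = u"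
proof -
  note solution = that
  define \<rho> where "\<rho> = r ^ d"
  have \<rho>: "0 < \<rho>" "\<rho> \<le> 1" using r by (auto simp: \<rho>_def power_le_one)
  define T1 T2 where "T1 = (v + csqrt (v ^ 2 - 4 * u ^ d)) / 2" and "T2 = (v - csqrt (v ^ 2 - 4 * u ^ d)) / 2"
  have T: "T1 + T2 = v" by (simp add: T1_def T2_def field_simps)
  have "T1 * T2 = (v ^ 2 - csqrt (v ^ 2 - 4 * u ^ d) ^ 2) / 4"
    unfolding T1_def T2_def by (simp add: power2_eq_square field_simps)
  then have P: "T1 * T2 = u ^ d" by simp
  have "\<rho> ^ 2 \<le> 1" using \<rho> by (simp add: power_le_one)
  then have u1: "norm u \<le> 1" using vu(2) by (simp add: \<rho>_def)
  have ud: "norm (u ^ d) < \<rho> ^ 2 / 4"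
  proof -
    have "norm u ^ d \<le> norm u ^ 1" using u1 d by (intro power_decreasing) auto
    then show ?thesis using vu(2) by (simp add: norm_power \<rho>_def)
  qed
  have small: "norm T < \<rho>" if "T * T = v * T - u ^ d" for T
  proof (rule ccontr)
    assume "\<not> norm T < \<rho>"
    then have nT: "\<rho> \<le> norm T" "0 < norm T" using \<rho> by auto
    have "norm T * norm T \<le> norm v * norm T + norm (u ^ d)"
      using arg_cong[OF that, of norm] norm_triangle_ineq4[of "v * T" "u ^ d"] by (simp add: norm_mult)
    also have "\<dots> \<le> \<rho> ^ 2 / 4 * norm T + \<rho> ^ 2 / 4"
      using vu(1) ud by (intro add_mono mult_right_mono) (auto simp: \<rho>_def)
    also have "\<dots> \<le> \<rho> / 4 * norm T + \<rho> / 4 * norm T"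
    proof (intro add_mono)
      have "\<rho> ^ 2 \<le> \<rho>" using \<rho> by (simp add: power2_eq_square mult_left_le)
      then show "\<rho> ^ 2 / 4 * norm T \<le> \<rho> / 4 * norm T" by (intro mult_right_mono) auto
      have "\<rho> * \<rho> \<le> \<rho> * norm T" using \<rho> nT by (intro mult_left_mono) auto
      then show "\<rho> ^ 2 / 4 \<le> \<rho> / 4 * norm T" by (simp add: power2_eq_square)
    qed
    also have "\<dots> = (\<rho> / 2) * norm T" by simp
    finally have "norm T \<le> \<rho> / 2" using nT(2) by simp
    then show False using nT(1) \<rho>(1) by simp
  qed
  have s1: "norm T1 < \<rho>" by (rule small) (simp flip: T P add: algebra_simps)
  have s2: "norm T2 < \<rho>" by (rule small) (simp flip: T P add: algebra_simps)
  have root_small: "norm w < r" if "norm (w ^ d) < \<rho>" for w :: complex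
    using that r(1) unfolding norm_power \<rho>_def by (metis norm_ge_zero power_less_imp_less_base less_imp_le)
  \<comment> \<open>Only a nonzero root \<open>T\<close> is turned into \<open>x\<close>; setting y
    = u / x makes x y = u hold exactly, and y^d is then the other root. Independent d-th roots would
    give x y = u only up to a root of unity.\<close>
  have main: thesis if T12: "T + T' = v" "T * T' = u ^ d" "norm T < \<rho>" "norm T' < \<rho>" "T \<noteq> 0" for T T'
  proof -
    obtain x where x: "x ^ d = T" using complex_nth_root_exists[OF d] by blast
    then have x0: "x \<noteq> 0" using T12(5) d by (auto simp: zero_power)
    define y where "y = u / x"
    have y: "y ^ d = T'" using T12 x by (simp add: y_def power_divide field_simps)
    show thesis
      by (rule solution[of x y]) (use x y T12 x0 root_small[of x] root_small[of y] in \<open>auto simp: y_def\<close>)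
  qed
  show thesis
  proof (cases "T1 = 0 \<and> T2 = 0")
    case True
    then have "v = 0" "u = 0" using T P d by auto
    then show thesis using that[of 0 0] r d by (simp add: zero_power)
  next
    case False
    then show thesis using main[of T1 T2] main[of T2 T1] T P s1 s2 by (auto simp: add.commute mult.commute)
  qed
qed

abbreviation sym_sum :: "nat \<Rightarrow> cps" where "sym_sum d \<equiv> monom2 1 d 0 + monom2 1 0 d"
abbreviation sym_prod :: cps where "sym_prod \<equiv> monom2 1 1 1"

text \<open>By \<open>solve_symmetric\<close> the map (x^d + y^d, x y) sends each neighbourhood of
  the origin onto a set containing a neighbourhood of the origin.\<close>

lemma subst_symmetric_inj:
  assumes d: "0 < d" and eq: "subst b (sym_sum d) sym_prod = subst b' (sym_sum d) sym_prod"
  shows "b = b'"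
proof -
  have 0: "coef (sym_sum d) 0 0 = 0" "coef sym_prod 0 0 = 0" using d by auto
  have "\<forall>\<^sub>0z. ev b (fst z ^ d + snd z ^ d, fst z * snd z) = ev b' (fst z ^ d + snd z ^ d, fst z * snd z)"
    using ev_subst[OF 0, of b] ev_subst[OF 0, of b'] ev_add[of "monom2 1 d 0" "monom2 1 0 d"]
    by eventually_elim (simp add: eq[unfolded One_nat_def] ev_monom2)
  then obtain r0 where r0: "r0 > 0" "\<And>z. z \<in> polydisc r0 \<Longrightarrow>
      ev b (fst z ^ d + snd z ^ d, fst z * snd z) = ev b' (fst z ^ d + snd z ^ d, fst z * snd z)"
    unfolding eventually_nhds_polydisc by blast
  define r where "r = min r0 1"
  have r: "0 < r" "r \<le> 1" "r \<le> r0" using r0 by (auto simp: r_def)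
  have "ev b (v, u) = ev b' (v, u)" if vu: "norm v < (r ^ d) ^ 2 / 4" "norm u < (r ^ d) ^ 2 / 4" for v u
  proof -
    obtain x y where "norm x < r" "norm y < r" "x ^ d + y ^ d = v" "x * y = u"
      by (rule solve_symmetric[OF d r(1,2) vu], rule that)
    then show ?thesis using r0(2)[of "(x, y)"] r(3) by simp
  qed
  then have "\<forall>\<^sub>0z. ev b z = ev b' z"
    unfolding eventually_nhds_polydisc using r by (intro exI[of _ "(r ^ d) ^ 2 / 4"]) auto
  then show ?thesis by (rule ev_eqI)
qed

text \<open>Lucas (Dickson) polynomials: the power sums a^k + b^k in terms of the elementary
  symmetric functions v = a + b and w = a b.\<close>

fun lucas :: "nat \<Rightarrow> complex \<Rightarrow> complex \<Rightarrow> complex" where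
  "lucas 0 v w = 2"
| "lucas (Suc 0) v w = v"
| "lucas (Suc (Suc k)) v w = v * lucas (Suc k) v w - w * lucas k v w"

lemma lucas_power_sum: "lucas k (a + b) (a * b) = a ^ k + b ^ k"
  by (induction k "a + b" "a * b" rule: lucas.induct) (auto simp: algebra_simps)

text \<open>The two bounds are balanced: each term of the recursion contributes at most \<rho>^(k +
  2).\<close>

lemma norm_lucas_le:
  assumes "norm v \<le> \<rho> / 2" "norm w \<le> \<rho> ^ 2 / 2" "0 \<le> \<rho>"
  shows "norm (lucas k v w) \<le> 2 * \<rho> ^ k"
  using assms
proof (induction k v w rule: lucas.induct)
  case (3 k v w)
  have "norm (lucas (Suc (Suc k)) v w) \<le> norm v * norm (lucas (Suc k) v w) + norm w * norm (lucas k v w)"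
    using norm_triangle_ineq4[of "v * lucas (Suc k) v w" "w * lucas k v w"] by (simp add: norm_mult)
  also have "\<dots> \<le> \<rho> / 2 * (2 * \<rho> ^ Suc k) + \<rho> ^ 2 / 2 * (2 * \<rho> ^ k)"
    using 3 by (intro add_mono mult_mono) auto
  also have "\<dots> = 2 * \<rho> ^ Suc (Suc k)" by (simp add: power2_eq_square)
  finally show ?case .
qed auto

lemma lucas_holomorphic2_on: "(\<lambda>z. lucas k (fst z) (snd z ^ d)) holomorphic2_on U"
proof (induction k rule: induct_nat_012)
  case (ge2 n)
  then show ?case by (auto intro!: holomorphic2_on_diff holomorphic2_on_mult holomorphic2_on_power)
qed auto

text \<open>Mirror monomials are paired: x^(j + d k) y^j + x^j y^(j + d k) is u^j times the Lucas
  polynomial of index k in v and u^d, where v = x^d + y^d and u = x y. The sum of these functions of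
  (v, u) converges uniformly near the origin, so it is holomorphic there and has an expansion
  \<open>b\<close>.\<close>

lemma symmetric_imp_subst:
  assumes d: "0 < d" and sym: "\<And>i j. coef s i j = coef s j i"
    and sup: "\<And>i j. coef s i j \<noteq> 0 \<Longrightarrow> [i = j] (mod d)"
  obtains b where "s = subst b (sym_sum d) sym_prod"
proof -
  obtain r0 M where r0: "r0 > 0" "\<And>i j. norm (coef s i j) * r0 ^ (i + j) \<le> M"
    using convergent_coef[of s] convergent_ps2_iff_bounded by blast
  obtain r5 where r5: "r5 > 0" "ps2_abs_conv (coef s) r5"
    using convergent_coef[of s] unfolding convergent_ps2_def by blast
  have M: "M \<ge> 0" using order_trans[OF _ r0(2)[of 0 0]] by simp
  define \<rho> where "\<rho> = r0 ^ d / 2"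
  have \<rho>: "0 < \<rho>" using r0 by (simp add: \<rho>_def)
  \<comment> \<open>These bounds make |u|^j at most (r0^2 / 2)^j and the Lucas factor at most 2
    \<rho>^k with \<rho> = r0^d / 2; the halves produce the geometric factor (1/2)^(j + k). The
    bound 1 serves |u^d| <= |u|.\<close>
  define \<epsilon> where "\<epsilon> = min (min 1 (r0 ^ 2 / 2)) (min (\<rho> / 2) (\<rho> ^ 2 / 2))"
  have \<epsilon>: "0 < \<epsilon>" "\<epsilon> \<le> 1" "\<epsilon> \<le> r0 ^ 2 / 2" "\<epsilon> \<le> \<rho> / 2" "\<epsilon> \<le> \<rho> ^ 2 / 2"
    using r0 \<rho> by (auto simp: \<epsilon>_def)
  \<comment> \<open>For k = 0 the monomial is its own mirror and counts once, whereas
    \<open>lucas 0\<close> is 2.\<close>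
  define f where "f = (\<lambda>p z. coef s (fst p + d * snd p) (fst p) * snd z ^ fst p *
      (if snd p = 0 then 1 else lucas (snd p) (fst z) (snd z ^ d)))"
  have hol: "(\<lambda>z. \<Sum>\<^sub>\<infinity>p. f p z) holomorphic2_on polydisc \<epsilon>"
  proof (rule holomorphic2_on_infsum[where M = "\<lambda>(i, j). norm (complex_of_real (2 * M)) * (1 / 2) ^ (i + j)"])
    show "f p holomorphic2_on polydisc \<epsilon>" for p
      unfolding f_def by (cases "snd p = 0") (auto intro!: holomorphic2_on_mult holomorphic2_on_power lucas_holomorphic2_on)
    show "(\<lambda>(i, j). norm (complex_of_real (2 * M)) * (1 / 2) ^ (i + j)) summable_on (UNIV :: (nat \<times> nat) set)"
      by (rule ps2_summable_of_bounded[where \<rho> = 1 and M = "2 * M"]) (use M in auto)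
    fix p :: "nat \<times> nat" and z assume z: "z \<in> polydisc \<epsilon>"
    obtain j k where p: "p = (j, k)" by force
    obtain v u where zv: "z = (v, u)" by force
    have vu: "norm v < \<epsilon>" "norm u < \<epsilon>" using z by (auto simp: zv)
    have ud: "norm (u ^ d) \<le> \<rho> ^ 2 / 2"
    proof -
      have "norm u ^ d \<le> norm u ^ 1" using vu \<epsilon> d by (intro power_decreasing) auto
      then show ?thesis using vu \<epsilon> by (simp add: norm_power)
    qed
    have L: "norm (if k = 0 then 1 else lucas k v (u ^ d)) \<le> 2 * \<rho> ^ k"
      using norm_lucas_le[of v \<rho> "u ^ d" k] vu \<epsilon> \<rho> ud by auto
    have "norm u ^ j \<le> (r0 ^ 2 / 2) ^ j" using vu \<epsilon> by (intro power_mono) auto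
    then have "norm (f p z) \<le> norm (coef s (j + d * k) j) * (r0 ^ 2 / 2) ^ j * (2 * \<rho> ^ k)"
      unfolding f_def p zv fst_conv snd_conv norm_mult norm_power using L by (intro mult_mono mult_left_mono) auto
    also have "\<dots> = 2 * (norm (coef s (j + d * k) j) * r0 ^ (j + d * k + j)) * (1 / 2) ^ (j + k)"
      by (simp add: \<rho>_def power_divide power_add power_mult power2_eq_square power_mult_distrib field_simps)
    also have "\<dots> \<le> 2 * M * (1 / 2) ^ (j + k)" using r0(2) by (intro mult_right_mono mult_left_mono) auto
    finally show "norm (f p z) \<le> (case p of (i, j) \<Rightarrow> norm (complex_of_real (2 * M)) * (1 / 2) ^ (i + j))"
      using M by (simp add: p)
  qed auto
  have "(0, 0) \<in> polydisc \<epsilon>" using \<epsilon> by simp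
  then obtain b where b: "\<forall>\<^sub>0z. ev b z = (\<Sum>\<^sub>\<infinity>p. f p z)"
    using holomorphic2_on_imp_ev[OF hol open_polydisc] by blast
  have 0: "coef (sym_sum d) 0 0 = 0" "coef sym_prod 0 0 = 0" using d by auto
  have "(\<Sum>\<^sub>\<infinity>p. f p (x ^ d + y ^ d, x * y)) = ev s (x, y)" if xy: "norm x < r5" "norm y < r5" for x y
  proof -
    define g where "g = (\<lambda>p. coef s (fst p) (snd p) * x ^ fst p * y ^ snd p)"
    have gs: "g summable_on UNIV"
      using has_sum_imp_summable[OF ps2_eval_has_sum[OF r5(2), of x y]] xy by (simp add: g_def case_prod_unfold)
    then have gS: "g summable_on S" for S using summable_on_subset by blast
    define h1 h2 where "h1 = (\<lambda>p :: nat \<times> nat. (fst p + d * snd p, fst p))" and "h2 = (\<lambda>p :: nat \<times> nat. (fst p, fst p + d * snd p))"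
    have inj: "inj h1" "inj_on h2 S" for S using d by (auto simp: h1_def h2_def inj_on_def prod_eq_iff)
    let ?K = "{p :: nat \<times> nat. snd p > 0}"
    have fp: "f p (x ^ d + y ^ d, x * y) = g (h1 p) + (if snd p = 0 then 0 else g (h2 p))" for p
    proof (cases "snd p = 0")
      case True
      then show ?thesis by (simp add: f_def g_def h1_def power_mult_distrib)
    next
      case False
      have "lucas (snd p) (x ^ d + y ^ d) ((x * y) ^ d) = x ^ (d * snd p) + y ^ (d * snd p)"
        using lucas_power_sum[of "snd p" "x ^ d" "y ^ d"] by (simp add: power_mult power_mult_distrib)
      then show ?thesis using False sym[of "fst p + d * snd p" "fst p"]
        by (simp add: f_def g_def h1_def h2_def power_mult_distrib power_add algebra_simps)
    qed
    have S1: "(\<lambda>p. g (h1 p)) summable_on UNIV" "infsum (\<lambda>p. g (h1 p)) UNIV = infsum g (range h1)"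
      using summable_on_reindex[OF inj(1), of g] infsum_reindex[OF inj(1), of g] gS by (simp_all add: comp_def)
    have S2: "(\<lambda>p. g (h2 p)) summable_on ?K" "infsum (\<lambda>p. g (h2 p)) ?K = infsum g (h2 ` ?K)"
      using summable_on_reindex[OF inj(2)[of ?K], of g] infsum_reindex[OF inj(2)[of ?K], of g] gS by (simp_all add: comp_def)
    have S3: "(\<lambda>p. if snd p = 0 then 0 else g (h2 p)) summable_on UNIV"
      "(\<Sum>\<^sub>\<infinity>p. if snd p = 0 then 0 else g (h2 p)) = infsum (\<lambda>p. g (h2 p)) ?K"
    proof -
      have "(\<lambda>p. if snd p = 0 then 0 else g (h2 p)) summable_on UNIV \<longleftrightarrow> (\<lambda>p. g (h2 p)) summable_on ?K"
        by (rule summable_on_cong_neutral) auto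
      then show "(\<lambda>p. if snd p = 0 then 0 else g (h2 p)) summable_on UNIV" using S2(1) by simp
      show "(\<Sum>\<^sub>\<infinity>p. if snd p = 0 then 0 else g (h2 p)) = infsum (\<lambda>p. g (h2 p)) ?K"
        by (rule infsum_cong_neutral) auto
    qed
    have "(\<Sum>\<^sub>\<infinity>p. f p (x ^ d + y ^ d, x * y)) = infsum g (range h1) + infsum g (h2 ` ?K)"
      unfolding fp infsum_add[OF S1(1) S3(1)] S3(2) S1(2) S2(2) ..
    also have "\<dots> = infsum g (range h1 \<union> h2 ` ?K)"
    proof (rule infsum_Un_disjoint[symmetric])
      show "range h1 \<inter> h2 ` ?K = {}" using d by (auto simp: h1_def h2_def)
    qed (rule gS)+
    also have "\<dots> = infsum g UNIV"
    proof (rule infsum_cong_neutral)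
      fix p assume p: "p \<in> UNIV - (range h1 \<union> h2 ` ?K)"
      show "g p = 0"
      proof (rule ccontr)
        assume "g p \<noteq> 0"
        then have c: "[fst p = snd p] (mod d)" using sup[of "fst p" "snd p"] by (auto simp: g_def)
        show False
        proof (cases "snd p \<le> fst p")
          case True
          then obtain k where "fst p = snd p + d * k"
            using c by (metis add.commute cong_altdef_nat dvd_def le_add_diff_inverse)
          then have "p = h1 (snd p, k)" by (simp add: h1_def prod_eq_iff)
          then show False using p by blast
        next
          case False
          then have le: "fst p \<le> snd p" by simp
          then obtain k where k: "snd p = fst p + d * k"
            using cong_sym[OF c] by (metis add.commute cong_altdef_nat dvd_def le_add_diff_inverse)
          then have "p = h2 (fst p, k)" "k > 0" using False by (auto simp: h2_def prod_eq_iff intro: gr0I)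
          then have "p \<in> h2 ` ?K" by (metis (mono_tags) image_eqI mem_Collect_eq snd_conv)
          then show False using p by blast
        qed
      qed
    qed auto
    also have "\<dots> = ev s (x, y)" by (simp add: ev_def ps2_eval_def g_def case_prod_unfold)
    finally show ?thesis .
  qed
  then have id: "\<forall>\<^sub>0z. (\<Sum>\<^sub>\<infinity>p. f p (fst z ^ d + snd z ^ d, fst z * snd z)) = ev s z"
    unfolding eventually_nhds_polydisc using r5(1) by (intro exI[of _ r5]) auto
  have "s = subst b (sym_sum d) sym_prod"
    by (rule ev_eqI, use ev_subst[OF 0, of b] near0_compose[OF b 0] id ev_add[of "monom2 1 d 0" "monom2 1 0 d"] in eventually_elim)
       (simp add: ev_monom2)
  then show ?thesis by (rule that)
qed


text \<open>x^d + y^d and x y are eigenvectors of the generator, with characters \<zeta>^d and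
  \<zeta>^(q + 1); \<zeta>^d has order m / d, and the second character is its power with exponent (q
  + 1) / d.\<close>

lemma symmetric_ring_iso:
  fixes m q :: nat
  defines "d \<equiv> gcd (q + 1) m"
  assumes m: "0 < m" and q: "[q ^ 2 = 1] (mod m)"
  shows "cps_iso {s \<in> inv_ring m q. \<forall>i j. coef s i j = coef s j i} (inv_ring (m div d) ((q + 1) div d))"
    (is "cps_iso ?S ?B")
proof -
  have d: "0 < d" "d dvd m" "d dvd q + 1" using m by (auto simp: d_def)
  obtain \<zeta> :: complex where \<zeta>: "\<And>k. \<zeta> ^ k = 1 \<longleftrightarrow> m dvd k" using primitive_root_exists[OF m] by blast
  let ?V = "sym_sum d" and ?U = sym_prod
  let ?g = "\<lambda>b. subst b ?V ?U"
  have 0: "coef ?V 0 0 = 0" "coef ?U 0 0 = 0" using d by auto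
  \<comment> \<open>x^d and y^d have the same character: m divides (q - 1)(q + 1) and (q - 1) m,
    hence (q - 1) d.\<close>
  have qd: "\<zeta> ^ (q * d) = \<zeta> ^ d"
  proof -
    have "int m dvd (int q) ^ 2 - 1"
      using q by (metis cong_iff_dvd_diff cong_int_iff of_nat_1 of_nat_power)
    then have "int m dvd (int q - 1) * int (q + 1)" by (simp add: power2_eq_square algebra_simps)
    then have "int m dvd gcd ((int q - 1) * int (q + 1)) ((int q - 1) * int m)" by simp
    also have "gcd ((int q - 1) * int (q + 1)) ((int q - 1) * int m) = \<bar>int q - 1\<bar> * int d"
      by (simp add: d_def gcd_mult_left abs_mult del: of_nat_add of_nat_Suc flip: gcd_int_int_eq)
    finally have "int m dvd int (q * d) - int d"
      by (auto simp: abs_if algebra_simps dvd_diff_commute split: if_splits)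
    then have "[q * d = d] (mod m)" by (simp add: cong_iff_dvd_diff flip: cong_int_iff)
    then show ?thesis using primitive_root_power_eq[OF \<zeta> m] by simp
  qed
  have \<omega>: "(\<zeta> ^ d) ^ k = 1 \<longleftrightarrow> m div d dvd k" for k
    using d by (simp add: \<zeta> div_dvd_iff_mult mult.commute flip: power_mult)
  have qp: "(\<zeta> ^ d) ^ ((q + 1) div d) = \<zeta> ^ (q + 1)" using d by (simp flip: power_mult)
  have l: "coef (monom2 \<zeta> 1 0) 0 0 = 0" "coef (monom2 (\<zeta> ^ q) 0 1) 0 0 = 0" by simp_all
  have sc1: "scale \<zeta> (\<zeta> ^ q) ?V = cst (\<zeta> ^ d) * ?V"
    unfolding subst_add[OF l] subst_monom2[OF l] using qd
    by (simp add: cst_1_mult monom2_power distrib_left monom2_mult power_mult)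
  have sc2: "scale \<zeta> (\<zeta> ^ q) ?U = cst ((\<zeta> ^ d) ^ ((q + 1) div d)) * ?U"
    unfolding subst_monom2[OF l] qp by (simp add: cst_1_mult monom2_mult)
  have inA: "?g b \<in> inv_ring m q \<longleftrightarrow> b \<in> ?B" for b
    by (rule subst_in_inv_ring_iff[OF 0 _ \<zeta> \<omega> sc1 sc2]) (rule subst_symmetric_inj[OF d(1)])
  have "bij_betw ?g ?B ?S"
    unfolding bij_betw_def
  proof
    show "inj_on ?g ?B" by (rule inj_onI) (rule subst_symmetric_inj[OF d(1)])
    show "?g ` ?B = ?S"
    proof
      show "?g ` ?B \<subseteq> ?S"
      proof (clarify, intro conjI allI)
        fix b assume b: "b \<in> ?B"
        show "?g b \<in> inv_ring m q" using b inA by simp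
        fix i j
        have v: "coef yvar 0 0 = 0" "coef xvar 0 0 = 0" by simp_all
        have "subst ?V yvar xvar = ?V" "subst ?U yvar xvar = ?U"
          unfolding subst_add[OF v] subst_monom2[OF v] by (simp_all add: cst_1_mult monom2_power monom2_mult add.commute)
        then have "subst (?g b) yvar xvar = ?g b" by (simp only: subst_subst[OF 0 v])
        then show "coef (?g b) i j = coef (?g b) j i" using coef_subst_swap[of "?g b" i j] by simp
      qed
      show "?S \<subseteq> ?g ` ?B"
      proof
        fix s assume s: "s \<in> ?S"
        \<comment> \<open>d divides m and q + 1, so i + q j is congruent to i - j modulo d.\<close>
        have "[i = j] (mod d)" if "coef s i j \<noteq> 0" for i j
        proof -
          have "m dvd i + q * j" using s that by (auto simp: inv_ring_def)
          then have "d dvd i + q * j" using d(2) dvd_trans by blast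
          then have "int d dvd int (i + q * j) - int (q + 1) * int j"
            using d(3) by (meson dvd_diff dvd_mult2 int_dvd_int_iff)
          also have "int (i + q * j) - int (q + 1) * int j = int i - int j" by (simp add: algebra_simps)
          finally show ?thesis by (simp add: cong_iff_dvd_diff flip: cong_int_iff)
        qed
        then obtain b where b: "s = ?g b"
          using symmetric_imp_subst[OF d(1), of s] s by blast
        then show "s \<in> ?g ` ?B" using s inA[of b] by auto
      qed
    qed
  qed
  then have "cps_iso ?B ?S" using subst_hom[OF 0] unfolding cps_iso_def by blast
  then obtain f where "cps_hom ?S f" "bij_betw f ?S ?B"
    by (rule cps_iso_sym) (auto intro: inv_ring_closed cst_mult_in_inv_ring that)
  then show ?thesis unfolding cps_iso_def by blast
qed

section \<open>Lifting an involution\<close>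

lemma coordinates_inj:
  assumes "coef \<xi> 0 0 = 0" "coef \<eta> 0 0 = 0" "coef \<xi> 1 0 * coef \<eta> 0 1 - coef \<xi> 0 1 * coef \<eta> 1 0 \<noteq> 0"
    and eq: "subst s \<xi> \<eta> = subst t \<xi> \<eta>"
  shows "s = t"
proof -
  obtain P Q where PQ: "coef P 0 0 = 0" "coef Q 0 0 = 0" "subst \<xi> P Q = xvar" "subst \<eta> P Q = yvar"
    "subst P \<xi> \<eta> = xvar" "subst Q \<xi> \<eta> = yvar"
    by (rule local_inverse_exists[OF assms(1-3)], rule that)
  have inv1: "subst (subst s \<xi> \<eta>) P Q = s" for s
    unfolding subst_subst[OF assms(1,2) PQ(1,2)] PQ(3,4) by (rule subst_xvar_yvar)
  show ?thesis using arg_cong[OF eq, of "\<lambda>u. subst u P Q"] unfolding inv1 .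
qed

text \<open>The series and its transform have the same n-th power, so they differ by a root of
  unity.\<close>

lemma semi_invariant:
  assumes "s ^ n \<in> inv_ring m q" "0 < n" and \<zeta>: "\<And>k. \<zeta> ^ k = 1 \<longleftrightarrow> m dvd k"
  obtains \<theta> where "\<theta> ^ n = 1" "scale \<zeta> (\<zeta> ^ q) s = cst \<theta> * s"
proof -
  have l: "coef (monom2 \<zeta> 1 0) 0 0 = 0" "coef (monom2 (\<zeta> ^ q) 0 1) 0 0 = 0" by simp_all
  have "scale \<zeta> (\<zeta> ^ q) s ^ n = s ^ n"
    using assms(1) unfolding inv_ring_iff_scale[OF \<zeta>] subst_power[OF l] .
  from cps_power_eq_imp[OF this assms(2)] show ?thesis using that by blast
qed

lemma semi_invariant_linear:
  assumes "scale \<zeta> (\<zeta> ^ q) s = cst \<theta> * s"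
  shows "\<zeta> * coef s 1 0 = \<theta> * coef s 1 0" "\<zeta> ^ q * coef s 0 1 = \<theta> * coef s 0 1"
  using arg_cong[OF assms, of "\<lambda>u. coef u 1 0"] arg_cong[OF assms, of "\<lambda>u. coef u 0 1"]
  unfolding coef_subst_scale by simp_all

text \<open>The square of the lift fixes all invariants, in particular x^m and x^e y; the first
  makes it multiply x by some \<omega>, and the second then makes it multiply y by
  \<omega>^q.\<close>

lemma involution_lift:
  assumes m: "0 < m" "coprime q m" and hom: "cps_hom (inv_ring m q) t"
    and tA: "\<And>a. a \<in> inv_ring m q \<Longrightarrow> t a \<in> inv_ring m q" and inv: "\<And>a. a \<in> inv_ring m q \<Longrightarrow> t (t a) = a"
  obtains X Y \<omega> where "coef X 0 0 = 0" "coef Y 0 0 = 0" "\<And>a. a \<in> inv_ring m q \<Longrightarrow> t a = subst a X Y"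
    "\<omega> ^ m = 1" "subst X X Y = monom2 \<omega> 1 0" "subst Y X Y = monom2 (\<omega> ^ q) 0 1"
proof -
  let ?A = "inv_ring m q"
  have xA: "monom2 1 m 0 \<in> ?A" "monom2 1 0 m \<in> ?A" by (rule monom2_in_inv_ring, simp)+
  have nz: "monom2 1 m 0 \<noteq> 0" using coef_monom2[of 1 m 0 m 0] by auto
  have nzt: "t (monom2 1 m 0) \<noteq> 0" using inv[OF xA(1)] hom_0[OF hom] nz by metis
  have c0: "coef (monom2 1 m 0) 0 0 = 0" "coef (monom2 1 0 m) 0 0 = 0" using m by auto
  \<comment> \<open>The fibre condition holds because \<open>t\<close> is its own inverse: common
    zeros of the images of x^m and y^m are zeros of t(t(x^m)) = x^m and of t(t(y^m)) = y^m.\<close>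
  have common: "\<forall>\<^sub>0z. ev (t (monom2 1 m 0)) z = 0 \<longrightarrow> ev (t (monom2 1 0 m)) z = 0 \<longrightarrow> z = (0, 0)"
    using hom_image_vanishes_at_common_zeros[OF hom m(1) tA[OF xA(1)] hom_local[OF hom xA(1) c0(1) m(1)]]
      hom_image_vanishes_at_common_zeros[OF hom m(1) tA[OF xA(2)] hom_local[OF hom xA(2) c0(2) m(1)]]
    unfolding inv[OF xA(1)] inv[OF xA(2)]
    by eventually_elim (auto simp: ev_monom2 prod_eq_iff)
  obtain X Y where XY: "coef X 0 0 = 0" "coef Y 0 0 = 0" "\<And>b. b \<in> ?A \<Longrightarrow> t b = subst b X Y"
    by (rule inv_ring_hom_lift[OF m hom nzt common], rule that)
  define X2 Y2 where "X2 = subst X X Y" and "Y2 = subst Y X Y"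
  have X20: "coef X2 0 0 = 0" "coef Y2 0 0 = 0"
    by (simp_all add: X2_def Y2_def coef_subst_0_0[OF XY(1,2)] XY)
  have id: "subst a X2 Y2 = a" if "a \<in> ?A" for a
    using inv[OF that] XY(3)[OF that] XY(3)[OF tA[OF that]] subst_subst[OF XY(1,2) XY(1,2), of a]
    by (simp add: X2_def Y2_def)
  have "X2 ^ m = xvar ^ m"
    using id[OF xA(1)] by (simp add: subst_monom2[OF X20] cst_1_mult monom2_power)
  then obtain \<omega> where \<omega>: "\<omega> ^ m = 1" "X2 = cst \<omega> * xvar" using cps_power_eq_imp[OF _ m(1)] by blast
  define e where "e = (m - 1) * q"
  have eq: "e + q = m * q" using m(1) by (cases m) (auto simp: e_def)
  have "monom2 1 e 1 \<in> ?A" by (rule monom2_in_inv_ring) (simp add: eq)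
  from id[OF this] have "X2 ^ e * Y2 = monom2 1 e 1" by (simp add: subst_monom2[OF X20] cst_1_mult)
  moreover have "X2 ^ e = cst (\<omega> ^ e) * monom2 1 e 0"
    by (simp add: \<omega>(2) monom2_mult monom2_power)
  ultimately have "monom2 1 e 0 * (cst (\<omega> ^ e) * Y2) = monom2 1 e 0 * yvar"
    by (simp add: monom2_mult mult_ac)
  moreover have "monom2 1 e 0 \<noteq> (0 :: cps)" using coef_monom2[of 1 e 0 e 0] by auto
  ultimately have "cst (\<omega> ^ e) * Y2 = yvar" by simp
  then have "cst (\<omega> ^ q) * (cst (\<omega> ^ e) * Y2) = cst (\<omega> ^ q) * yvar" by simp
  then have "cst (\<omega> ^ q * \<omega> ^ e) * Y2 = monom2 (\<omega> ^ q) 0 1" unfolding cst_mult_cst by (simp add: monom2_mult)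
  moreover have "\<omega> ^ q * \<omega> ^ e = 1" using \<omega>(1) eq by (simp add: power_mult add.commute flip: power_add)
  ultimately have Y2: "Y2 = monom2 (\<omega> ^ q) 0 1" by (simp add: cst_1_mult)
  have "X2 = monom2 \<omega> 1 0" using \<omega>(2) by (simp add: monom2_mult)
  then show ?thesis using that[OF XY \<omega>(1)] Y2 unfolding X2_def Y2_def by blast
qed

text \<open>On exponents with m | i + q j the assignment (i, j) -> \<alpha>^i \<beta>^j is a
  character with values 1 and -1. It is determined by its values \<open>s1\<close> on x^m and
  \<open>s2\<close> on x^e y, whose exponents generate the lattice; the four choices of signs give
  the four rings.\<close>

lemma diagonal_fixed_ring:
  assumes m: "0 < m" "coprime q m" and \<alpha>: "\<alpha> ^ 2 = \<omega>" "\<beta> ^ 2 = \<omega> ^ q" "\<omega> ^ m = (1 :: complex)"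
  defines "G \<equiv> {s \<in> inv_ring m q. \<forall>i j. coef s i j \<noteq> 0 \<longrightarrow> \<alpha> ^ i * \<beta> ^ j = 1}"
  shows "G = inv_ring m q \<or> G = inv_ring (2 * m) q \<or> G = inv_ring (2 * m) (m + q) \<or>
    G = {s \<in> inv_ring m q. \<forall>i j. coef s i j \<noteq> 0 \<longrightarrow> even j}"
proof -
  define e where "e = (m - 1) * q"
  have eq: "e + q = m * q" using m(1) by (cases m) (auto simp: e_def)
  define s1 s2 where "s1 = \<alpha> ^ m" and "s2 = \<alpha> ^ e * \<beta>"
  have "s1 ^ 2 = 1" using \<alpha> by (simp add: s1_def flip: power_mult) (metis mult.commute power_mult)
  then have s1: "s1 = 1 \<or> s1 = -1" by (rule power2_eq_1_iff[THEN iffD1])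
  have "s2 ^ 2 = (\<alpha> ^ 2) ^ e * \<beta> ^ 2" by (simp add: s2_def power_mult_distrib mult.commute flip: power_mult)
  also have "\<dots> = \<omega> ^ (m * q)" using \<alpha> eq by (simp flip: power_add)
  finally have "s2 ^ 2 = 1" using \<alpha>(3) by (simp add: power_mult)
  then have s2: "s2 = 1 \<or> s2 = -1" by (rule power2_eq_1_iff[THEN iffD1])
  \<comment> \<open>(i, j) is j times (e, 1) plus k - q j times (m, 0); for the sign
    \<open>s1\<close> the exponents k - q j and k + q j are equivalent.\<close>
  have chi: "\<alpha> ^ i * \<beta> ^ j = s2 ^ j * s1 ^ (k + q * j)" if k: "i + q * j = m * k" for i j k
  proof -
    have ex: "i + m * (q * j) = e * j + m * k"
    proof -
      have "e * j + (i + q * j) = i + (e + q) * j" by (simp add: algebra_simps)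
      then show ?thesis by (simp add: eq k mult.assoc)
    qed
    have "\<alpha> ^ i * \<beta> ^ j * s1 ^ (q * j) = \<alpha> ^ (i + m * (q * j)) * \<beta> ^ j"
      by (simp add: s1_def power_add mult_ac flip: power_mult)
    also have "\<dots> = s2 ^ j * s1 ^ k"
      unfolding ex by (simp add: s1_def s2_def power_add power_mult_distrib mult_ac flip: power_mult)
    finally have "\<alpha> ^ i * \<beta> ^ j * (s1 ^ (q * j) * s1 ^ (q * j)) = s2 ^ j * s1 ^ (k + q * j)"
      by (simp add: power_add mult_ac)
    moreover have "s1 ^ (q * j) * s1 ^ (q * j) = 1" using s1 by (auto simp flip: power_add)
    ultimately show ?thesis by simp
  qed
  have neg: "(- 1 :: complex) ^ n = 1 \<longleftrightarrow> even n" for n by (cases "even n") auto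
  have dv: "m dvd i + q * j \<longleftrightarrow> (\<exists>k. i + q * j = m * k)" for i j by (auto simp: dvd_def)
  have eqI: "G = {s. \<forall>i j. coef s i j \<noteq> 0 \<longrightarrow> P i j}"
    if "\<And>i j. P i j \<longleftrightarrow> (m dvd i + q * j \<and> \<alpha> ^ i * \<beta> ^ j = 1)" for P
    using that unfolding G_def inv_ring_def by auto
  show ?thesis
  proof (cases "s1 = 1")
    case True
    then have c: "\<alpha> ^ i * \<beta> ^ j = s2 ^ j" if "m dvd i + q * j" for i j using chi that by (auto simp: dv)
    show ?thesis
    proof (cases "s2 = 1")
      case True
      then have "G = inv_ring m q" unfolding G_def using c by (auto simp: inv_ring_def)
      then show ?thesis by simp
    next
      case False
      then have "s2 = -1" using s2 by simp
      then have "G = {s \<in> inv_ring m q. \<forall>i j. coef s i j \<noteq> 0 \<longrightarrow> even j}"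
        unfolding G_def using c neg by (auto simp: inv_ring_def)
      then show ?thesis by simp
    qed
  next
    case False
    then have s1m: "s1 = -1" using s1 by simp
    have half: "2 * m dvd n \<longleftrightarrow> (\<exists>k. n = m * k \<and> even k)" for n
      by (auto simp: dvd_def)
    \<comment> \<open>With s1 = -1 the character is (-1)^k or (-1)^(k + j), where i + q j = m k. Its
      kernel is given by divisibility by 2m of i + q j or of i + (m + q) j, respectively.\<close>
    show ?thesis
    proof (cases "s2 = (- 1) ^ q")
      case True
      have c: "\<alpha> ^ i * \<beta> ^ j = (- 1) ^ k" if "i + q * j = m * k" for i j k
        unfolding chi[OF that] s1m True by (simp add: power_add power_mult flip: power_mult_distrib)
      have "G = inv_ring (2 * m) q"
        unfolding inv_ring_def
      proof (rule eqI)
        show "2 * m dvd i + q * j \<longleftrightarrow> m dvd i + q * j \<and> \<alpha> ^ i * \<beta> ^ j = 1" for i j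
          unfolding half dv using c neg by metis
      qed
      then show ?thesis by simp
    next
      case False
      then have s2q: "s2 = - ((- 1) ^ q)" using s2 by (cases "even q") auto
      have c: "\<alpha> ^ i * \<beta> ^ j = (- 1) ^ (k + j)" if "i + q * j = m * k" for i j k
        unfolding chi[OF that] s1m s2q by (cases "even q"; cases "even j"; cases "even k") (auto simp: power_add power_mult)
      have "G = inv_ring (2 * m) (m + q)"
        unfolding inv_ring_def
      proof (rule eqI)
        fix i j
        show "2 * m dvd i + (m + q) * j \<longleftrightarrow> m dvd i + q * j \<and> \<alpha> ^ i * \<beta> ^ j = 1"
        proof
          assume "2 * m dvd i + (m + q) * j"
          then obtain l where l: "i + (m + q) * j = m * l" "even l" using half by blast
          then have "m * j \<le> m * l" by (metis add_mult_distrib le_add1 le_add2 order_trans)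
          then have jl: "j \<le> l" using m(1) by simp
          have "i + q * j = m * l - m * j" using l(1) by (simp add: algebra_simps)
          then have k: "i + q * j = m * (l - j)" by (simp add: diff_mult_distrib2)
          then show "m dvd i + q * j \<and> \<alpha> ^ i * \<beta> ^ j = 1" using c[OF k] jl l(2) neg by auto
        next
          assume a: "m dvd i + q * j \<and> \<alpha> ^ i * \<beta> ^ j = 1"
          then obtain k where k: "i + q * j = m * k" by (auto simp: dvd_def)
          then have "i + (m + q) * j = m * (k + j)" "even (k + j)" using a c[OF k] neg by (auto simp: algebra_simps)
          then show "2 * m dvd i + (m + q) * j" using half by blast
        qed
      qed
      then show ?thesis by simp
    qed
  qed
qed

lemma cps_iso_rev_trans:
  assumes "cps_iso F B" "cps_iso F C"
    and F: "1 \<in> F" "\<And>a b. a \<in> F \<Longrightarrow> b \<in> F \<Longrightarrow> a + b \<in> F \<and> a * b \<in> F" "\<And>a c. a \<in> F \<Longrightarrow> cst c * a \<in> F"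
  shows "cps_iso B C"
proof -
  obtain g where g: "cps_hom B g" "bij_betw g B F"
    by (rule cps_iso_sym[OF assms(1)]) (auto intro: that F(1,3) F(2)[THEN conjunct1] F(2)[THEN conjunct2])
  obtain f where f: "cps_hom F f" "bij_betw f F C" using assms(2) by (auto simp: cps_iso_def)
  have gF: "g b \<in> F" if "b \<in> B" for b using g(2) that by (auto dest: bij_betwE)
  have "cps_hom B (f \<circ> g)" using f(1) g(1) gF unfolding cps_hom_def comp_def by simp
  moreover have "bij_betw (f \<circ> g) B C" using g(2) f(2) by (rule bij_betw_trans)
  ultimately show ?thesis unfolding cps_iso_def by blast
qed

lemma cps_iso_trans:
  assumes "cps_iso A B" "cps_iso B C"
  shows "cps_iso A C"
proof -
  obtain g where g: "cps_hom A g" "bij_betw g A B" using assms(1) by (auto simp: cps_iso_def)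
  obtain f where f: "cps_hom B f" "bij_betw f B C" using assms(2) by (auto simp: cps_iso_def)
  have gB: "g a \<in> B" if "a \<in> A" for a using g(2) that by (auto dest: bij_betwE)
  have "cps_hom A (f \<circ> g)" using f(1) g(1) gB unfolding cps_hom_def comp_def by simp
  moreover have "bij_betw (f \<circ> g) A C" using g(2) f(2) by (rule bij_betw_trans)
  ultimately show ?thesis unfolding cps_iso_def by blast
qed

text \<open>The matrix with rows (a, b) and (c, d) squares to \<omega> times the identity. If it is
  not diagonal, its trace is 0 and there are left eigenvectors (p, r) for both square roots of
  \<omega>; if it is diagonal, the coordinate rows serve.\<close>

lemma involution_eigenvectors:
  fixes a b c d \<omega> :: complex
  assumes L: "a * a + b * c = \<omega>" "a * b + b * d = 0" "c * a + d * c = 0" "c * b + d * d = \<omega>" and "\<omega> \<noteq> 0"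
  obtains \<alpha> p r \<alpha>' p' r' where "\<alpha> ^ 2 = \<omega>" "p * a + r * c = \<alpha> * p" "p * b + r * d = \<alpha> * r"
    "\<alpha>' ^ 2 = \<omega>" "p' * a + r' * c = \<alpha>' * p'" "p' * b + r' * d = \<alpha>' * r'" "p * r' - r * p' \<noteq> 0"
proof -
  define \<alpha> where "\<alpha> = csqrt \<omega>"
  have \<alpha>: "\<alpha> * \<alpha> = \<omega>" "\<alpha> ^ 2 = \<omega>" by (simp_all add: \<alpha>_def flip: power2_eq_square)
  have \<alpha>0: "\<alpha> \<noteq> 0" using \<alpha> assms(5) by auto
  consider "c \<noteq> 0" | "c = 0" "b \<noteq> 0" | "c = 0" "b = 0" by blast
  then show thesis
  proof cases
    case 1
    have d: "d = - a" using L(3) 1 by (metis add.inverse_unique mult.commute mult_cancel_left distrib_left mult_zero_right)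
    show thesis
    proof (rule that[of \<alpha> c "\<alpha> - a" "- \<alpha>" c "- \<alpha> - a"])
      show "c * b + (\<alpha> - a) * d = \<alpha> * (\<alpha> - a)" "c * b + (- \<alpha> - a) * d = - \<alpha> * (- \<alpha> - a)"
        using L(1) \<alpha>(1) by (simp_all add: d algebra_simps)
    qed (use \<alpha> \<alpha>0 1 in \<open>auto simp: algebra_simps\<close>)
  next
    case 2
    have d: "d = - a" using L(2) 2 by (metis add.inverse_unique mult.commute mult_cancel_left distrib_left mult_zero_right)
    show thesis
    proof (rule that[of \<alpha> "\<alpha> - d" b "- \<alpha>" "- \<alpha> - d" b])
      show "(\<alpha> - d) * a + b * c = \<alpha> * (\<alpha> - d)" "(- \<alpha> - d) * a + b * c = - \<alpha> * (- \<alpha> - d)"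
        using L(1) \<alpha>(1) 2 by (simp_all add: d algebra_simps)
    qed (use \<alpha> \<alpha>0 2 in \<open>auto simp: algebra_simps\<close>)
  next
    case 3
    show thesis
      by (rule that[of a 1 0 d 0 1]) (use L 3 in \<open>auto simp: power2_eq_square\<close>)
  qed
qed


section \<open>Lifts that exchange the axes\<close>

lemma coef_subst_twisted_swap: "coef (subst s yvar (monom2 \<omega> 1 0)) i j = \<omega> ^ i * coef s j i"
proof -
  have v: "coef yvar 0 0 = 0" "coef xvar 0 0 = 0" by simp_all
  have "subst (scale 1 \<omega> s) yvar xvar = subst s (cst 1 * yvar) (cst \<omega> * xvar)"
    by (rule subst_scale[OF v])
  also have "\<dots> = subst s yvar (monom2 \<omega> 1 0)" by (simp add: monom2_mult)
  finally show ?thesis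
    using coef_subst_swap[of "scale 1 \<omega> s" i j] unfolding coef_subst_scale by simp
qed

lemma partials_monom2:
  "dx (monom2 c (Suc i) j) = monom2 (of_nat (Suc i) * c) i j" "dx (monom2 c 0 j) = 0"
  "dy (monom2 c i (Suc j)) = monom2 (of_nat (Suc j) * c) i j" "dy (monom2 c i 0) = 0"
  by (rule cps_eqI; simp add: coef_monom2 del: of_nat_Suc)+

lemma partials_add: "dx (s + t) = dx s + dx t" "dy (s + t) = dy s + dy t"
  by (rule cps_eqI; simp add: algebra_simps)+

lemma jacobian_factor:
  assumes XY: "coef X 0 0 = 0" "coef Y 0 0 = 0"
  shows "dx (subst b X Y) * dy (subst b' X Y) - dy (subst b X Y) * dx (subst b' X Y) =
    (subst (dx b) X Y * subst (dy b') X Y - subst (dy b) X Y * subst (dx b') X Y) * (dx X * dy Y - dy X * dx Y)"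
  unfolding partials_subst[OF XY] by (simp add: algebra_simps)

text \<open>Without pseudo-reflections the quotient is not cyclic: otherwise its uniformisation would be
  given by semi-invariants \<open>X\<close>, \<open>Y\<close> of the non-abelian group, whose linear parts vanish, whereas
  the Jacobian of \<open>(X, Y)\<close> divides every Jacobian of two invariants and so has no zero off the origin.\<close>

lemma twisted_symmetric_ring_not_cyclic:
  fixes \<omega> :: complex
  assumes m: "1 < q" "q < m" "[q ^ 2 = 1] (mod m)" and \<omega>: "\<omega> ^ m = 1" "\<omega> ^ q = \<omega>"
    and no_refl: "\<And>c. c ^ m = 1 \<Longrightarrow> c ^ (q + 1) \<noteq> \<omega>"
    and n0: "0 < n0" "coprime p0 n0"
  defines "G \<equiv> {s \<in> inv_ring m q. \<forall>i j. coef s i j = \<omega> ^ i * coef s j i}"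
  shows "\<not> cps_iso (inv_ring n0 p0) G"
proof
  let ?B = "inv_ring n0 p0"
  assume "cps_iso ?B G"
  then obtain \<psi> where \<psi>: "cps_hom ?B \<psi>" "bij_betw \<psi> ?B G" by (auto simp: cps_iso_def)
  have \<psi>G: "\<psi> b \<in> G" if "b \<in> ?B" for b using \<psi>(2) that by (auto dest: bij_betwE)
  have \<omega>0: "\<omega> \<noteq> 0" using \<omega>(1) m by (auto simp: zero_power)
  obtain m' where m': "m = Suc m'" "0 < m'" using m by (cases m) auto
  \<comment> \<open>A representative of -q modulo m, so that x^n y is invariant. The choice 2m - q
    keeps n > 1 also for q = m - 1, and the factor 1 - n below is then nonzero.\<close>
  define n where "n = 2 * m - q"
  have n: "n + q = 2 * m" "1 < n" using m by (auto simp: n_def)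
  obtain n' where n': "n = Suc n'" "0 < n'" using n(2) by (cases n) auto
  have \<omega>n: "\<omega> ^ n * \<omega> = 1"
  proof -
    have "\<omega> ^ n * \<omega> ^ q = (\<omega> ^ m) ^ 2" using n(1) by (metis mult.commute power_add power_mult)
    then show ?thesis using \<omega> by simp
  qed
  \<comment> \<open>Three invariants of the extended group: \<open>r1\<close> and \<open>r2\<close>
    vanish together only at the origin, and outside it the three pairwise Jacobians vanish together
    only on lines fixed by pseudo-reflections.\<close>
  define r1 r2 r3 where "r1 = monom2 1 m 0 + monom2 1 0 m" and "r2 = monom2 1 m m"
    and "r3 = monom2 1 n 1 + monom2 \<omega> 1 n"
  have r1G: "r1 \<in> G"
    unfolding G_def r1_def using m \<omega>(1)
    by (auto simp: coef_monom2 intro!: inv_ring_closed(1) monom2_in_inv_ring)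
  have r2G: "r2 \<in> G"
    unfolding G_def r2_def using \<omega>(1) by (auto simp: coef_monom2 intro!: monom2_in_inv_ring)
  have "m dvd 1 + q * n"
  proof -
    have "m dvd q * (n + q)" by (simp add: n(1))
    then have "[q * n + q ^ 2 = 0] (mod m)" by (simp add: cong_0_iff distrib_left power2_eq_square)
    moreover have "[q * n + q ^ 2 = q * n + 1] (mod m)" by (rule cong_add[OF cong_refl m(3)])
    ultimately have "[q * n + 1 = 0] (mod m)" using cong_sym cong_trans by blast
    then show ?thesis by (simp add: cong_0_iff)
  qed
  then have r3G: "r3 \<in> G"
    unfolding G_def r3_def using n \<omega>n
    by (auto simp: coef_monom2 mult.commute intro!: inv_ring_closed(1) monom2_in_inv_ring)
  have pre: "\<exists>b\<in>?B. \<psi> b = r" if "r \<in> G" for r using \<psi>(2) that by (metis bij_betw_iff_bijections)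
  obtain b1 where b1: "b1 \<in> ?B" "\<psi> b1 = r1" using pre[OF r1G] by blast
  obtain b2 where b2: "b2 \<in> ?B" "\<psi> b2 = r2" using pre[OF r2G] by blast
  have loc: "coef b 0 0 = 0" if b: "b \<in> ?B" "coef (\<psi> b) 0 0 = 0" for b
  proof (rule ccontr)
    assume "coef b 0 0 \<noteq> 0"
    then obtain b' where "b' \<in> ?B" "b * b' = 1" using inv_ring_unit[OF b(1) _ n0(1)] by blast
    then have "\<psi> b * \<psi> b' = 1" using hom_mult[OF \<psi>(1) b(1)] hom_1[OF \<psi>(1)] by metis
    then show False using b(2) by (metis coef_1 coef_mult_0_0 mult_zero_left zero_neq_one)
  qed
  have xB: "monom2 1 n0 0 \<in> ?B" "monom2 1 0 n0 \<in> ?B" by (rule monom2_in_inv_ring, simp)+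
  have nz: "\<psi> (monom2 1 n0 0) \<noteq> 0"
  proof
    assume "\<psi> (monom2 1 n0 0) = 0"
    then have "\<psi> (monom2 1 n0 0) = \<psi> 0" by (simp only: hom_0[OF \<psi>(1)])
    from inj_onD[OF bij_betw_imp_inj_on[OF \<psi>(2)] this xB(1) zero_in_inv_ring] have "monom2 1 n0 0 = (0 :: cps)" .
    then show False using coef_monom2[of 1 n0 0 n0 0] by simp
  qed
  have c1: "coef b1 0 0 = 0" by (rule loc[OF b1(1)]) (use m in \<open>simp add: b1(2) r1_def\<close>)
  have c2: "coef b2 0 0 = 0" by (rule loc[OF b2(1)]) (use m in \<open>simp add: b2(2) r2_def\<close>)
  have common: "\<forall>\<^sub>0z. ev (\<psi> (monom2 1 n0 0)) z = 0 \<longrightarrow> ev (\<psi> (monom2 1 0 n0)) z = 0 \<longrightarrow> z = (0, 0)"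
    using hom_image_vanishes_at_common_zeros[OF \<psi>(1) n0(1) b1(1) c1]
      hom_image_vanishes_at_common_zeros[OF \<psi>(1) n0(1) b2(1) c2] ev_add[of "monom2 1 m 0" "monom2 1 0 m"]
    unfolding b1(2) b2(2) r1_def r2_def
    by eventually_elim (use m in \<open>auto simp: ev_monom2 prod_eq_iff zero_power\<close>)
  obtain X Y where XY: "coef X 0 0 = 0" "coef Y 0 0 = 0" "\<And>b. b \<in> ?B \<Longrightarrow> \<psi> b = subst b X Y"
    by (rule inv_ring_hom_lift[OF n0 \<psi>(1) nz common], rule that)
  obtain \<zeta> :: complex where \<zeta>: "\<And>k. \<zeta> ^ k = 1 \<longleftrightarrow> m dvd k" using primitive_root_exists[of m] m by auto
  have \<zeta>q: "\<zeta> \<noteq> \<zeta> ^ q"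
    using primitive_root_power_eq[OF \<zeta>, of 1 q] m by (auto simp: cong_def)
  \<comment> \<open>\<open>Z\<close> is an eigenvector both of the generator of \<mu>_m and of the
    twisted exchange. The first confines its linear part to one axis, because \<zeta> and \<zeta>^q
    differ; the second carries that axis to the other.\<close>
  have lin: "coef Z 1 0 = 0 \<and> coef Z 0 1 = 0" if Z: "Z ^ n0 \<in> G" for Z
  proof -
    have "Z ^ n0 \<in> inv_ring m q" using Z by (simp add: G_def)
    from semi_invariant[OF this n0(1) \<zeta>] obtain \<theta> where "scale \<zeta> (\<zeta> ^ q) Z = cst \<theta> * Z" .
    note l1 = semi_invariant_linear[OF this]
    have v: "coef yvar 0 0 = 0" "coef (monom2 \<omega> 1 0) 0 0 = 0" by simp_all
    have "subst (Z ^ n0) yvar (monom2 \<omega> 1 0) = Z ^ n0"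
    proof (rule cps_eqI)
      fix i j
      have "coef (Z ^ n0) i j = \<omega> ^ i * coef (Z ^ n0) j i" using Z unfolding G_def by blast
      then show "coef (subst (Z ^ n0) yvar (monom2 \<omega> 1 0)) i j = coef (Z ^ n0) i j"
        unfolding coef_subst_twisted_swap by (rule sym)
    qed
    then have "subst Z yvar (monom2 \<omega> 1 0) ^ n0 = Z ^ n0" by (simp only: subst_power[OF v])
    then obtain \<theta>' where \<theta>': "\<theta>' ^ n0 = 1" "subst Z yvar (monom2 \<omega> 1 0) = cst \<theta>' * Z"
      using cps_power_eq_imp[OF _ n0(1)] by blast
    have "\<omega> * coef Z 0 1 = \<theta>' * coef Z 1 0" "coef Z 1 0 = \<theta>' * coef Z 0 1"
      using arg_cong[OF \<theta>'(2), of "\<lambda>u. coef u 1 0"] arg_cong[OF \<theta>'(2), of "\<lambda>u. coef u 0 1"]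
      unfolding coef_subst_twisted_swap by simp_all
    moreover have "coef Z 1 0 = 0 \<or> coef Z 0 1 = 0" using l1 \<zeta>q by auto
    ultimately show ?thesis using \<omega>0 by auto
  qed
  have "X ^ n0 \<in> G" "Y ^ n0 \<in> G"
    using \<psi>G[OF xB(1)] \<psi>G[OF xB(2)] XY(3)[OF xB(1)] XY(3)[OF xB(2)]
    by (simp_all add: subst_monom2[OF XY(1,2)] cst_1_mult)
  then have XYl: "coef X 1 0 = 0" "coef X 0 1 = 0" "coef Y 1 0 = 0" "coef Y 0 1 = 0" using lin by auto
  define J where "J = dx X * dy Y - dy X * dx Y"
  have J0: "coef J 0 0 = 0" using XYl by (simp add: J_def)
  define D where "D = (\<lambda>r r'. dx r * dy r' - dy r * dx r')"
  have DJ: "\<forall>\<^sub>0z. ev J z = 0 \<longrightarrow> ev (D r r') z = 0" if r: "r \<in> G" "r' \<in> G" for r r'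
  proof -
    obtain b b' where b: "b \<in> ?B" "\<psi> b = r" "b' \<in> ?B" "\<psi> b' = r'" using pre r by blast
    then have "r = subst b X Y" "r' = subst b' X Y" using XY(3) by auto
    then have "D r r' = (subst (dx b) X Y * subst (dy b') X Y - subst (dy b) X Y * subst (dx b') X Y) * J"
      unfolding D_def J_def using jacobian_factor[OF XY(1,2)] by simp
    then show ?thesis
      using ev_mult[of "subst (dx b) X Y * subst (dy b') X Y - subst (dy b) X Y * subst (dx b') X Y" J]
      by (auto elim: eventually_mono)
  qed
  have evD: "\<forall>\<^sub>0z. ev (D r r') z = ev (dx r) z * ev (dy r') z - ev (dy r) z * ev (dx r') z" for r r'
    unfolding D_def using ev_diff[of "dx r * dy r'" "dy r * dx r'"] ev_mult[of "dx r" "dy r'"] ev_mult[of "dy r" "dx r'"]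
    by eventually_elim simp
  have d1: "dx r1 = monom2 (of_nat m) m' 0" "dy r1 = monom2 (of_nat m) 0 m'"
    and d2: "dx r2 = monom2 (of_nat m) m' m" "dy r2 = monom2 (of_nat m) m m'"
    and d3: "dx r3 = monom2 (of_nat n) n' 1 + monom2 \<omega> 0 n" "dy r3 = monom2 1 n 0 + monom2 (of_nat n * \<omega>) 1 n'"
    by (simp_all add: r1_def r2_def r3_def partials_add partials_monom2 m'(1) n'(1) One_nat_def del: of_nat_Suc) simp_all
  have ev3: "\<forall>\<^sub>0z. ev (dx r3) z = of_nat n * fst z ^ n' * snd z + \<omega> * snd z ^ n"
    "\<forall>\<^sub>0z. ev (dy r3) z = fst z ^ n + of_nat n * \<omega> * fst z * snd z ^ n'"
    using ev_add[of "monom2 (of_nat n) n' 1" "monom2 \<omega> 0 n"] ev_add[of "monom2 1 n 0" "monom2 (of_nat n * \<omega>) 1 n'"]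
    unfolding d3 by (auto simp: ev_monom2)
  have "\<forall>\<^sub>0z. z \<noteq> (0, 0) \<longrightarrow> ev J z \<noteq> 0"
    using DJ[OF r1G r2G] DJ[OF r1G r3G] DJ[OF r2G r3G] evD[of r1 r2] evD[of r1 r3] evD[of r2 r3] ev3
  proof eventually_elim
    case (elim z)
    show ?case
    proof (intro impI notI)
      assume z: "z \<noteq> (0, 0)" and J: "ev J z = 0"
      obtain x y where xy: "z = (x, y)" by force
      have mc: "complex_of_nat m \<noteq> 0" using m by simp
      have D12: "x ^ m' * (x ^ m * y ^ m') - y ^ m' * (x ^ m' * y ^ m) = 0"
        using elim J mc by (simp add: d1 d2 ev_monom2 xy mult.assoc mult.left_commute flip: right_diff_distrib)
      have D13: "x ^ m' * (x ^ n + of_nat n * \<omega> * x * y ^ n') - y ^ m' * (of_nat n * x ^ n' * y + \<omega> * y ^ n) = 0"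
        using elim J mc by (simp add: d1 ev_monom2 xy mult.assoc flip: right_diff_distrib)
      have D23: "x ^ m' * y ^ m * (x ^ n + of_nat n * \<omega> * x * y ^ n') - x ^ m * y ^ m' * (of_nat n * x ^ n' * y + \<omega> * y ^ n) = 0"
        using elim J mc by (simp add: d2 ev_monom2 xy mult.assoc flip: right_diff_distrib)
      have x0: "x \<noteq> 0"
      proof
        assume "x = 0"
        then have "y \<noteq> 0" "y ^ m' * (\<omega> * y ^ n) = 0" using z D13 m' n' by (auto simp: xy zero_power)
        then show False using \<omega>0 by simp
      qed
      have y0: "y \<noteq> 0"
      proof
        assume "y = 0"
        then have "x ^ m' * x ^ n = 0" using D13 m' n' by (auto simp: zero_power)
        then show False using x0 by simp
      qed
      have "x ^ m' * y ^ m' * (x ^ m - y ^ m) = 0" using D12 by (simp add: algebra_simps)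
      then have xm: "x ^ m = y ^ m" using x0 y0 by simp
      have "x ^ m = x * x ^ m'" "y ^ m = y * y ^ m'" "x ^ n = x * x ^ n'" "y ^ n = y * y ^ n'"
        by (simp_all add: m' n')
      note e = this
      have "x ^ m' * y ^ m' * x * y * (1 - of_nat n) * (x ^ n' - \<omega> * y ^ n') =
          x ^ m' * y ^ m * (x ^ n + of_nat n * \<omega> * x * y ^ n') - x ^ m * y ^ m' * (of_nat n * x ^ n' * y + \<omega> * y ^ n)"
        unfolding e by (simp add: algebra_simps)
      then have "x ^ m' * y ^ m' * x * y * (1 - of_nat n) * (x ^ n' - \<omega> * y ^ n') = 0" using D23 by simp
      moreover have "(1 :: complex) - of_nat n \<noteq> 0" using n(2) by (metis of_nat_1 of_nat_eq_iff right_minus_eq less_irrefl)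
      ultimately have xn: "x ^ n' = \<omega> * y ^ n'" using x0 y0 by simp
      \<comment> \<open>The ratio is an m-th root of unity, and (n - 1) + (q + 1) = 2m turns the
        second equation into c^(q + 1) = \<omega>, the condition for a pseudo-reflection.\<close>
      define c where "c = y / x"
      have cm: "c ^ m = 1" using xm x0 y0 by (simp add: c_def power_divide)
      have "c ^ (q + 1) = \<omega>"
      proof -
        have "c ^ n' * \<omega> = 1" using xn x0 y0 \<omega>0 by (simp add: c_def power_divide field_simps)
        moreover have "c ^ n' * c ^ (q + 1) = 1"
        proof -
          have "n' + (q + 1) = m * 2" using n(1) n'(1) by simp
          then have "c ^ n' * c ^ (q + 1) = (c ^ m) ^ 2" by (metis power_add power_mult)
          then show ?thesis using cm by simp
        qed
        ultimately show ?thesis by (metis mult.commute mult.left_neutral mult.assoc)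
      qed
      then show False using no_refl[OF cm] by simp
    qed
  qed
  then show False using cps_zero_not_isolated[OF J0] by blast
qed


section \<open>Fixed rings for the two types of lift\<close>

lemma diagonal_case:
  assumes m: "0 < m" "coprime q m" and XY: "coef X 0 0 = 0" "coef Y 0 0 = 0"
    and t: "\<And>a. a \<in> inv_ring m q \<Longrightarrow> t a = subst a X Y" and nontriv: "\<exists>a\<in>inv_ring m q. t a \<noteq> a"
    and \<alpha>: "\<alpha> ^ 2 = \<omega>" "\<beta> ^ 2 = \<omega> ^ q" "\<omega> ^ m = (1 :: complex)"
    and \<zeta>: "\<And>k. \<zeta> ^ k = 1 \<longleftrightarrow> m dvd k"
    and \<xi>\<eta>: "coef \<xi> 0 0 = 0" "coef \<eta> 0 0 = 0" "coef \<xi> 1 0 * coef \<eta> 0 1 - coef \<xi> 0 1 * coef \<eta> 1 0 \<noteq> 0"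
    and sc: "scale \<zeta> (\<zeta> ^ q) \<xi> = cst \<zeta> * \<xi>" "scale \<zeta> (\<zeta> ^ q) \<eta> = cst (\<zeta> ^ q) * \<eta>"
    and eig: "subst \<xi> X Y = cst \<alpha> * \<xi>" "subst \<eta> X Y = cst \<beta> * \<eta>"
  defines "F \<equiv> {a \<in> inv_ring m q. t a = a}"
  shows "cps_iso F (inv_ring (2 * m) q) \<or> cps_iso F (inv_ring (2 * m) (m + q)) \<or> cps_iso F (inv_ring m (2 * q))"
proof -
  define G where "G = {s \<in> inv_ring m q. \<forall>i j. coef s i j \<noteq> 0 \<longrightarrow> \<alpha> ^ i * \<beta> ^ j = 1}"
  have GG: "{s \<in> inv_ring m q. subst s (subst \<xi> X Y) (subst \<eta> X Y) = subst s \<xi> \<eta>} = G"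
  proof -
    have "subst s (subst \<xi> X Y) (subst \<eta> X Y) = subst s \<xi> \<eta> \<longleftrightarrow> scale \<alpha> \<beta> s = s" for s
      unfolding eig subst_scale[OF \<xi>\<eta>(1,2), symmetric] using coordinates_inj[OF \<xi>\<eta>] by metis
    also have "scale \<alpha> \<beta> s = s \<longleftrightarrow> (\<forall>i j. coef s i j \<noteq> 0 \<longrightarrow> \<alpha> ^ i * \<beta> ^ j = 1)" for s
    proof -
      have "scale \<alpha> \<beta> s = s \<longleftrightarrow> (\<forall>i j. \<alpha> ^ i * \<beta> ^ j * coef s i j = coef s i j)"
        unfolding coef_subst_scale[symmetric] by (metis cps_eqI)
      then show ?thesis by auto
    qed
    finally show ?thesis unfolding G_def by blast
  qed
  have iso: "cps_iso F G"
    using fixed_ring_in_coordinates[OF XY t \<xi>\<eta> \<zeta> sc] unfolding GG F_def by simp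
  \<comment> \<open>The first alternative of \<open>diagonal_fixed_ring\<close> would make
    \<open>t\<close> the identity on invariants, against \<open>nontriv\<close>.\<close>
  have "G \<noteq> inv_ring m q"
  proof
    assume G: "G = inv_ring m q"
    obtain P Q where PQ: "coef P 0 0 = 0" "coef Q 0 0 = 0" "subst \<xi> P Q = xvar" "subst \<eta> P Q = yvar"
      "subst P \<xi> \<eta> = xvar" "subst Q \<xi> \<eta> = yvar"
      by (rule local_inverse_exists[OF \<xi>\<eta>], rule that)
    have inv2: "subst (subst s P Q) \<xi> \<eta> = s" for s
      unfolding subst_subst[OF PQ(1,2) \<xi>\<eta>(1,2)] PQ(5,6) by (rule subst_xvar_yvar)
    have inA: "subst s \<xi> \<eta> \<in> inv_ring m q \<longleftrightarrow> s \<in> inv_ring m q" for s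
      by (rule subst_in_inv_ring_iff[OF \<xi>\<eta>(1,2) _ \<zeta> \<zeta> sc]) (rule coordinates_inj[OF \<xi>\<eta>])
    have "t a = a" if a: "a \<in> inv_ring m q" for a
    proof -
      have "subst a P Q \<in> G" unfolding G using inA[of "subst a P Q"] a by (simp add: inv2)
      then have "subst (subst a P Q) (subst \<xi> X Y) (subst \<eta> X Y) = subst (subst a P Q) \<xi> \<eta>"
        unfolding GG[symmetric] by simp
      then show ?thesis unfolding t[OF a] subst_subst[OF \<xi>\<eta>(1,2) XY, symmetric] inv2 .
    qed
    then show False using nontriv by blast
  qed
  then have "G = inv_ring (2 * m) q \<or> G = inv_ring (2 * m) (m + q) \<or>
      G = {s \<in> inv_ring m q. \<forall>i j. coef s i j \<noteq> 0 \<longrightarrow> even j}"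
    using diagonal_fixed_ring[OF m \<alpha>] unfolding G_def by blast
  then show ?thesis
  proof (elim disjE)
    assume g: "G = {s \<in> inv_ring m q. \<forall>i j. coef s i j \<noteq> 0 \<longrightarrow> even j}"
    show ?thesis using cps_iso_trans[OF iso[unfolded g] even_part_iso] by blast
  qed (use iso in blast)+
qed

text \<open>A root of unity c with c^(q + 1) = \<omega> is what permits correcting the lift by an
  element of \<mu>_m into a plain exchange of coordinates. If there is none, the fixed ring is the
  twisted symmetric one, which \<open>iso0\<close> contradicts.\<close>

lemma swap_case:
  assumes m: "1 < q" "q < m" "[q ^ 2 = 1] (mod m)" and XY: "coef X 0 0 = 0" "coef Y 0 0 = 0"
    and t: "\<And>a. a \<in> inv_ring m q \<Longrightarrow> t a = subst a X Y" and hom: "cps_hom (inv_ring m q) t"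
    and \<omega>: "\<omega> ^ m = 1" "\<omega> ^ q = \<omega>" and \<zeta>: "\<And>k. \<zeta> ^ k = 1 \<longleftrightarrow> m dvd k"
    and X: "coef X 0 1 \<noteq> 0" "scale \<zeta> (\<zeta> ^ q) X = cst (\<zeta> ^ q) * X" "subst X X Y = monom2 \<omega> 1 0"
  defines "F \<equiv> {a \<in> inv_ring m q. t a = a}" and "d \<equiv> gcd (q + 1) m"
  assumes n0: "0 < n0" "coprime p0 n0" and iso0: "cps_iso F (inv_ring n0 p0)"
  shows "cps_iso F (inv_ring (m div d) ((q + 1) div d))"
proof -
  have l: "coef (monom2 \<zeta> 1 0) 0 0 = 0" "coef (monom2 (\<zeta> ^ q) 0 1) 0 0 = 0" by simp_all
  have scx: "scale \<zeta> (\<zeta> ^ q) xvar = cst \<zeta> * xvar"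
    unfolding subst_monom2[OF l] by (simp add: monom2_mult cst_1_mult)
  have x0: "coef xvar 0 0 = 0" and sx: "subst xvar X Y = X" using subst_vars[OF XY] by simp_all
  have closed: "1 \<in> F" "\<And>a b. a \<in> F \<Longrightarrow> b \<in> F \<Longrightarrow> a + b \<in> F \<and> a * b \<in> F" "\<And>a c. a \<in> F \<Longrightarrow> cst c * a \<in> F"
    unfolding F_def by (auto simp: hom_1[OF hom] hom_add[OF hom] hom_mult[OF hom] hom_cst_mult[OF hom]
        intro: inv_ring_closed cst_mult_in_inv_ring)
  show ?thesis
  proof (cases "\<exists>c. c ^ m = 1 \<and> c ^ (q + 1) = \<omega>")
    case True
    then obtain c where c: "c ^ m = 1" "c ^ (q + 1) = \<omega>" by blast
    have c0: "c \<noteq> 0" using c(1) m by (auto simp: zero_power)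
    define \<eta> where "\<eta> = cst (inverse c) * X"
    have \<xi>\<eta>: "coef xvar 0 0 = 0" "coef \<eta> 0 0 = 0"
      "coef xvar 1 0 * coef \<eta> 0 1 - coef xvar 0 1 * coef \<eta> 1 0 \<noteq> 0"
      using X(1) c0 XY by (simp_all add: \<eta>_def coef_monom2)
    have sc: "scale \<zeta> (\<zeta> ^ q) \<eta> = cst (\<zeta> ^ q) * \<eta>"
      unfolding \<eta>_def subst_mult[OF l] subst_monom2[OF l] X(2) by (simp add: mult_ac)
    have e1: "subst xvar X Y = cst c * \<eta>" unfolding sx \<eta>_def cst_mult_cst using c0 by (simp add: cst_1_mult)
    have e2: "subst \<eta> X Y = cst (c ^ q) * xvar"
    proof -
      have "inverse c * \<omega> = c ^ q" unfolding c(2)[symmetric] using c0 by simp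
      then show ?thesis unfolding \<eta>_def subst_mult[OF XY] subst_monom2[OF XY] X(3)
        by (simp add: monom2_mult)
    qed
    have "subst s (subst xvar X Y) (subst \<eta> X Y) = subst s xvar \<eta> \<longleftrightarrow> (\<forall>i j. coef s i j = coef s j i)"
      if s: "s \<in> inv_ring m q" for s
    proof -
      \<comment> \<open>diag(c, c^q) belongs to \<mu>_m and acts trivially on invariants; in the
        coordinates (x, \<eta>) only the exchange remains.\<close>
      have "scale c (c ^ q) s = s"
      proof (rule cps_eqI)
        fix i j
        have "c ^ i * (c ^ q) ^ j = 1" if ne: "coef s i j \<noteq> 0"
        proof -
          obtain k where "i + q * j = m * k" using s ne by (auto simp: inv_ring_def dvd_def)
          then have "c ^ (i + q * j) = (c ^ m) ^ k" by (simp add: power_mult)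
          then show ?thesis using c(1) by (simp add: power_add power_mult)
        qed
        then show "coef (scale c (c ^ q) s) i j = coef s i j" unfolding coef_subst_scale by auto
      qed
      then have "subst s (subst xvar X Y) (subst \<eta> X Y) = subst s \<eta> xvar"
        unfolding e1 e2 using subst_scale[OF \<xi>\<eta>(2,1), of s c "c ^ q"] by simp
      also have "\<dots> = subst (subst s yvar xvar) xvar \<eta>"
        using subst_subst[of yvar xvar xvar \<eta> s] subst_vars[OF \<xi>\<eta>(1,2)] \<xi>\<eta>(2) by simp
      finally have "subst s (subst xvar X Y) (subst \<eta> X Y) = subst s xvar \<eta> \<longleftrightarrow> subst s yvar xvar = s"
        using coordinates_inj[OF \<xi>\<eta>] by metis
      also have "\<dots> \<longleftrightarrow> (\<forall>i j. coef s i j = coef s j i)"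
        using coef_subst_swap[of s] cps_eqI[of "subst s yvar xvar" s] by metis
      finally show ?thesis .
    qed
    then have "{s \<in> inv_ring m q. subst s (subst xvar X Y) (subst \<eta> X Y) = subst s xvar \<eta>} =
        {s \<in> inv_ring m q. \<forall>i j. coef s i j = coef s j i}" by blast
    then have "cps_iso F {s \<in> inv_ring m q. \<forall>i j. coef s i j = coef s j i}"
      using fixed_ring_in_coordinates[OF XY t \<xi>\<eta> \<zeta> scx sc] unfolding F_def by simp
    moreover have "0 < m" using m by simp
    ultimately show ?thesis using symmetric_ring_iso[OF _ m(3)] cps_iso_trans unfolding d_def by blast
  next
    case False
    have \<xi>\<eta>: "coef xvar 0 0 = 0" "coef X 0 0 = 0"
      "coef xvar 1 0 * coef X 0 1 - coef xvar 0 1 * coef X 1 0 \<noteq> 0"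
      using X(1) XY by (simp_all add: coef_monom2)
    have "subst s (subst xvar X Y) (subst X X Y) = subst s xvar X \<longleftrightarrow> (\<forall>i j. coef s i j = \<omega> ^ i * coef s j i)" for s
    proof -
      have v: "coef yvar 0 0 = 0" "coef (monom2 \<omega> 1 0) 0 0 = 0" by simp_all
      have "subst (monom2 \<omega> 1 0) xvar X = monom2 \<omega> 1 0"
        unfolding subst_monom2[OF \<xi>\<eta>(1,2)] by (simp add: monom2_mult)
      then have "subst s (subst xvar X Y) (subst X X Y) = subst (subst s yvar (monom2 \<omega> 1 0)) xvar X"
        unfolding sx X(3) using subst_subst[OF v \<xi>\<eta>(1,2), of s] subst_vars(2)[OF \<xi>\<eta>(1,2)] by simp
      then have "subst s (subst xvar X Y) (subst X X Y) = subst s xvar X \<longleftrightarrow> subst s yvar (monom2 \<omega> 1 0) = s"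
        using coordinates_inj[OF \<xi>\<eta>] by metis
      also have "\<dots> \<longleftrightarrow> (\<forall>i j. coef s i j = \<omega> ^ i * coef s j i)"
        unfolding coef_subst_twisted_swap[symmetric] using cps_eqI[of "subst s yvar (monom2 \<omega> 1 0)" s] by metis
      finally show ?thesis .
    qed
    then have "cps_iso F {s \<in> inv_ring m q. \<forall>i j. coef s i j = \<omega> ^ i * coef s j i}"
      using fixed_ring_in_coordinates[OF XY t \<xi>\<eta> \<zeta> scx X(2)] unfolding F_def by simp
    then have "cps_iso (inv_ring n0 p0) {s \<in> inv_ring m q. \<forall>i j. coef s i j = \<omega> ^ i * coef s j i}"
      by (rule cps_iso_rev_trans[OF iso0]) (use closed in auto)
    then show ?thesis using twisted_symmetric_ring_not_cyclic[OF m \<omega> _ n0] False by blast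
  qed
qed

text \<open>The linear parts of \<open>X\<close> and \<open>Y\<close> are eigenvectors of
  diag(\<zeta>, \<zeta>^q). For q = 1 this is no restriction, and the linear part of the lift has to
  be diagonalised; for q different from 1 it is diagonal or antidiagonal from the start.\<close>

lemma involution_quotient:
  assumes q: "0 < q" "q < m" "coprime q m" and hom: "cps_hom (inv_ring m q) t"
    and tA: "\<And>a. a \<in> inv_ring m q \<Longrightarrow> t a \<in> inv_ring m q" and inv: "\<And>a. a \<in> inv_ring m q \<Longrightarrow> t (t a) = a"
    and nontriv: "\<exists>a\<in>inv_ring m q. t a \<noteq> a"
  defines "F \<equiv> {a \<in> inv_ring m q. t a = a}" and "d \<equiv> gcd (q + 1) m"
  assumes n0: "0 < n0" "coprime p0 n0" and iso0: "cps_iso F (inv_ring n0 p0)"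
  shows "cps_iso F (inv_ring (2 * m) q) \<or> cps_iso F (inv_ring (2 * m) (m + q)) \<or> cps_iso F (inv_ring m (2 * q)) \<or>
    [q ^ 2 = 1] (mod m) \<and> cps_iso F (inv_ring (m div d) ((q + 1) div d))"
proof -
  have m: "0 < m" using q by simp
  obtain X Y \<omega> where XY: "coef X 0 0 = 0" "coef Y 0 0 = 0" and t: "\<And>a. a \<in> inv_ring m q \<Longrightarrow> t a = subst a X Y"
    and \<omega>: "\<omega> ^ m = 1" and X2: "subst X X Y = monom2 \<omega> 1 0" and Y2: "subst Y X Y = monom2 (\<omega> ^ q) 0 1"
    by (rule involution_lift[OF m q(3) hom tA inv], assumption, assumption, rule that)
  obtain \<zeta> :: complex where \<zeta>: "\<And>k. \<zeta> ^ k = 1 \<longleftrightarrow> m dvd k" using primitive_root_exists[OF m] by blast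
  have \<omega>0: "\<omega> \<noteq> 0" using \<omega> m by (auto simp: zero_power)
  define a b c d' where "a = coef X 1 0" and "b = coef X 0 1" and "c = coef Y 1 0" and "d' = coef Y 0 1"
  have L: "a * a + b * c = \<omega>" "a * b + b * d' = 0" "c * a + d' * c = 0" "c * b + d' * d' = \<omega> ^ q"
    using linear_coef_subst[OF XY, of X] linear_coef_subst[OF XY, of Y]
    unfolding X2 Y2 by (simp_all add: a_def b_def c_def d'_def coef_monom2)
  have xA: "monom2 1 m 0 \<in> inv_ring m q" "monom2 1 0 m \<in> inv_ring m q" by (rule monom2_in_inv_ring, simp)+
  have "X ^ m \<in> inv_ring m q" "Y ^ m \<in> inv_ring m q"
    using tA[OF xA(1)] tA[OF xA(2)] unfolding t[OF xA(1)] t[OF xA(2)] subst_monom2[OF XY] by (simp_all add: cst_1_mult)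
  then obtain \<theta> \<theta>' where \<theta>: "scale \<zeta> (\<zeta> ^ q) X = cst \<theta> * X" and \<theta>': "scale \<zeta> (\<zeta> ^ q) Y = cst \<theta>' * Y"
    using semi_invariant[OF _ m \<zeta>] by metis
  have lX: "\<zeta> * a = \<theta> * a" "\<zeta> ^ q * b = \<theta> * b" using semi_invariant_linear[OF \<theta>] by (simp_all add: a_def b_def)
  have lY: "\<zeta> * c = \<theta>' * c" "\<zeta> ^ q * d' = \<theta>' * d'" using semi_invariant_linear[OF \<theta>'] by (simp_all add: c_def d'_def)
  have l: "coef (monom2 \<zeta> 1 0) 0 0 = 0" "coef (monom2 (\<zeta> ^ q) 0 1) 0 0 = 0" by simp_all
  have scx: "scale \<zeta> (\<zeta> ^ q) xvar = cst \<zeta> * xvar" and scy: "scale \<zeta> (\<zeta> ^ q) yvar = cst (\<zeta> ^ q) * yvar"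
    unfolding subst_monom2[OF l] by (simp_all add: monom2_mult cst_1_mult)
  have csl: "scale \<zeta> (\<zeta> ^ q) (cst k) = cst k" for k using subst_monom2[OF l, of k 0 0] by simp
  have csX: "subst (cst k) X Y = cst k" for k using subst_monom2[OF XY, of k 0 0] by simp
  note sv = subst_vars[OF XY]
  show ?thesis
  proof (cases "q = 1")
    case q1: True
    have "a \<noteq> 0 \<or> b \<noteq> 0" using L(1) \<omega>0 by auto
    then have \<theta>1: "\<theta> = \<zeta>" using lX q1 by auto
    have "c \<noteq> 0 \<or> d' \<noteq> 0" using L(4) \<omega>0 by auto
    then have \<theta>1': "\<theta>' = \<zeta>" using lY q1 by auto
    have L4: "c * b + d' * d' = \<omega>" using L(4) q1 by simp
    obtain \<alpha> p r \<alpha>' p' r' where \<alpha>: "\<alpha> ^ 2 = \<omega>" "p * a + r * c = \<alpha> * p" "p * b + r * d' = \<alpha> * r"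
      and \<alpha>': "\<alpha>' ^ 2 = \<omega>" "p' * a + r' * c = \<alpha>' * p'" "p' * b + r' * d' = \<alpha>' * r'" and det: "p * r' - r * p' \<noteq> 0"
      by (rule involution_eigenvectors[OF L(1-3) L4 \<omega>0], rule that)
    \<comment> \<open>Averaging: for a linear form l, the lift squares to \<omega> = \<alpha>^2 on
      l, so \<alpha> l plus the image of l is an exact eigenvector for \<alpha>. If l is a left
      eigenvector of the linear part, this series has linear part 2 \<alpha> l, so two of them form
      coordinates.\<close>
    define lf where "lf = (\<lambda>\<alpha> p r. cst \<alpha> * (cst p * xvar + cst r * yvar) + (cst p * X + cst r * Y))"
    have lf0: "coef (lf \<alpha> p r) 0 0 = 0" for \<alpha> p r using XY by (simp add: lf_def)
    have lfsc: "scale \<zeta> (\<zeta> ^ q) (lf \<alpha> p r) = cst \<zeta> * lf \<alpha> p r" for \<alpha> p r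
      unfolding lf_def subst_add[OF l] subst_mult[OF l] csl scx scy \<theta> \<theta>' \<theta>1 \<theta>1' using q1
      by (simp add: algebra_simps)
    have lfX: "subst (lf \<alpha> p r) X Y = cst \<alpha> * lf \<alpha> p r" if "\<alpha> ^ 2 = \<omega>" for \<alpha> p r
    proof -
      have e: "monom2 \<omega> 1 0 = cst \<alpha> * (cst \<alpha> * xvar)" "monom2 (\<omega> ^ q) 0 1 = cst \<alpha> * (cst \<alpha> * yvar)"
        using that q1 by (simp_all add: monom2_mult power2_eq_square)
      have "subst (lf \<alpha> p r) X Y = cst \<alpha> * (cst p * X + cst r * Y) + (cst p * monom2 \<omega> 1 0 + cst r * monom2 (\<omega> ^ q) 0 1)"
        unfolding lf_def subst_add[OF XY] subst_mult[OF XY] csX sv X2 Y2 ..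
      also have "\<dots> = cst \<alpha> * lf \<alpha> p r" unfolding e lf_def by (simp only: distrib_left mult_ac add_ac)
      finally show ?thesis .
    qed
    have lfl: "coef (lf \<alpha> p r) 1 0 = 2 * \<alpha> * p" "coef (lf \<alpha> p r) 0 1 = 2 * \<alpha> * r"
      if "p * a + r * c = \<alpha> * p" "p * b + r * d' = \<alpha> * r" for \<alpha> p r
      using that by (simp_all add: lf_def a_def b_def c_def d'_def coef_monom2)
    have "coef (lf \<alpha> p r) 1 0 * coef (lf \<alpha>' p' r') 0 1 - coef (lf \<alpha> p r) 0 1 * coef (lf \<alpha>' p' r') 1 0 = 4 * \<alpha> * \<alpha>' * (p * r' - r * p')"
      unfolding lfl[OF \<alpha>(2,3)] lfl[OF \<alpha>'(2,3)] by (simp add: algebra_simps)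
    moreover have "\<alpha> \<noteq> 0" "\<alpha>' \<noteq> 0" using \<alpha>(1) \<alpha>'(1) \<omega>0 by auto
    ultimately have det': "coef (lf \<alpha> p r) 1 0 * coef (lf \<alpha>' p' r') 0 1 - coef (lf \<alpha> p r) 0 1 * coef (lf \<alpha>' p' r') 1 0 \<noteq> 0"
      using det by simp
    have q': "\<alpha>' ^ 2 = \<omega> ^ q" "scale \<zeta> (\<zeta> ^ q) (lf \<alpha>' p' r') = cst (\<zeta> ^ q) * lf \<alpha>' p' r'"
      using \<alpha>'(1) lfsc[of \<alpha>' p' r'] q1 by simp_all
    have "cps_iso F (inv_ring (2 * m) q) \<or> cps_iso F (inv_ring (2 * m) (m + q)) \<or> cps_iso F (inv_ring m (2 * q))"
      unfolding F_def
      by (rule diagonal_case[OF m q(3) XY t nontriv \<alpha>(1) q'(1) \<omega> \<zeta> lf0 lf0 det' lfsc q'(2) lfX[OF \<alpha>(1)] lfX[OF \<alpha>'(1)]])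
    then show ?thesis by blast
  next
    case False
    then have \<zeta>q: "\<zeta> \<noteq> \<zeta> ^ q" using primitive_root_power_eq[OF \<zeta> m, of 1 q] q by (auto simp: cong_def)
    have ab: "a = 0 \<or> b = 0" using lX \<zeta>q by auto
    have cd: "c = 0 \<or> d' = 0" using lY \<zeta>q by auto
    show ?thesis
    proof (cases "a = 0")
      case a0: False
      then have b0: "b = 0" using ab by simp
      then have d2: "d' ^ 2 = \<omega> ^ q" and a2: "a ^ 2 = \<omega>" using L by (simp_all add: power2_eq_square)
      then have d0: "d' \<noteq> 0" using \<omega>0 by auto
      then have c0: "c = 0" using cd by simp
      have \<theta>1: "\<theta> = \<zeta>" "\<theta>' = \<zeta> ^ q" using lX lY a0 d0 by auto
      \<comment> \<open>The same averaging on each axis, with the diagonal entries as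
        eigenvalues.\<close>
      define \<xi> \<eta> where "\<xi> = cst a * xvar + X" and "\<eta> = cst d' * yvar + Y"
      have 0: "coef \<xi> 0 0 = 0" "coef \<eta> 0 0 = 0" using XY by (simp_all add: \<xi>_def \<eta>_def)
      have det: "coef \<xi> 1 0 * coef \<eta> 0 1 - coef \<xi> 0 1 * coef \<eta> 1 0 \<noteq> 0"
        using a0 d0 b0 c0 by (simp add: \<xi>_def \<eta>_def coef_monom2 a_def b_def c_def d'_def)
      have sc: "scale \<zeta> (\<zeta> ^ q) \<xi> = cst \<zeta> * \<xi>" "scale \<zeta> (\<zeta> ^ q) \<eta> = cst (\<zeta> ^ q) * \<eta>"
        unfolding \<xi>_def \<eta>_def subst_add[OF l] subst_mult[OF l] csl scx scy \<theta> \<theta>' \<theta>1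
        by (simp_all add: algebra_simps)
      have e: "monom2 \<omega> 1 0 = cst a * (cst a * xvar)" "monom2 (\<omega> ^ q) 0 1 = cst d' * (cst d' * yvar)"
        using a2 d2 by (simp_all add: monom2_mult power2_eq_square)
      have eig: "subst \<xi> X Y = cst a * \<xi>" "subst \<eta> X Y = cst d' * \<eta>"
        unfolding \<xi>_def \<eta>_def subst_add[OF XY] subst_mult[OF XY] csX sv X2 Y2 e
        by (simp_all add: algebra_simps)
      have "cps_iso F (inv_ring (2 * m) q) \<or> cps_iso F (inv_ring (2 * m) (m + q)) \<or> cps_iso F (inv_ring m (2 * q))"
        unfolding F_def by (rule diagonal_case[OF m q(3) XY t nontriv a2 d2 \<omega> \<zeta> 0 det sc eig])
      then show ?thesis by blast
    next
      case a0: True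
      then have bc: "b * c = \<omega>" "b \<noteq> 0" "c \<noteq> 0" using L(1) \<omega>0 by auto
      then have d0: "d' = 0" using cd by simp
      have \<omega>q: "\<omega> ^ q = \<omega>" using L(4) bc(1) d0 by (simp add: mult.commute)
      have \<theta>1: "\<theta> = \<zeta> ^ q" "\<theta>' = \<zeta>" using lX lY bc by auto
      \<comment> \<open>\<open>X\<close> and \<open>Y\<close> have the exchanged weights \<zeta>^q
        and \<zeta>. Invariance of X^e Y, the image of x^e y, gives m | q e + 1, and e is congruent
        to -q, whence q^2 = 1 modulo m.\<close>
      define e where "e = (m - 1) * q"
      have eq: "e + q = m * q" using m by (cases m) (auto simp: e_def)
      have "monom2 1 e 1 \<in> inv_ring m q" by (rule monom2_in_inv_ring) (simp add: eq)
      note eA = this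
      have "X ^ e * Y \<in> inv_ring m q" using tA[OF eA] unfolding t[OF eA] subst_monom2[OF XY] by (simp add: cst_1_mult)
      then have "scale \<zeta> (\<zeta> ^ q) (X ^ e * Y) = X ^ e * Y" unfolding inv_ring_iff_scale[OF \<zeta>] .
      then have "(cst (\<zeta> ^ q) * X) ^ e * (cst \<zeta> * Y) = X ^ e * Y"
        unfolding subst_mult[OF l] subst_power[OF l] \<theta> \<theta>' \<theta>1 .
      then have "cst ((\<zeta> ^ q) ^ e * \<zeta>) * (X ^ e * Y) = X ^ e * Y"
        by (simp add: power_mult_distrib cst_power monom2_mult mult_ac)
      moreover have "X ^ e * Y \<noteq> 0"
        using bc(2,3) by (auto simp: b_def c_def)
      ultimately have "cst ((\<zeta> ^ q) ^ e * \<zeta>) = 1" by auto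
      from arg_cong[OF this, of "\<lambda>s. coef s 0 0"] have "(\<zeta> ^ q) ^ e * \<zeta> = 1" by simp
      then have "\<zeta> ^ (q * e + 1) = 1" by (simp only: power_add power_mult power_one_right)
      then have "m dvd q * e + 1" by (simp only: \<zeta>)
      moreover have "m dvd q * e + q ^ 2"
      proof -
        have "q * e + q ^ 2 = m * (q * q)" using eq by (metis distrib_left mult.left_commute power2_eq_square)
        then show ?thesis by simp
      qed
      ultimately have "[q * e + q ^ 2 = q * e + 1] (mod m)" by (metis cong_0_iff cong_sym cong_trans)
      then have qq: "[q ^ 2 = 1] (mod m)" by (simp only: cong_add_lcancel_nat)
      have q1: "1 < q" using False q by simp
      have "cps_iso F (inv_ring (m div d) ((q + 1) div d))"
        unfolding F_def d_def
        by (rule swap_case[OF q1 q(2) qq XY t hom \<omega> \<omega>q \<zeta> _ _ X2 n0 iso0[unfolded F_def]])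
           (use bc \<theta> \<theta>1 in \<open>auto simp: b_def\<close>)
      then show ?thesis using qq by blast
    qed
  qed
qed

theorem theorem5p1:
  fixes m q :: nat and \<tau> :: "ps2 \<Rightarrow> ps2"
  assumes "0 < q" and "q < m" and "coprime q m"
    and "is_involution (cqs_ring m q) \<tau>"
    and "(\<exists>m0 q0. 0 < q0 \<and> q0 < m0 \<and> coprime q0 m0 \<and>
                 alg_iso (fixed_ring (cqs_ring m q) \<tau>) (cqs_ring m0 q0))
         \<or> alg_iso (fixed_ring (cqs_ring m q) \<tau>) smooth_ring"
  shows "(alg_iso (fixed_ring (cqs_ring m q) \<tau>) smooth_ring \<longrightarrow> q = m - 1) \<and>
         ((alg_iso (fixed_ring (cqs_ring m q) \<tau>) smooth_ring \<and> q = m - 1)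
          \<or> alg_iso (fixed_ring (cqs_ring m q) \<tau>) (cqs_ring (2 * m) q)
          \<or> alg_iso (fixed_ring (cqs_ring m q) \<tau>) (cqs_ring (2 * m) (m + q))
          \<or> alg_iso (fixed_ring (cqs_ring m q) \<tau>) (cqs_ring m (2 * q))
          \<or> (even m \<and> alg_iso (fixed_ring (cqs_ring m q) \<tau>) (cqs_ring (m div 2) q))
          \<or> (alg_iso (fixed_ring (cqs_ring m q) \<tau>)
               (cqs_ring (m div gcd (q + 1) m) ((q + 1) div gcd (q + 1) m))
             \<and> [q ^ 2 = 1] (mod m) \<and> q \<noteq> m - 1))"
proof -
  let ?A = "inv_ring m q"
  define t where "t = (\<lambda>s. Cps (\<tau> (coef s)))"
  define F where "F = {a \<in> ?A. t a = a}"
  have inv\<tau>: "alg_hom (coef ` ?A) (coef ` ?A) \<tau>" "\<And>a. a \<in> coef ` ?A \<Longrightarrow> \<tau> (\<tau> a) = a" "\<exists>a\<in>coef ` ?A. \<tau> a \<noteq> a"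
    using assms(4) unfolding cqs_ring_eq is_involution_def by blast+
  have sub: "coef ` ?A \<subseteq> Collect convergent_ps2" by auto
  have hom: "cps_hom ?A t" unfolding t_def by (rule alg_hom_imp_cps_hom(1)[OF inv\<tau>(1) sub])
  have ct: "coef (t s) = \<tau> (coef s)" if "s \<in> ?A" for s
    unfolding t_def by (rule alg_hom_imp_cps_hom(2)[OF inv\<tau>(1) sub that])
  have tA: "t s \<in> ?A" if s: "s \<in> ?A" for s
  proof -
    have "coef (t s) \<in> coef ` ?A" using inv\<tau>(1) s unfolding ct[OF s] alg_hom_def by blast
    then show ?thesis by (auto simp: coef_inject)
  qed
  have tt: "t (t s) = s" if s: "s \<in> ?A" for s
  proof -
    have "coef (t (t s)) = coef s" unfolding ct[OF tA[OF s]] ct[OF s] using inv\<tau>(2) s by blast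
    then show ?thesis by (simp only: coef_inject)
  qed
  have nontriv: "\<exists>a\<in>?A. t a \<noteq> a" using inv\<tau>(3) ct by fastforce
  have fixed: "fixed_ring (cqs_ring m q) \<tau> = coef ` F"
    unfolding fixed_ring_def cqs_ring_eq F_def using ct by (auto simp: coef_inject[symmetric])
  have iso: "alg_iso (fixed_ring (cqs_ring m q) \<tau>) (cqs_ring n p) \<longleftrightarrow> cps_iso F (inv_ring n p)" for n p
    unfolding fixed cqs_ring_eq[of n p] by (rule alg_iso_iff_cps_iso)
  have smooth: "alg_iso (fixed_ring (cqs_ring m q) \<tau>) smooth_ring \<longleftrightarrow> cps_iso F UNIV"
    unfolding fixed smooth_ring_eq by (rule alg_iso_iff_cps_iso)
  obtain n0 p0 where n0: "0 < n0" "coprime p0 n0" "cps_iso F (inv_ring n0 p0)"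
  proof -
    consider n0 p0 where "p0 < n0" "coprime p0 n0" "cps_iso F (inv_ring n0 p0)" | "cps_iso F UNIV"
      using assms(5) unfolding iso smooth by blast
    then show ?thesis
    proof cases
      case (1 n0 p0)
      then show ?thesis using that[of n0 p0] by simp
    next
      case 2
      \<comment> \<open>A smooth point is the case n0 = 1, whose invariant ring is the whole
        ring.\<close>
      then show ?thesis using that[of "Suc 0" "Suc 0"] by simp
    qed
  qed
  let ?d = "gcd (q + 1) m"
  have cases: "cps_iso F (inv_ring (2 * m) q) \<or> cps_iso F (inv_ring (2 * m) (m + q)) \<or> cps_iso F (inv_ring m (2 * q)) \<or>
    [q ^ 2 = 1] (mod m) \<and> cps_iso F (inv_ring (m div ?d) ((q + 1) div ?d))"
    unfolding F_def
    by (rule involution_quotient[OF assms(1-3) hom tA tt nontriv n0(1,2) n0(3)[unfolded F_def]])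
  have closed: "1 \<in> F" "\<And>a b. a \<in> F \<Longrightarrow> b \<in> F \<Longrightarrow> a + b \<in> F \<and> a * b \<in> F" "\<And>a c. a \<in> F \<Longrightarrow> cst c * a \<in> F"
    unfolding F_def by (auto simp: hom_1[OF hom] hom_add[OF hom] hom_mult[OF hom] hom_cst_mult[OF hom]
        intro: inv_ring_closed cst_mult_in_inv_ring)
  \<comment> \<open>Smoothness is tested on each candidate: it makes n divide p. This excludes the
    two rings of order 2m, leaves only m = 2 for the pair (m, 2q), and gives m | q + 1 for the
    last.\<close>
  have dvd: "n dvd p" if "cps_iso F UNIV" "cps_iso F (inv_ring n p)" "0 < n" for n p
  proof -
    have "cps_iso (inv_ring n p) UNIV"
      by (rule cps_iso_rev_trans[OF that(2,1)]) (use closed in auto)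
    then show ?thesis by (rule inv_ring_not_smooth[OF _ that(3)])
  qed
  have m: "0 < m" using assms by simp
  have d: "?d dvd m" "?d dvd q + 1" "0 < ?d" using m by auto
  have "q = m - 1" if s: "cps_iso F UNIV"
    using cases
  proof (elim disjE conjE)
    assume "cps_iso F (inv_ring (2 * m) q)"
    then have "2 * m dvd q" using dvd[OF s] m by simp
    then show ?thesis using assms by (auto dest: dvd_imp_le)
  next
    assume "cps_iso F (inv_ring (2 * m) (m + q))"
    then have "2 * m dvd m + q" using dvd[OF s] m by simp
    then show ?thesis using assms by (auto dest: dvd_imp_le)
  next
    assume "cps_iso F (inv_ring m (2 * q))"
    then have "m dvd 2 * q" using dvd[OF s] m by simp
    then have "m dvd 2" using assms(3) by (simp add: coprime_commute coprime_dvd_mult_left_iff)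
    then have "m \<le> 2" by (rule dvd_imp_le) simp
    then show ?thesis using assms by linarith
  next
    assume "cps_iso F (inv_ring (m div ?d) ((q + 1) div ?d))"
    then have "m div ?d dvd (q + 1) div ?d" using dvd[OF s] d m by (simp add: div_greater_zero_iff dvd_imp_le)
    then have "m dvd q + 1" using d by (metis dvd_div_mult_self mult_dvd_mono dvd_refl)
    then have "m \<le> q + 1" by (rule dvd_imp_le) simp
    then show ?thesis using assms by linarith
  qed
  moreover have "(cps_iso F UNIV \<and> q = m - 1) \<or> cps_iso F (inv_ring (2 * m) q) \<or> cps_iso F (inv_ring (2 * m) (m + q)) \<or>
      cps_iso F (inv_ring m (2 * q)) \<or>
      cps_iso F (inv_ring (m div ?d) ((q + 1) div ?d)) \<and> [q ^ 2 = 1] (mod m) \<and> q \<noteq> m - 1"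
  proof (cases "q = m - 1")
    case True
    \<comment> \<open>For q = m - 1 the gcd is m and the last ring is that of a smooth point, so
      this outcome belongs to (a).\<close>
    then have "m div ?d = Suc 0" using m by simp
    then show ?thesis using cases True by auto
  next
    case False
    then show ?thesis using cases by blast
  qed
  ultimately show ?thesis unfolding iso smooth by blast
qed

end
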